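(* Let $(A,\mathfrak m)$ be a Noetherian local ring with infinite residue field and let $I$ be a regular ideal of $A$ with analytic spread one and reduction number $r$. The following conditions are equivalent, where each of (2)–(7) may be read either with "every" or with "some" minimal reduction (all resulting conditions being equivalent): (1) $F(I)$ is a Cohen-Macaulay ring. (2) For every (some) minimal reduction $(a)$ of $I$, $I^n\cap(\mathfrak m I^{n+1}:a)=\mathfrak m I^n$ for $1\leq n\leq r-1$. (3) For every (some) minimal reduction $(a)$ of $I$, $\lambda(F(I)/aF(I))=\mu(I^r)$. (4) For every (some) minimal reduction $(a)$ of $I$, $I^k\cap(\mathfrak m I^r:a^{r-k})=\mathfrak m I^k$ for $1\leq k\leq r-1$. (5) For every (some) minimal reduction $(a)$ of $I$, $aI^n\cap\mathfrak m I^{n+1}=a\mathfrak m I^n$ for $1\leq n\leq r-1$. (6) For every (some) minimal reduction $(a)$ of $I$, $\lambda(I^n/(\mathfrak m I^n+aI^{n-1}))=\mu(I^n)-\mu(I^{n-1})$ for $1\leq n\leq r$. (7) For every (some) minimal reduction $J=(a)$ of $I$ the decomposition of $F(I)$ as a graded $F(J)$-module has the form $$F(I)\cong\bigoplus_{i=0}^{r}F(J)(-i)^{\mu(I^i)-\mu(I^{i-1})}.$$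
   Context: For an ideal $L$ of $A$, $F(L)=\bigoplus_{n\ge0}L^n/\mathfrak m L^n$ (with $L^0=A$) is its fiber cone; the analytic spread of $I$ is $l(I)=\dim F(I)$. An ideal is regular if it contains a non-zero-divisor of $A$. A reduction of $I$ is an ideal $J\subseteq I$ with $I^{n+1}=JI^n$ for some $n$; it is minimal if it is minimal under inclusion among reductions. When $l(I)=1$ (and the residue field is infinite) the minimal reductions of $I$ are principal, $J=(a)$; for $I$ regular of analytic spread one, the least $r$ with $I^{r+1}=JI^r$ does not depend on the minimal reduction $J$ and is called the reduction number $r$ of $I$. For $a\in I$, $a^0$ is the class of $a$ in $I/\mathfrak m I=F(I)_1$, and $aF(I)$ means $a^0F(I)$. For a minimal reduction $J=(a)$, $F(J)\subseteq F(I)$ is a polynomial ring in the one variable $a^0$ over $A/\mathfrak m$ and $F(I)$ is a finitely generated graded $F(J)$-module; $M(-i)_n=M_{n-i}$. $\lambda$ denotes length, $\mu$ the minimal number of generators, with conventions $\mu(I^0)=1$ and $\mu(I^n)=0$ for $n<0$. Colons are taken in $A$. *)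

theory Defs
  imports "HOL-Library.Extended_Real" "HOL-Algebra.Algebra"
begin

section \<open>Local rings, ideals and reductions\<close>

locale noetherian_local_ring = noetherian_ring R + cring R for R (structure) +
  fixes m
  assumes maximal: "maximalideal m R"
    and maximal_unique: "maximalideal n R \<Longrightarrow> n = m"

primrec ideal_pow :: "('a, 'b) ring_scheme \<Rightarrow> 'a set \<Rightarrow> nat \<Rightarrow> 'a set" where
  "ideal_pow R L 0 = carrier R"
| "ideal_pow R L (Suc n) = L \<cdot>\<^bsub>R\<^esub> ideal_pow R L n"

definition colon :: "('a, 'b) ring_scheme \<Rightarrow> 'a set \<Rightarrow> 'a \<Rightarrow> 'a set" where
  "colon R K x = {y \<in> carrier R. x \<otimes>\<^bsub>R\<^esub> y \<in> K}"

definition nonzerodivisor :: "('a, 'b) ring_scheme \<Rightarrow> 'a \<Rightarrow> bool" where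
  "nonzerodivisor R x \<longleftrightarrow>
     x \<in> carrier R \<and> (\<forall>y\<in>carrier R. x \<otimes>\<^bsub>R\<^esub> y = \<zero>\<^bsub>R\<^esub> \<longrightarrow> y = \<zero>\<^bsub>R\<^esub>)"

definition regular_ideal :: "('a, 'b) ring_scheme \<Rightarrow> 'a set \<Rightarrow> bool" where
  "regular_ideal R I \<longleftrightarrow> ideal I R \<and> (\<exists>x\<in>I. nonzerodivisor R x)"

definition reduction :: "('a, 'b) ring_scheme \<Rightarrow> 'a set \<Rightarrow> 'a set \<Rightarrow> bool" where
  "reduction R I J \<longleftrightarrow> ideal J R \<and> J \<subseteq> I \<and>
     (\<exists>n. ideal_pow R I (n + 1) = J \<cdot>\<^bsub>R\<^esub> ideal_pow R I n)"

definition minimal_reduction :: "('a, 'b) ring_scheme \<Rightarrow> 'a set \<Rightarrow> 'a set \<Rightarrow> bool" where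
  "minimal_reduction R I J \<longleftrightarrow> reduction R I J \<and>
     (\<forall>K. reduction R I K \<and> K \<subseteq> J \<longrightarrow> K = J)"

text \<open>For regular ideals of analytic spread one (over an infinite residue field) the number below
  is the same for all minimal reductions; being attained for some of them is therefore the weakest
  way to say that \<open>r\<close> is the reduction number.\<close>

definition is_reduction_number :: "('a, 'b) ring_scheme \<Rightarrow> 'a set \<Rightarrow> nat \<Rightarrow> bool" where
  "is_reduction_number R I r \<longleftrightarrow> (\<exists>J. minimal_reduction R I J \<and>
     r = (LEAST n. ideal_pow R I (n + 1) = J \<cdot>\<^bsub>R\<^esub> ideal_pow R I n))"

definition min_gens :: "('a, 'b) ring_scheme \<Rightarrow> 'a set \<Rightarrow> nat" where
  "min_gens R I = (LEAST k. \<exists>S. S \<subseteq> carrier R \<and> finite S \<and> card S = k \<and> Idl\<^bsub>R\<^esub> S = I)"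

text \<open>The minimal number of generators of \<open>I\<^sup>n\<close> for an integer \<open>n\<close>, with its conventions for \<open>n \<le> 0\<close>.\<close>

definition mu_pow :: "('a, 'b) ring_scheme \<Rightarrow> 'a set \<Rightarrow> int \<Rightarrow> nat" where
  "mu_pow R I n = (if n < 0 then 0 else if n = 0 then 1 else min_gens R (ideal_pow R I (nat n)))"


section \<open>Dimension, depth and Cohen--Macaulay rings\<close>

definition krull_dim :: "('a, 'b) ring_scheme \<Rightarrow> enat" where
  "krull_dim R = Sup {enat n | n. \<exists>P :: nat \<Rightarrow> 'a set.
     (\<forall>i\<le>n. primeideal (P i) R) \<and> (\<forall>i<n. P i \<subset> P (Suc i))}"

definition height :: "('a, 'b) ring_scheme \<Rightarrow> 'a set \<Rightarrow> enat" where
  "height R Q = Sup {enat n | n. \<exists>P :: nat \<Rightarrow> 'a set.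
     (\<forall>i\<le>n. primeideal (P i) R) \<and> (\<forall>i<n. P i \<subset> P (Suc i)) \<and> P n = Q}"

definition regular_sequence :: "('a, 'b) ring_scheme \<Rightarrow> 'a list \<Rightarrow> bool" where
  "regular_sequence R xs \<longleftrightarrow> set xs \<subseteq> carrier R \<and> Idl\<^bsub>R\<^esub> (set xs) \<noteq> carrier R \<and>
     (\<forall>i<length xs. \<forall>y\<in>carrier R.
        xs ! i \<otimes>\<^bsub>R\<^esub> y \<in> Idl\<^bsub>R\<^esub> (set (take i xs)) \<longrightarrow> y \<in> Idl\<^bsub>R\<^esub> (set (take i xs)))"

definition depth :: "('a, 'b) ring_scheme \<Rightarrow> 'a set \<Rightarrow> enat" where
  "depth R Q = Sup {enat (length xs) | xs. set xs \<subseteq> Q \<and> regular_sequence R xs}"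

text \<open>The definition for not necessarily local rings in Kaplansky, \<open>Commutative Rings\<close>, 3-1, and
  Eisenbud, \<open>Commutative Algebra\<close>, 18.2.\<close>

definition cohen_macaulay :: "('a, 'b) ring_scheme \<Rightarrow> bool" where
  "cohen_macaulay R \<longleftrightarrow> cring R \<and> noetherian_ring R \<and>
     (\<forall>P. maximalideal P R \<longrightarrow> depth R P = height R P)"


section \<open>Modules\<close>

text \<open>For ideals \<open>K \<subseteq> N\<close>, the \<open>R\<close>-module \<open>N/K\<close> of cosets. The ring multiplication and unit that
  the library's module record carries along are irrelevant for a module.\<close>

definition quot_module :: "('a, 'b) ring_scheme \<Rightarrow> 'a set \<Rightarrow> 'a set \<Rightarrow> ('a, 'a set) module" where
  "quot_module R N K =
     \<lparr>carrier = (\<lambda>x. K +>\<^bsub>R\<^esub> x) ` N, monoid.mult = undefined, monoid.one = undefined,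
      ring.zero = K, ring.add = set_add R,
      smult = (\<lambda>c B. \<Union>x\<in>B. K +>\<^bsub>R\<^esub> (c \<otimes>\<^bsub>R\<^esub> x))\<rparr>"

definition module_length :: "('a, 'b) ring_scheme \<Rightarrow> ('a, 'c, 'd) module_scheme \<Rightarrow> enat" where
  "module_length R M = Sup {enat n | n. \<exists>N :: nat \<Rightarrow> 'c set.
     (\<forall>i\<le>n. submodule (N i) R M) \<and> (\<forall>i<n. N i \<subset> N (Suc i))}"

record ('a, 'b) graded_module = "('a, 'b) module" +
  degree_part :: "int \<Rightarrow> 'b set"

text \<open>\<open>graded_shift M d\<close> is \<open>M(d)\<close>, that is, \<open>M(d)\<^sub>n = M\<^sub>n\<^sub>+\<^sub>d\<close>.\<close>

definition graded_shift :: "('a, 'c) graded_module \<Rightarrow> int \<Rightarrow> ('a, 'c) graded_module" where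
  "graded_shift M d = M\<lparr>degree_part := \<lambda>n. degree_part M (n + d)\<rparr>"

text \<open>The direct sum over a \<^emph>\<open>finite\<close> index set \<open>K\<close>.\<close>

definition graded_sum ::
    "'k set \<Rightarrow> ('k \<Rightarrow> ('a, 'c) graded_module) \<Rightarrow> ('a, 'k \<Rightarrow> 'c) graded_module" where
  "graded_sum K M =
     \<lparr>carrier = (\<Pi>\<^sub>E k\<in>K. carrier (M k)), monoid.mult = undefined, monoid.one = undefined,
      ring.zero = (\<lambda>k\<in>K. \<zero>\<^bsub>M k\<^esub>), ring.add = (\<lambda>f g. \<lambda>k\<in>K. f k \<oplus>\<^bsub>M k\<^esub> g k),
      smult = (\<lambda>c f. \<lambda>k\<in>K. c \<odot>\<^bsub>M k\<^esub> f k),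
      degree_part = (\<lambda>n. \<Pi>\<^sub>E k\<in>K. degree_part (M k) n)\<rparr>"

definition graded_isomorphic ::
    "('a, 'b) ring_scheme \<Rightarrow> ('a, 'c) graded_module \<Rightarrow> ('a, 'd) graded_module \<Rightarrow> bool" where
  "graded_isomorphic R M N \<longleftrightarrow> (\<exists>h. bij_betw h (carrier M) (carrier N) \<and>
     (\<forall>x\<in>carrier M. \<forall>y\<in>carrier M. h (x \<oplus>\<^bsub>M\<^esub> y) = h x \<oplus>\<^bsub>N\<^esub> h y) \<and>
     (\<forall>c\<in>carrier R. \<forall>x\<in>carrier M. h (c \<odot>\<^bsub>M\<^esub> x) = c \<odot>\<^bsub>N\<^esub> h x) \<and>
     (\<forall>n. h ` degree_part M n = degree_part N n))"


section \<open>Fiber cones\<close>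

text \<open>An element of \<open>F(L)\<close> is a finitely supported sequence \<open>f\<close> of cosets, \<open>f n \<in> L\<^sup>n/mL\<^sup>n\<close>.
  Applied to cosets of \<open>mL\<^sup>i\<close> in \<open>L\<^sup>i\<close> and of \<open>mL\<^sup>j\<close> in \<open>L\<^sup>j\<close>, \<^term>\<open>rcoset_mult R\<close> modulo \<open>mL\<^sup>i\<^sup>+\<^sup>j\<close>
  is the coset of the product of representatives.\<close>

definition fiber_piece ::
    "('a, 'b) ring_scheme \<Rightarrow> 'a set \<Rightarrow> 'a set \<Rightarrow> nat \<Rightarrow> ('a, 'a set) module" where
  "fiber_piece R m L n = quot_module R (ideal_pow R L n) (m \<cdot>\<^bsub>R\<^esub> ideal_pow R L n)"

definition fiber_cone ::
    "('a, 'b) ring_scheme \<Rightarrow> 'a set \<Rightarrow> 'a set \<Rightarrow> (nat \<Rightarrow> 'a set) ring" where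
  "fiber_cone R m L =
     \<lparr>carrier = {f. (\<forall>n. f n \<in> carrier (fiber_piece R m L n)) \<and>
                    finite {n. f n \<noteq> \<zero>\<^bsub>fiber_piece R m L n\<^esub>}},
      monoid.mult = (\<lambda>f g n. \<Oplus>\<^bsub>fiber_piece R m L n\<^esub>i\<in>{..n}.
                 rcoset_mult R (m \<cdot>\<^bsub>R\<^esub> ideal_pow R L n) (f i) (g (n - i))),
      monoid.one = (\<lambda>n. if n = 0 then (m \<cdot>\<^bsub>R\<^esub> ideal_pow R L 0) +>\<^bsub>R\<^esub> \<one>\<^bsub>R\<^esub>
                 else \<zero>\<^bsub>fiber_piece R m L n\<^esub>),
      ring.zero = (\<lambda>n. \<zero>\<^bsub>fiber_piece R m L n\<^esub>),
      ring.add = (\<lambda>f g n. f n \<oplus>\<^bsub>fiber_piece R m L n\<^esub> g n)\<rparr>"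

text \<open>The class of \<open>a \<in> L\<close> in \<open>L/mL = F(L)\<^sub>1\<close>.\<close>

definition fiber_class ::
    "('a, 'b) ring_scheme \<Rightarrow> 'a set \<Rightarrow> 'a set \<Rightarrow> 'a \<Rightarrow> nat \<Rightarrow> 'a set" where
  "fiber_class R m L a = (\<lambda>n. if n = 1 then (m \<cdot>\<^bsub>R\<^esub> ideal_pow R L 1) +>\<^bsub>R\<^esub> a
                              else \<zero>\<^bsub>fiber_piece R m L n\<^esub>)"

definition analytic_spread :: "('a, 'b) ring_scheme \<Rightarrow> 'a set \<Rightarrow> 'a set \<Rightarrow> enat" where
  "analytic_spread R m L = krull_dim (fiber_cone R m L)"

text \<open>For \<open>J \<subseteq> L\<close>, \<open>F(L)\<close> as a graded \<open>F(J)\<close>-module: scalars act through the canonical map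
  \<open>F(J) \<rightarrow> F(L)\<close>, which enlarges a coset of \<open>mJ\<^sup>n\<close> to the coset of \<open>mL\<^sup>n\<close> containing it. For \<open>J = L\<close>
  this is \<open>F(J)\<close> as a module over itself.\<close>

definition fiber_module ::
    "('a, 'b) ring_scheme \<Rightarrow> 'a set \<Rightarrow> 'a set \<Rightarrow> (nat \<Rightarrow> 'a set, nat \<Rightarrow> 'a set) graded_module" where
  "fiber_module R m L =
     \<lparr>carrier = carrier (fiber_cone R m L), monoid.mult = monoid.mult (fiber_cone R m L),
      monoid.one = monoid.one (fiber_cone R m L), ring.zero = ring.zero (fiber_cone R m L),
      ring.add = ring.add (fiber_cone R m L),
      smult = (\<lambda>c f. (\<lambda>n. c n <+>\<^bsub>R\<^esub> (m \<cdot>\<^bsub>R\<^esub> ideal_pow R L n)) \<otimes>\<^bsub>fiber_cone R m L\<^esub> f),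
      degree_part = (\<lambda>d. {f \<in> carrier (fiber_cone R m L).
                            \<forall>n. int n \<noteq> d \<longrightarrow> f n = \<zero>\<^bsub>fiber_piece R m L n\<^esub>})\<rparr>"

end

theory Submission
  imports Defs
begin

text \<open>
  If \<open>(a)\<close> is a minimal reduction of \<open>I\<close>, then \<open>a\<close> is a non-zero-divisor, and each of the conditions
  (2)--(7) says that multiplication by \<open>a\<close> is injective as a map
  \<open>I\<^sup>n/mI\<^sup>n \<rightarrow> I\<^sup>n\<^sup>+\<^sup>1/mI\<^sup>n\<^sup>+\<^sup>1\<close> for every \<open>n\<close>; only \<open>1 \<le> n \<le> r - 1\<close> matters, because \<open>a\<close> is not in
  \<open>mI\<close> and \<open>I\<^sup>n\<^sup>+\<^sup>1 = aI\<^sup>n\<close> for \<open>n \<ge> r\<close>. For the length conditions the kernels are measured by lengths of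
  intervals of ideals, which are additive by the modular law. Injectivity in all degrees means that
  \<open>a\<^sup>0\<close> is a non-zero-divisor of \<open>F(I)\<close>. If it is one, then every maximal ideal of the one-dimensional
  noetherian ring \<open>F(I)\<close> contains a non-zero-divisor, namely \<open>a\<^sup>0\<close> or some \<open>1 - a\<^sup>0 b\<close>, so \<open>F(I)\<close> is
  Cohen--Macaulay. Conversely, an element killed by \<open>a\<^sup>0\<close> is killed by a power of the irrelevant ideal,
  which contains a non-zero-divisor if \<open>F(I)\<close> is Cohen--Macaulay.

  Minimal reductions are principal: if \<open>d \<ge> 2\<close> elements of \<open>I\<close> generate a reduction and no \<open>d - 1\<close> do,
  then two of them are algebraically independent modulo the others by a linear change of coordinates
  over the infinite residue field, and this yields a chain of three homogeneous primes in \<open>F(I)\<close>.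
\<close>

text \<open>Elements of the fiber cone are sequences of cosets, and its operations are unions over
  representatives. Hence nearly everything is proved for finitely supported sequences of elements of
  \<open>R\<close>, and ideals of the fiber cone are traded for families of ideals of
  \<open>R\<close>. A recurring detail is that zero cosets must receive the representative zero,
  because otherwise finite support is lost. Lengths may be infinite a priori; they are compared
  through chains of a given finite length, and identities between them stay additive until
  finiteness is known. Cohen-Macaulayness quantifies over all maximal ideals, homogeneous or not, so
  depth and height have to be controlled without any grading. The readings with "every" and "some"
  agree because Cohen-Macaulayness does not mention \<open>a\<close>, because a principal minimal
  reduction exists, and because cancelling powers of non-zero-divisors shows that the same
  \<open>r\<close> serves all minimal reductions.\<close>

no_notation Sum_Type.Plus (infixr \<open><+>\<close> 65)

section \<open>Lengths of intervals of ideals\<close>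

text \<open>Chains need not start at \<open>K\<close> or end at \<open>N\<close>. Truncating them,
  enlarging the interval and splicing are then immediate, and the supremum of their lengths is still
  the usual length.\<close>

definition ideal_chain :: "('a, 'b) ring_scheme \<Rightarrow> 'a set \<Rightarrow> 'a set \<Rightarrow> nat \<Rightarrow> bool" where
  "ideal_chain R K N n \<longleftrightarrow> (\<exists>c :: nat \<Rightarrow> 'a set.
     (\<forall>i\<le>n. ideal (c i) R \<and> K \<subseteq> c i \<and> c i \<subseteq> N) \<and> (\<forall>i<n. c i \<subset> c (Suc i)))"

definition ideal_length :: "('a, 'b) ring_scheme \<Rightarrow> 'a set \<Rightarrow> 'a set \<Rightarrow> enat" where
  "ideal_length R K N = Sup {enat n | n. ideal_chain R K N n}"

text \<open>Turns an inequality for a possibly infinite supremum into the existence of one chain of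
  prescribed finite length. Together with \<open>enat_le_eqI\<close> it removes most case
  distinctions on infinity.\<close>

lemma Sup_enat_downclosed:
  assumes "P (0::nat)" "\<And>m n. m \<le> n \<Longrightarrow> P n \<Longrightarrow> P m"
  shows "enat n \<le> Sup {enat n | n. P n} \<longleftrightarrow> P n"
proof
  assume le: "enat n \<le> Sup {enat n | n. P n}"
  show "P n"
  proof (rule ccontr)
    assume np: "\<not> P n"
    hence "0 < n" using assms(1) by (cases n) auto
    have "Sup {enat n | n. P n} \<le> enat (n - 1)"
    proof (rule Sup_least)
      fix x assume "x \<in> {enat n | n. P n}"
      then obtain m where m: "x = enat m" "P m" by blast
      have "m < n"
      proof (rule ccontr)
        assume "\<not> m < n" thus False using assms(2)[OF _ m(2), of n] np by simp
      qed
      thus "x \<le> enat (n - 1)" using m(1) by simp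
    qed
    from order_trans[OF le this] have "n \<le> n - 1" by simp
    thus False using \<open>0 < n\<close> by simp
  qed
next
  assume "P n" thus "enat n \<le> Sup {enat n | n. P n}"
    by (intro Sup_upper) blast
qed

lemma ideal_chain_mono: "m \<le> n \<Longrightarrow> ideal_chain R K N n \<Longrightarrow> ideal_chain R K N m"
  unfolding ideal_chain_def by (meson le_trans less_le_trans)

lemma ideal_chain_0:
  assumes "ideal K R" "K \<subseteq> N" shows "ideal_chain R K N 0"
  using assms unfolding ideal_chain_def by (intro exI[of _ "\<lambda>_. K"]) auto

lemma le_ideal_length_iff:
  assumes "ideal K R" "K \<subseteq> N"
  shows "enat n \<le> ideal_length R K N \<longleftrightarrow> ideal_chain R K N n"
  unfolding ideal_length_def
  by (rule Sup_enat_downclosed) (use assms ideal_chain_0 ideal_chain_mono in blast)+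

lemma enat_le_eqI: "(\<And>n. enat n \<le> x \<Longrightarrow> enat n \<le> y) \<Longrightarrow> x \<le> y"
  by (cases x; cases y; auto) (meson Suc_n_not_le_n)

text \<open>The main device for comparing lengths: a strictly monotone map between intervals carries
  chains to chains. The two rings may differ, which is needed to pass between ideals of the fiber
  cone and ideals of \<open>R\<close>.\<close>

lemma ideal_length_order_embedding:
  assumes "ideal K R" "K \<subseteq> N" "ideal K' S" "K' \<subseteq> N'"
    and "\<And>V. ideal V R \<Longrightarrow> K \<subseteq> V \<Longrightarrow> V \<subseteq> N \<Longrightarrow> ideal (f V) S \<and> K' \<subseteq> f V \<and> f V \<subseteq> N'"
    and "\<And>V Y. ideal V R \<Longrightarrow> ideal Y R \<Longrightarrow> K \<subseteq> V \<Longrightarrow> V \<subset> Y \<Longrightarrow> Y \<subseteq> N \<Longrightarrow> f V \<subset> f Y"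
  shows "ideal_length R K N \<le> ideal_length S K' N'"
proof (rule enat_le_eqI)
  fix n assume "enat n \<le> ideal_length R K N"
  then obtain c where c: "\<forall>i\<le>n. ideal (c i) R \<and> K \<subseteq> c i \<and> c i \<subseteq> N" "\<forall>i<n. c i \<subset> c (Suc i)"
    unfolding le_ideal_length_iff[OF assms(1,2)] ideal_chain_def by blast
  have "ideal_chain S K' N' n" unfolding ideal_chain_def
  proof (intro exI[of _ "\<lambda>i. f (c i)"] conjI allI impI)
    fix i assume "i < n"
    thus "f (c i) \<subset> f (c (Suc i))" using c(1)[rule_format, of i] c(1)[rule_format, of "Suc i"]
      c(2)[rule_format, of i] by (simp add: assms(6))
  qed (use c(1) in \<open>simp_all only: assms(5)\<close>)
  thus "enat n \<le> ideal_length S K' N'" using le_ideal_length_iff[OF assms(3,4)] by simp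
qed

lemma ideal_chain_extend:
  assumes "ideal_chain R K V n" "ideal Y R" "V \<subset> Y" "K \<subseteq> Y"
  shows "ideal_chain R K Y (Suc n)"
proof -
  obtain c where c: "\<forall>i\<le>n. ideal (c i) R \<and> K \<subseteq> c i \<and> c i \<subseteq> V" "\<forall>i<n. c i \<subset> c (Suc i)"
    using assms(1) unfolding ideal_chain_def by blast
  show ?thesis unfolding ideal_chain_def
  proof (intro exI[of _ "c(Suc n := Y)"] conjI allI impI)
    fix i assume "i < Suc n"
    thus "(c(Suc n := Y)) i \<subset> (c(Suc n := Y)) (Suc i)"
      using c(1)[rule_format, of n] c(2)[rule_format, of i] assms(3) by (cases "i = n") auto
  next
    fix i assume i: "i \<le> Suc n"
    show "ideal ((c(Suc n := Y)) i) R" "K \<subseteq> (c(Suc n := Y)) i" "(c(Suc n := Y)) i \<subseteq> Y"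
      using c(1)[rule_format, of i] i assms(2-) by (cases "i = Suc n"; auto)+
  qed
qed

lemma ideal_chain_superset: "ideal_chain R K V n \<Longrightarrow> V \<subseteq> Y \<Longrightarrow> ideal_chain R K Y n"
  unfolding ideal_chain_def by (meson subset_trans)

lemma ideal_chain_append:
  assumes "ideal_chain R L N j" "ideal_chain R K L i" "K \<subseteq> L" "L \<subseteq> N"
  shows "ideal_chain R K N (i + j)"
proof -
  obtain c where c: "\<forall>k\<le>j. ideal (c k) R \<and> L \<subseteq> c k \<and> c k \<subseteq> N" "\<forall>k<j. c k \<subset> c (Suc k)"
    using assms(1) unfolding ideal_chain_def by blast
  have "ideal_chain R K (c k) (i + k)" if "k \<le> j" for k
    using that
  proof (induction k)
    case 0 thus ?case using ideal_chain_superset[OF assms(2)] c(1) by simp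
  next
    case (Suc k)
    thus ?case using ideal_chain_extend[of R K "c k" "i + k" "c (Suc k)"] c assms(3)
      by (simp add: Suc_le_lessD) (meson le_SucI order.trans order_refl)
  qed
  thus ?thesis using c(1) ideal_chain_superset by blast
qed

section \<open>Sums of ideals, the modular law and additivity of length\<close>

context ring
begin

lemma ideal_subset_carrier: "ideal I R \<Longrightarrow> I \<subseteq> carrier R"
  by (simp add: additive_subgroup.a_subset ideal.axioms(1))

lemma set_add_subset_iff:
  assumes "ideal K R" "ideal L R" "ideal N R"
  shows "K <+> L \<subseteq> N \<longleftrightarrow> K \<subseteq> N \<and> L \<subseteq> N"
proof
  assume le: "K <+> L \<subseteq> N"
  have "x \<in> N" if "x \<in> K" for x
  proof -
    have "x \<oplus> \<zero> \<in> K <+> L" using that additive_subgroup.zero_closed[OF ideal.axioms(1)[OF assms(2)]]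
      unfolding set_add_def' by blast
    thus ?thesis using le that ideal.Icarr[OF assms(1)] by auto
  qed
  moreover have "x \<in> N" if "x \<in> L" for x
  proof -
    have "\<zero> \<oplus> x \<in> K <+> L" using that additive_subgroup.zero_closed[OF ideal.axioms(1)[OF assms(1)]]
      unfolding set_add_def' by blast
    thus ?thesis using le that ideal.Icarr[OF assms(2)] by auto
  qed
  ultimately show "K \<subseteq> N \<and> L \<subseteq> N" by auto
next
  assume "K \<subseteq> N \<and> L \<subseteq> N"
  thus "K <+> L \<subseteq> N" using assms(3)
    by (auto simp: set_add_def' intro!: additive_subgroup.a_closed[OF ideal.axioms(1)])
qed

lemma set_add_upper:
  assumes "ideal K R" "ideal L R"
  shows "K \<subseteq> K <+> L" "L \<subseteq> K <+> L"
  using set_add_subset_iff[OF assms add_ideals[OF assms]] by auto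

lemma set_add_absorb: "ideal K R \<Longrightarrow> ideal L R \<Longrightarrow> K \<subseteq> L \<Longrightarrow> K <+> L = L"
  by (meson equalityI set_add_subset_iff set_add_upper(2) subset_refl)

lemma ideal_minus_closed: "ideal I R \<Longrightarrow> x \<in> I \<Longrightarrow> y \<in> I \<Longrightarrow> x \<ominus> y \<in> I"
  by (simp add: a_minus_def additive_subgroup.a_closed additive_subgroup.a_inv_closed ideal.axioms(1))

lemma ideal_add_closed: "ideal I R \<Longrightarrow> x \<in> I \<Longrightarrow> y \<in> I \<Longrightarrow> x \<oplus> y \<in> I"
  by (simp add: additive_subgroup.a_closed ideal.axioms(1))

lemma ideal_zero_closed: "ideal I R \<Longrightarrow> \<zero> \<in> I"
  by (simp add: additive_subgroup.zero_closed ideal.axioms(1))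

text \<open>If \<open>y\<close> in \<open>Y\<close> were \<open>x + l\<close> with \<open>x\<close>
  in \<open>V\<close> and \<open>l\<close> in \<open>L\<close>, then \<open>l = y - x\<close> would
  lie in \<open>Y\<close> and \<open>L\<close>, hence in \<open>V\<close>, and so would
  \<open>y\<close>. Thus a strict step that disappears after intersecting with \<open>L\<close>
  survives adding \<open>L\<close>.\<close>

lemma modular_strict:
  assumes "ideal V R" "ideal Y R" "ideal L R" "V \<subset> Y" "V \<inter> L = Y \<inter> L"
  shows "V <+> L \<subset> Y <+> L"
proof -
  have le: "V <+> L \<subseteq> Y <+> L" using assms(4) by (auto simp: set_add_def')
  obtain y where y: "y \<in> Y" "y \<notin> V" using assms(4) by auto
  have "y \<notin> V <+> L"
  proof
    assume "y \<in> V <+> L"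
    then obtain x l where xl: "x \<in> V" "l \<in> L" "y = x \<oplus> l" by (auto simp: set_add_def')
    have c: "x \<in> carrier R" "l \<in> carrier R"
      using xl assms ideal.Icarr by metis+
    have "y \<ominus> x \<in> Y" using y xl assms by (intro ideal_minus_closed) auto
    moreover have "y \<ominus> x = l" using xl c by algebra
    ultimately have "l \<in> V" using xl assms(5) by auto
    thus False using y xl assms(1) ideal_add_closed by metis
  qed
  moreover have "y \<in> Y <+> L" using set_add_upper[OF assms(2,3)] y by auto
  ultimately show ?thesis using le by auto
qed

text \<open>By the modular law every strict step of the chain survives in the intersections with
  \<open>L\<close> or in the sums with \<open>L\<close>; \<open>i\<close> and \<open>j\<close> count
  the two kinds.\<close>

lemma ideal_chain_split:
  assumes "ideal K R" "ideal L R" "ideal N R" "K \<subseteq> L" "L \<subseteq> N" "ideal_chain R K N n"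
  shows "\<exists>i j. n \<le> i + j \<and> ideal_chain R K L i \<and> ideal_chain R L N j"
proof -
  obtain c where c: "\<forall>k\<le>n. ideal (c k) R \<and> K \<subseteq> c k \<and> c k \<subseteq> N" "\<forall>k<n. c k \<subset> c (Suc k)"
    using assms(6) unfolding ideal_chain_def by blast
  have "\<exists>i j. k = i + j \<and> ideal_chain R K (c k \<inter> L) i \<and> ideal_chain R L (c k <+> L) j"
    if "k \<le> n" for k using that
  proof (induction k)
    case 0
    have "ideal_chain R K (c 0 \<inter> L) 0" "ideal_chain R L (c 0 <+> L) 0"
      using c(1) assms(1,2,4) set_add_upper(2)[of "c 0" L] by (auto intro!: ideal_chain_0)
    thus ?case by auto
  next
    case (Suc k)
    have k: "ideal (c k) R" "ideal (c (Suc k)) R" "c k \<subset> c (Suc k)" "K \<subseteq> c (Suc k)"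
      using c Suc.prems by auto
    obtain i j where ij: "k = i + j" "ideal_chain R K (c k \<inter> L) i" "ideal_chain R L (c k <+> L) j"
      using Suc by auto
    have le: "c k <+> L \<subseteq> c (Suc k) <+> L" using k(3) by (auto simp: set_add_def')
    show ?case
    proof (cases "c k \<inter> L = c (Suc k) \<inter> L")
      case True
      have "ideal_chain R L (c (Suc k) <+> L) (Suc j)"
        by (rule ideal_chain_extend[OF ij(3)])
          (use modular_strict[OF k(1,2) assms(2) k(3) True] add_ideals[OF k(2) assms(2)]
             set_add_upper[OF k(2) assms(2)] in auto)
      thus ?thesis using ij True by (intro exI[of _ i] exI[of _ "Suc j"]) auto
    next
      case False
      have "ideal_chain R K (c (Suc k) \<inter> L) (Suc i)"
        by (rule ideal_chain_extend[OF ij(2)]) (use False k assms(2,4) i_intersect in auto)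
      thus ?thesis using ij ideal_chain_superset[OF ij(3) le]
        by (intro exI[of _ "Suc i"] exI[of _ j]) auto
    qed
  qed
  from this[of n] obtain i j where ij: "n = i + j" "ideal_chain R K (c n \<inter> L) i"
    "ideal_chain R L (c n <+> L) j" by auto
  have "c n <+> L \<subseteq> N" using set_add_subset_iff c(1) assms by auto
  thus ?thesis using ij ideal_chain_superset by (metis Int_lower2 order_refl)
qed

text \<open>Jordan-Hoelder additivity without composition series: chains are split by
  \<open>ideal_chain_split\<close> and glued by \<open>ideal_chain_append\<close>, also when a
  length is infinite.\<close>

lemma ideal_length_add:
  assumes "ideal K R" "ideal L R" "ideal N R" "K \<subseteq> L" "L \<subseteq> N"
  shows "ideal_length R K N = ideal_length R K L + ideal_length R L N"
proof (rule antisym)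
  note iffs = le_ideal_length_iff[OF assms(1,4)] le_ideal_length_iff[OF assms(2,5)]
    le_ideal_length_iff[OF assms(1) subset_trans[OF assms(4,5)]]
  show "ideal_length R K N \<le> ideal_length R K L + ideal_length R L N"
  proof (rule enat_le_eqI)
    fix n assume "enat n \<le> ideal_length R K N"
    then obtain i j where ij: "n \<le> i + j" "ideal_chain R K L i" "ideal_chain R L N j"
      using ideal_chain_split[OF assms] iffs by blast
    have "enat n \<le> enat i + enat j" using ij by simp
    also have "\<dots> \<le> ideal_length R K L + ideal_length R L N"
      using ij iffs by (intro add_mono) auto
    finally show "enat n \<le> ideal_length R K L + ideal_length R L N" .
  qed
  show "ideal_length R K L + ideal_length R L N \<le> ideal_length R K N"
  proof (rule enat_le_eqI)
    fix n assume n: "enat n \<le> ideal_length R K L + ideal_length R L N"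
    \<comment> \<open>An infinite summand supplies a chain of length \<open>n\<close> on its
      own.\<close>
    have "\<exists>i j. n \<le> i + j \<and> enat i \<le> ideal_length R K L \<and> enat j \<le> ideal_length R L N"
    proof (cases "ideal_length R K L")
      case (enat i)
      show ?thesis
      proof (cases "ideal_length R L N")
        case (enat j)
        thus ?thesis using n \<open>ideal_length R K L = enat i\<close> by (intro exI[of _ i] exI[of _ j]) auto
      next
        case infinity
        thus ?thesis by (intro exI[of _ 0] exI[of _ n]) (auto simp: zero_enat_def[symmetric])
      qed
    next
      case infinity
      thus ?thesis by (intro exI[of _ n] exI[of _ 0]) (auto simp: zero_enat_def[symmetric])
    qed
    then obtain i j where ij: "n \<le> i + j" "ideal_chain R K L i" "ideal_chain R L N j"
      using iffs by blast
    thus "enat n \<le> ideal_length R K N"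
      using ideal_chain_append[OF ij(3,2) assms(4,5)] iffs ideal_chain_mono by blast
  qed
qed

lemma ideal_length_same: "ideal K R \<Longrightarrow> ideal_length R K K = 0"
proof -
  assume K: "ideal K R"
  have "ideal_length R K K \<le> 0"
  proof (rule enat_le_eqI)
    fix n assume "enat n \<le> ideal_length R K K"
    hence "ideal_chain R K K n" using le_ideal_length_iff K by blast
    then obtain c where c: "\<forall>i\<le>n. K \<subseteq> c i \<and> c i \<subseteq> K" "\<forall>i<n. c i \<subset> c (Suc i)"
      unfolding ideal_chain_def by blast
    have "n = 0"
    proof (rule ccontr)
      assume "n \<noteq> 0"
      hence "c 0 = K" "c 1 = K" "c 0 \<subset> c 1"
        using c(1)[rule_format, of 0] c(1)[rule_format, of 1] c(2)[rule_format, of 0] by auto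
      thus False by simp
    qed
    thus "enat n \<le> 0" by (simp add: zero_enat_def)
  qed
  thus ?thesis by simp
qed

lemma ideal_length_eq_0_iff:
  assumes "ideal K R" "ideal N R" "K \<subseteq> N"
  shows "ideal_length R K N = 0 \<longleftrightarrow> K = N"
proof
  assume 0: "ideal_length R K N = 0"
  show "K = N"
  proof (rule ccontr)
    assume "K \<noteq> N"
    hence "ideal_chain R K N (Suc 0)"
      using assms ideal_chain_extend[OF ideal_chain_0[OF assms(1) subset_refl]] by blast
    hence "enat (Suc 0) \<le> 0" using le_ideal_length_iff[OF assms(1,3)] 0 by metis
    thus False by (simp add: zero_enat_def)
  qed
qed (use ideal_length_same assms in auto)

lemma ideal_length_le_1:
  assumes "ideal K R" "K \<subseteq> N" "\<And>V. ideal V R \<Longrightarrow> K \<subseteq> V \<Longrightarrow> V \<subseteq> N \<Longrightarrow> V = K \<or> V = N"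
  shows "ideal_length R K N \<le> 1"
proof (rule enat_le_eqI)
  fix n assume "enat n \<le> ideal_length R K N"
  hence "ideal_chain R K N n" using le_ideal_length_iff[OF assms(1,2)] by simp
  then obtain c where c: "\<forall>k\<le>n. ideal (c k) R \<and> K \<subseteq> c k \<and> c k \<subseteq> N" "\<forall>k<n. c k \<subset> c (Suc k)"
    unfolding ideal_chain_def by blast
  have "n < 2"
  proof (rule ccontr)
    assume n: "\<not> n < 2"
    have s: "c 0 \<subset> c 1" "c 1 \<subset> c 2" using c(2)[rule_format, of 0] c(2)[rule_format, of 1] n
      by (auto simp: numeral_2_eq_2)
    have "c 0 \<subseteq> N" "c 1 \<subseteq> N" "c 2 \<subseteq> N" "K \<subseteq> c 0" "K \<subseteq> c 1" "K \<subseteq> c 2"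
      using c(1) n by auto
    moreover have "c 1 = K \<or> c 1 = N" using c(1) n assms(3)[of "c 1"] by auto
    ultimately show False using s by (metis psubset_subset_trans subset_psubset_trans psubset_eq)
  qed
  thus "enat n \<le> 1" by (simp add: one_enat_def)
qed

text \<open>Second isomorphism theorem for intervals: \<open>Z\<close> to \<open>V + Z\<close> and
  \<open>Z\<close> to \<open>Z \<inter> Y\<close> are mutually inverse by the modular law, so both
  are strictly monotone.\<close>

lemma ideal_length_inter_sum:
  assumes "ideal V R" "ideal Y R"
  shows "ideal_length R (V \<inter> Y) Y = ideal_length R V (V <+> Y)"
proof (rule antisym)
  have modular: "V <+> Z \<inter> Y = Z" if Z: "ideal Z R" "V \<subseteq> Z" "Z \<subseteq> V <+> Y" for Z
  proof
    show "V <+> Z \<inter> Y \<subseteq> Z" using set_add_subset_iff Z assms i_intersect by auto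
    show "Z \<subseteq> V <+> Z \<inter> Y"
    proof
      fix z assume z: "z \<in> Z"
      then obtain x y where xy: "x \<in> V" "y \<in> Y" "z = x \<oplus> y" using Z(3) by (auto simp: set_add_def')
      have "x \<in> carrier R" "y \<in> carrier R" using xy assms ideal.Icarr by metis+
      hence "y = z \<ominus> x" using xy by algebra
      moreover have "z \<ominus> x \<in> Z" using z xy Z by (intro ideal_minus_closed) auto
      ultimately have "y \<in> Z" by simp
      thus "z \<in> V <+> Z \<inter> Y" using xy by (auto simp: set_add_def')
    qed
  qed
  have modular': "(V <+> Z) \<inter> Y = Z" if Z: "ideal Z R" "V \<inter> Y \<subseteq> Z" "Z \<subseteq> Y" for Z
  proof
    show "Z \<subseteq> (V <+> Z) \<inter> Y" using set_add_upper[OF assms(1) Z(1)] Z by auto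
    show "(V <+> Z) \<inter> Y \<subseteq> Z"
    proof
      fix y assume y: "y \<in> (V <+> Z) \<inter> Y"
      then obtain x z where xz: "x \<in> V" "z \<in> Z" "y = x \<oplus> z" by (auto simp: set_add_def')
      have "x \<in> carrier R" "z \<in> carrier R" using xz assms Z ideal.Icarr by metis+
      hence "x = y \<ominus> z" using xz by algebra
      moreover have "y \<ominus> z \<in> Y" using y xz Z assms by (intro ideal_minus_closed) auto
      ultimately have "x \<in> Y" by simp
      thus "y \<in> Z" using xz Z ideal_add_closed by auto
    qed
  qed
  have I: "ideal (V \<inter> Y) R" using i_intersect assms by auto
  show "ideal_length R (V \<inter> Y) Y \<le> ideal_length R V (V <+> Y)"
  proof (rule ideal_length_order_embedding[where f = "\<lambda>Z. V <+> Z"])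
    fix Z W assume *: "ideal Z R" "ideal W R" "V \<inter> Y \<subseteq> Z" "Z \<subset> W" "W \<subseteq> Y"
    have "V <+> Z \<subseteq> V <+> W" using *(4) unfolding set_add_def' by blast
    moreover have "V <+> Z \<noteq> V <+> W"
      using modular'[of Z] modular'[of W] * by (metis psubset_imp_subset psubset_eq subset_trans)
    ultimately show "V <+> Z \<subset> V <+> W" by auto
  qed (use I assms add_ideals set_add_upper in \<open>auto simp: set_add_subset_iff set_add_def'\<close>)
  show "ideal_length R V (V <+> Y) \<le> ideal_length R (V \<inter> Y) Y"
  proof (rule ideal_length_order_embedding[where f = "\<lambda>Z. Z \<inter> Y"])
    fix Z W assume *: "ideal Z R" "ideal W R" "V \<subseteq> Z" "Z \<subset> W" "W \<subseteq> V <+> Y"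
    have "Z \<inter> Y \<subseteq> W \<inter> Y" using * by auto
    moreover have "Z \<inter> Y \<noteq> W \<inter> Y"
      using modular[of Z] modular[of W] * by (metis psubset_imp_subset psubset_eq subset_trans)
    ultimately show "Z \<inter> Y \<subset> W \<inter> Y" by auto
  qed (use I assms i_intersect set_add_upper in auto)
qed

end

section \<open>Quotient modules\<close>

context cring
begin

lemma quot_carrier: "carrier (quot_module R N K) = (\<lambda>x. K +> x) ` N"
  by (simp add: quot_module_def)

lemma coset_eq_iff:
  assumes "ideal K R" "x \<in> carrier R" "y \<in> carrier R"
  shows "K +> x = K +> y \<longleftrightarrow> x \<ominus> y \<in> K"
  using quotient_eq_iff_same_a_r_cos[OF assms] by simp

lemma coset_zero: "ideal K R \<Longrightarrow> K +> \<zero> = K"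
  by (simp add: ideal_subset_carrier)

lemma coset_eq_zero_iff:
  assumes "ideal K R" "x \<in> carrier R"
  shows "K +> x = K \<longleftrightarrow> x \<in> K"
  using coset_eq_iff[OF assms, of \<zero>] coset_zero assms by (simp add: a_minus_def)

lemma coset_subset_iff:
  assumes "ideal K R" "ideal V R" "K \<subseteq> V" "x \<in> carrier R"
  shows "K +> x \<subseteq> V \<longleftrightarrow> x \<in> V"
proof
  have "\<zero> \<oplus> x \<in> K +> x" using ideal_zero_closed[OF assms(1)] by (auto simp: a_r_coset_def')
  moreover assume "K +> x \<subseteq> V" ultimately show "x \<in> V" using assms(4) by auto
next
  assume "x \<in> V" thus "K +> x \<subseteq> V"
    using assms ideal_add_closed by (auto simp: a_r_coset_def')
qed

lemma quot_add:
  assumes "ideal K R" "x \<in> carrier R" "y \<in> carrier R"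
  shows "(K +> x) \<oplus>\<^bsub>quot_module R N K\<^esub> (K +> y) = K +> (x \<oplus> y)"
  using assms ideal.a_rcos_sum[OF assms] by (simp add: quot_module_def)

lemma coset_self: "ideal K R \<Longrightarrow> x \<in> carrier R \<Longrightarrow> x \<in> K +> x"
  using ideal_zero_closed[of K] by (force simp: a_r_coset_def')

text \<open>Scalar multiplication is a union over representatives; all cosets in the union coincide
  because \<open>K\<close> is an ideal.\<close>

lemma quot_smult:
  assumes "ideal K R" "c \<in> carrier R" "x \<in> carrier R"
  shows "c \<odot>\<^bsub>quot_module R N K\<^esub> (K +> x) = K +> (c \<otimes> x)"
proof -
  have *: "K +> (c \<otimes> y) = K +> (c \<otimes> x)" if y: "y \<in> K +> x" for y
  proof -
    obtain k where k: "k \<in> K" "y = k \<oplus> x" using y unfolding a_r_coset_def' by blast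
    have kc: "k \<in> carrier R" using k assms ideal.Icarr by metis
    have "c \<otimes> y \<ominus> c \<otimes> x = c \<otimes> k" using k(2) kc assms by algebra
    hence "c \<otimes> y \<ominus> c \<otimes> x \<in> K" using ideal.I_l_closed[OF assms(1) k(1) assms(2)] by simp
    moreover have "y \<in> carrier R" using k(2) kc assms(3) by simp
    ultimately show ?thesis using coset_eq_iff[OF assms(1), of "c \<otimes> y" "c \<otimes> x"] assms by simp
  qed
  have "(\<Union>y\<in>K +> x. K +> (c \<otimes> y)) = (\<Union>y\<in>K +> x. K +> (c \<otimes> x))"
    by (rule SUP_cong[OF refl *])
  also have "\<dots> = K +> (c \<otimes> x)" using coset_self[OF assms(1,3)] by blast
  finally show ?thesis by (simp add: quot_module_def)
qed

lemma quot_abelian_group: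
  assumes "ideal K R" "ideal N R"
  shows "abelian_group (quot_module R N K)"
proof -
  have c: "x \<in> carrier R" if "x \<in> N" for x using that assms ideal.Icarr by metis
  have z: "\<zero>\<^bsub>quot_module R N K\<^esub> = K +> \<zero>" using coset_zero assms by (simp add: quot_module_def)
  show ?thesis
  proof (rule abelian_groupI)
    show "\<zero>\<^bsub>quot_module R N K\<^esub> \<in> carrier (quot_module R N K)"
      using z ideal_zero_closed[OF assms(2)] by (simp add: quot_carrier)
    fix x assume "x \<in> carrier (quot_module R N K)"
    then obtain x' where x': "x' \<in> N" "x = K +> x'" by (auto simp: quot_carrier)
    show "\<zero>\<^bsub>quot_module R N K\<^esub> \<oplus>\<^bsub>quot_module R N K\<^esub> x = x"
      using x' c assms by (simp add: z quot_add)
    have "\<ominus> x' \<in> N" using x' assms by (simp add: additive_subgroup.a_inv_closed ideal.axioms(1))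
    moreover from this have "(K +> \<ominus> x') \<oplus>\<^bsub>quot_module R N K\<^esub> x = \<zero>\<^bsub>quot_module R N K\<^esub>"
      using x' c assms by (simp add: z quot_add l_neg)
    ultimately show "\<exists>y\<in>carrier (quot_module R N K). y \<oplus>\<^bsub>quot_module R N K\<^esub> x = \<zero>\<^bsub>quot_module R N K\<^esub>"
      by (auto simp: quot_carrier)
  qed (use assms c ideal_add_closed in \<open>auto simp: quot_carrier quot_add a_ac\<close>)
qed

text \<open>Membership in \<open>N\<close> is carried along because the induction needs partial sums
  that are admissible representatives.\<close>

lemma quot_finsum:
  assumes "ideal K R" "ideal N R" "finite S" "\<And>i. i \<in> S \<Longrightarrow> g i \<in> N"
  shows "(\<Oplus>\<^bsub>quot_module R N K\<^esub>i\<in>S. K +> g i) = K +> (\<Oplus>i\<in>S. g i) \<and> (\<Oplus>i\<in>S. g i) \<in> N"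
proof -
  interpret Q: abelian_group "quot_module R N K" using quot_abelian_group assms by simp
  have c: "x \<in> carrier R" if "x \<in> N" for x using that assms ideal.Icarr by metis
  show ?thesis using assms(3,4)
  proof (induction rule: finite_induct)
    case empty
    have "\<zero>\<^bsub>quot_module R N K\<^esub> = K" by (simp add: quot_module_def)
    thus ?case using coset_zero assms ideal_zero_closed by simp
  next
    case (insert i S)
    thus ?case using c assms ideal_add_closed
      by (subst finsum_insert Q.finsum_insert; force simp: quot_carrier quot_add Pi_def)+
  qed
qed

text \<open>Correspondence between submodules of the quotient and ideals from \<open>K\<close> to
  \<open>N\<close>: images in one direction, preimages under the coset map in the other. Strict
  inclusions are kept both ways.\<close>

lemma module_length_quot:
  assumes K: "ideal K R" and N: "ideal N R" and KN: "K \<subseteq> N"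
  shows "module_length R (quot_module R N K) = ideal_length R K N"
proof -
  let ?Q = "quot_module R N K"
  interpret Q: abelian_group ?Q using quot_abelian_group assms by simp
  have c: "x \<in> carrier R" if "x \<in> N" for x using that assms ideal.Icarr by metis
  have z: "\<zero>\<^bsub>?Q\<^esub> = K" by (simp add: quot_module_def)
  have sub: "submodule ((\<lambda>x. K +> x) ` V) R ?Q" if V: "ideal V R" "K \<subseteq> V" "V \<subseteq> N" for V
  proof (intro submodule.intro subgroup.intro submodule_axioms.intro)
    show "inv\<^bsub>add_monoid ?Q\<^esub> x \<in> (+>) K ` V" if x: "x \<in> (+>) K ` V" for x
    proof -
      obtain x' where x': "x' \<in> V" "x = K +> x'" using x by auto
      have m: "\<ominus> x' \<in> V" using x' V by (simp add: additive_subgroup.a_inv_closed ideal.axioms(1))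
      have "(K +> \<ominus> x') \<oplus>\<^bsub>?Q\<^esub> (K +> x') = \<zero>\<^bsub>?Q\<^esub>"
        using x' V c m assms coset_zero by (subst quot_add) (auto simp: z l_neg)
      hence "\<ominus>\<^bsub>?Q\<^esub> x = K +> \<ominus> x'" using x' V m Q.minus_equality
        by (metis image_eqI quot_carrier subsetD)
      thus ?thesis using m by (simp add: a_inv_def)
    qed
  qed (use V c assms ideal_add_closed ideal.I_l_closed ideal_zero_closed[OF V(1)] coset_zero in
      \<open>auto simp: quot_carrier quot_add quot_smult z subset_iff intro!: image_eqI\<close>)
  have idl: "ideal {x\<in>N. K +> x \<in> M} R \<and> K \<subseteq> {x\<in>N. K +> x \<in> M} \<and> M = (\<lambda>x. K +> x) ` {x\<in>N. K +> x \<in> M}"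
    if M: "submodule M R ?Q" for M
  proof -
    interpret M: submodule M R ?Q by fact
    have Msub: "M \<subseteq> (\<lambda>x. K +> x) ` N" using M.subset by (simp add: quot_carrier)
    have zM: "K \<in> M" using M.one_closed z by simp
    have "ideal {x\<in>N. K +> x \<in> M} R"
    proof (rule idealI)
      show "subgroup {x \<in> N. K +> x \<in> M} (add_monoid R)"
      proof (rule add.subgroupI)
        fix x assume x: "x \<in> {x \<in> N. K +> x \<in> M}"
        \<comment> \<open>Negatives come from the scalar \<open>- 1\<close>, which avoids computing
          inverses in the quotient.\<close>
        have "\<ominus> \<one> \<odot>\<^bsub>?Q\<^esub> (K +> x) \<in> M" using x by (intro M.smult_closed) auto
        moreover have "\<ominus> \<one> \<otimes> x = \<ominus> x" using x c[of x] by (simp add: l_minus)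
        ultimately show "\<ominus> x \<in> {x \<in> N. K +> x \<in> M}"
          using x c quot_smult[OF K, of "\<ominus> \<one>" x] N
          by (auto simp: additive_subgroup.a_inv_closed ideal.axioms(1))
      next
        fix x y assume "x \<in> {x \<in> N. K +> x \<in> M}" "y \<in> {x \<in> N. K +> x \<in> M}"
        thus "x \<oplus> y \<in> {x \<in> N. K +> x \<in> M}"
          using M.m_closed[of "K +> x" "K +> y"] c K N ideal_add_closed by (auto simp: quot_add)
      next
        show "{x \<in> N. K +> x \<in> M} \<noteq> {}"
          using zM coset_zero[OF K] ideal_zero_closed[OF N] by (auto intro!: exI[of _ \<zero>])
      qed (use c in auto)
      fix a x assume ax: "a \<in> {x \<in> N. K +> x \<in> M}" "x \<in> carrier R"
      show xa: "x \<otimes> a \<in> {x \<in> N. K +> x \<in> M}"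
        using ax M.smult_closed[of x "K +> a"] quot_smult[OF K ax(2)] c ideal.I_l_closed[OF N] by auto
      thus "a \<otimes> x \<in> {x \<in> N. K +> x \<in> M}" using ax c[of a] m_comm by simp
    qed (rule ring_axioms)
    moreover have "K \<subseteq> {x\<in>N. K +> x \<in> M}"
    proof
      fix x assume "x \<in> K"
      thus "x \<in> {x\<in>N. K +> x \<in> M}" using zM KN coset_eq_zero_iff[OF K, of x] c[of x] by auto
    qed
    moreover have "M = (\<lambda>x. K +> x) ` {x\<in>N. K +> x \<in> M}" using Msub by auto
    ultimately show ?thesis by simp
  qed
  have "(\<exists>c :: nat \<Rightarrow> 'a set set. (\<forall>i\<le>n. submodule (c i) R ?Q) \<and> (\<forall>i<n. c i \<subset> c (Suc i))) \<longleftrightarrow>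
     ideal_chain R K N n" for n
  proof
    assume "\<exists>c :: nat \<Rightarrow> 'a set set. (\<forall>i\<le>n. submodule (c i) R ?Q) \<and> (\<forall>i<n. c i \<subset> c (Suc i))"
    then obtain c where c: "\<forall>i\<le>n. submodule (c i) R ?Q" "\<forall>i<n. c i \<subset> c (Suc i)" by auto
    show "ideal_chain R K N n" unfolding ideal_chain_def
    proof (intro exI[of _ "\<lambda>i. {x\<in>N. K +> x \<in> c i}"] conjI allI impI)
      fix i assume i: "i < n"
      hence "{x\<in>N. K +> x \<in> c i} \<subseteq> {x\<in>N. K +> x \<in> c (Suc i)}" using c by auto
      moreover have "{x\<in>N. K +> x \<in> c i} \<noteq> {x\<in>N. K +> x \<in> c (Suc i)}"
        using idl[of "c i"] idl[of "c (Suc i)"] c(1)[rule_format, of i] c(1)[rule_format, of "Suc i"]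
          c(2)[rule_format, OF i] i by auto
      ultimately show "{x\<in>N. K +> x \<in> c i} \<subset> {x\<in>N. K +> x \<in> c (Suc i)}" by auto
    qed (use idl c in auto)
  next
    assume "ideal_chain R K N n"
    then obtain d where d: "\<forall>i\<le>n. ideal (d i) R \<and> K \<subseteq> d i \<and> d i \<subseteq> N" "\<forall>i<n. d i \<subset> d (Suc i)"
      unfolding ideal_chain_def by blast
    have "(\<lambda>x. K +> x) ` d i \<subset> (\<lambda>x. K +> x) ` d (Suc i)" if i: "i < n" for i
    proof -
      have di: "ideal (d i) R" "K \<subseteq> d i" "d i \<subset> d (Suc i)" "ideal (d (Suc i)) R" using d i by auto
      then obtain y where y: "y \<in> d (Suc i)" "y \<notin> d i" by auto
      have yc: "y \<in> carrier R" using y di ideal.Icarr by metis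
      have "K +> y \<noteq> K +> x" if "x \<in> d i" for x
        using that coset_subset_iff[OF K di(1,2) yc] coset_subset_iff[OF K di(1,2), of x] y
          ideal.Icarr[OF di(1)] by auto
      hence "K +> y \<notin> (\<lambda>x. K +> x) ` d i" by blast
      moreover have "K +> y \<in> (\<lambda>x. K +> x) ` d (Suc i)" using y by blast
      ultimately show ?thesis using di(3) by blast
    qed
    thus "\<exists>c :: nat \<Rightarrow> 'a set set. (\<forall>i\<le>n. submodule (c i) R ?Q) \<and> (\<forall>i<n. c i \<subset> c (Suc i))"
      using d sub by (intro exI[of _ "\<lambda>i. (\<lambda>x. K +> x) ` d i"]) auto
  qed
  thus ?thesis unfolding module_length_def ideal_length_def by simp
qed

end

section \<open>Prime ideals\<close>

text \<open>An ideal maximal among those that contain \<open>K\<close> and miss \<open>S\<close> is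
  prime. Zorn's lemma takes the place of a chain condition because the result is applied to the
  fiber cone before that ring is known to be noetherian.\<close>

lemma (in cring) exists_prime_avoiding:
  assumes K: "ideal K R" and S: "S \<subseteq> carrier R" "\<one> \<in> S" "\<And>s t. s \<in> S \<Longrightarrow> t \<in> S \<Longrightarrow> s \<otimes> t \<in> S"
    and disj: "K \<inter> S = {}"
  shows "\<exists>P. primeideal P R \<and> K \<subseteq> P \<and> P \<inter> S = {}"
proof -
  let ?F = "{P. ideal P R \<and> K \<subseteq> P \<and> P \<inter> S = {}}"
  have "\<exists>M\<in>?F. \<forall>V\<in>?F. M \<subseteq> V \<longrightarrow> V = M"
  proof (rule subset_Zorn_nonempty)
    show "?F \<noteq> {}" using K disj by blast
    fix C assume C: "C \<noteq> {}" "subset.chain ?F C"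
    have "ideal (if C = {} then {\<zero>} else \<Union>C) R"
      by (rule chain_Union_is_ideal) (use C(2) in \<open>auto simp: pred_on.chain_def\<close>)
    thus "\<Union>C \<in> ?F" using C by (auto simp: pred_on.chain_def)
  qed
  then obtain M where M: "ideal M R" "K \<subseteq> M" "M \<inter> S = {}"
    and max: "\<And>V. ideal V R \<Longrightarrow> M \<subseteq> V \<Longrightarrow> V \<inter> S = {} \<Longrightarrow> V = M"
    by (smt (verit) mem_Collect_eq subset_trans)
  interpret M: ideal M R by fact
  \<comment> \<open>By maximality, adding \<open>x\<close> to \<open>M\<close> must create an
    element of \<open>S\<close>.\<close>
  have meet: "\<exists>c\<in>carrier R. \<exists>k\<in>M. k \<oplus> c \<otimes> x \<in> S" if x: "x \<in> carrier R" "x \<notin> M" for x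
  proof -
    have I: "ideal (M <+> PIdl x) R" using M(1) cgenideal_ideal[OF x(1)] add_ideals by simp
    have "x \<in> M <+> PIdl x"
      using set_add_upper(2)[OF M(1) cgenideal_ideal[OF x(1)]] cgenideal_self[OF x(1)] by blast
    hence "M <+> PIdl x \<noteq> M" using x by blast
    hence "(M <+> PIdl x) \<inter> S \<noteq> {}"
      using max[OF I] set_add_upper(1)[OF M(1) cgenideal_ideal[OF x(1)]] by blast
    thus ?thesis by (auto simp: set_add_def' cgenideal_def)
  qed
  have "primeideal M R"
  proof (rule primeidealI)
    show "carrier R \<noteq> M" using M(3) S by blast
    fix x y assume xy: "x \<in> carrier R" "y \<in> carrier R" "x \<otimes> y \<in> M"
    show "x \<in> M \<or> y \<in> M"
    proof (rule ccontr)
      assume "\<not> (x \<in> M \<or> y \<in> M)"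
      then obtain c k d l where *: "c \<in> carrier R" "k \<in> M" "k \<oplus> c \<otimes> x \<in> S"
        "d \<in> carrier R" "l \<in> M" "l \<oplus> d \<otimes> y \<in> S"
        using meet xy by meson
      have kl: "k \<in> carrier R" "l \<in> carrier R" using * by auto
      \<comment> \<open>The product of two such elements is again in \<open>S\<close>, but modulo
        \<open>M\<close> it is a multiple of \<open>x y\<close>.\<close>
      have "(k \<oplus> c \<otimes> x) \<otimes> (l \<oplus> d \<otimes> y) = (k \<otimes> (l \<oplus> d \<otimes> y) \<oplus> l \<otimes> (c \<otimes> x)) \<oplus> (c \<otimes> d) \<otimes> (x \<otimes> y)"
        using * kl xy(1,2) by algebra
      also have "\<dots> \<in> M"
        using M.I_r_closed[OF *(2), of "l \<oplus> d \<otimes> y"] M.I_r_closed[OF *(5), of "c \<otimes> x"]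
          M.I_l_closed[OF xy(3), of "c \<otimes> d"] * kl xy by simp
      finally show False using S(3)[OF *(3,6)] M(3) by blast
    qed
  qed (use M is_cring in auto)
  thus ?thesis using M by blast
qed

lemma krull_dim_ge_2:
  assumes "primeideal P0 R" "primeideal P1 R" "primeideal P2 R" "P0 \<subset> P1" "P1 \<subset> P2"
  shows "2 \<le> krull_dim R"
proof -
  have "enat 2 \<le> krull_dim R" unfolding krull_dim_def
    by (rule Sup_upper, simp, rule exI[of _ "\<lambda>i. if i = 0 then P0 else if i = 1 then P1 else P2"])
      (use assms in auto)
  thus ?thesis by (simp add: numeral_eq_enat)
qed

lemma height_le_krull_dim: "height R Q \<le> krull_dim R"
  unfolding height_def krull_dim_def by (rule Sup_subset_mono) auto

lemma one_le_height:
  assumes "primeideal P0 R" "primeideal P R" "P0 \<subset> P"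
  shows "1 \<le> height R P"
proof -
  have "enat 1 \<le> height R P" unfolding height_def
    by (rule Sup_upper, simp, rule exI[of _ "\<lambda>i. if i = 0 then P0 else P"]) (use assms in auto)
  thus ?thesis by (simp add: one_enat_def)
qed

context cring
begin

lemma Idl_empty: "Idl {} = {\<zero>}"
  using genideal_minimal[OF zeroideal, of "{}"] ideal_zero_closed[OF genideal_ideal[of "{}"]] by auto

text \<open>Take a prime that contains \<open>K\<close> and avoids all products \<open>x^n s\<close>
  with \<open>s\<close> outside \<open>P\<close>. None of them is in \<open>K\<close>, since
  \<open>x\<close> can be cancelled modulo \<open>K\<close> and \<open>K\<close> is inside
  \<open>P\<close>. Avoiding every \<open>s\<close> puts the prime inside \<open>P\<close>, and
  avoiding \<open>x\<close> makes it smaller. This replaces localization and minimal primes.\<close>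

lemma exists_smaller_prime:
  assumes P: "primeideal P R" and K: "ideal K R" "K \<subseteq> P" and x: "x \<in> P"
    and nz: "\<And>y. y \<in> carrier R \<Longrightarrow> x \<otimes> y \<in> K \<Longrightarrow> y \<in> K"
  shows "\<exists>Q. primeideal Q R \<and> K \<subseteq> Q \<and> Q \<subset> P \<and> x \<notin> Q"
proof -
  interpret P: primeideal P R by fact
  have xc: "x \<in> carrier R" using x by simp
  let ?S = "{x [^] (n::nat) \<otimes> s | n s. s \<in> carrier R - P}"
  have "\<one> \<notin> P" using P.one_imp_carrier P.I_notcarr by auto
  have "\<exists>Q. primeideal Q R \<and> K \<subseteq> Q \<and> Q \<inter> ?S = {}"
  proof (rule exists_prime_avoiding[OF K(1)])
    show "\<one> \<in> ?S" using \<open>\<one> \<notin> P\<close> by (intro CollectI exI[of _ 0] exI[of _ \<one>]) auto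
    show "?S \<subseteq> carrier R" using xc by auto
    fix s t assume "s \<in> ?S" "t \<in> ?S"
    then obtain i j s' t' where *: "s = x [^] (i::nat) \<otimes> s'" "t = x [^] (j::nat) \<otimes> t'"
      "s' \<in> carrier R - P" "t' \<in> carrier R - P" by auto
    hence "s \<otimes> t = x [^] (i + j) \<otimes> (s' \<otimes> t')"
      using xc by (simp add: nat_pow_mult[symmetric] m_ac)
    moreover have "s' \<otimes> t' \<in> carrier R - P" using * P.I_prime[of s' t'] by auto
    ultimately show "s \<otimes> t \<in> ?S" by blast
  next
    have "x [^] (n::nat) \<otimes> s \<in> K \<Longrightarrow> s \<in> K" if "s \<in> carrier R" for n s
    proof (induction n)
      case (Suc n)
      have "x \<otimes> (x [^] n \<otimes> s) \<in> K" using Suc.prems that xc by (simp add: m_ac)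
      thus ?case using Suc.IH nz[of "x [^] n \<otimes> s"] xc that by auto
    qed (use that in simp)
    thus "K \<inter> ?S = {}" using K(2) by blast
  qed
  then obtain Q where Q: "primeideal Q R" "K \<subseteq> Q" "Q \<inter> ?S = {}" by blast
  have 1: "s \<notin> Q" if "s \<in> carrier R - P" for s
  proof -
    have "x [^] (0::nat) \<otimes> s \<in> ?S" using that by blast
    thus ?thesis using Q(3) that xc by auto
  qed
  have 2: "x \<notin> Q"
  proof -
    have "x [^] (1::nat) \<otimes> \<one> \<in> ?S" using \<open>\<one> \<notin> P\<close> by blast
    thus ?thesis using Q(3) xc by auto
  qed
  have "Q \<subseteq> carrier R" using Q(1) ideal_subset_carrier primeideal.axioms(1) by blast
  thus ?thesis using Q 1 2 x by blast
qed

text \<open>Each member of the sequence yields one more prime: descend from \<open>P\<close> modulo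
  the first element by means of the second, then once more modulo zero by means of the
  first.\<close>

lemma regular_sequence_length_2:
  assumes P: "primeideal P R" and xs: "set xs \<subseteq> P" "regular_sequence R xs" "2 \<le> length xs"
  shows "2 \<le> krull_dim R"
proof -
  interpret P: primeideal P R by fact
  obtain x y zs where xs': "xs = x # y # zs"
    using xs(3) by (metis Suc_le_length_iff numeral_2_eq_2)
  have xy: "x \<in> P" "y \<in> P" "x \<in> carrier R" using xs(1) by (auto simp: xs')
  have 1: "z = \<zero>" if "z \<in> carrier R" "x \<otimes> z = \<zero>" for z
    using xs(2) that unfolding regular_sequence_def xs' by (force simp: Idl_empty)
  have 2: "z \<in> Idl {x}" if "z \<in> carrier R" "y \<otimes> z \<in> Idl {x}" for z
    using xs(2) that unfolding regular_sequence_def xs' by (auto dest!: spec[of _ "Suc 0"])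
  have xP: "Idl {x} \<subseteq> P" using xy by (intro genideal_minimal) (auto simp: P.is_ideal)
  obtain Q1 where Q1: "primeideal Q1 R" "Idl {x} \<subseteq> Q1" "Q1 \<subset> P"
    using exists_smaller_prime[OF P genideal_ideal xP xy(2) 2] xy(3) by auto
  have "x \<in> Q1" using Q1(2) genideal_self'[OF xy(3)] by blast
  moreover have "{\<zero>} \<subseteq> Q1" using Q1(1) ideal_zero_closed primeideal.axioms(1) by blast
  ultimately obtain Q0 where "primeideal Q0 R" "Q0 \<subset> Q1"
    using exists_smaller_prime[OF Q1(1) zeroideal, of x] 1 by blast
  thus ?thesis using krull_dim_ge_2 Q1 P by blast
qed

text \<open>Depth and height are both squeezed to 1: a non-zero-divisor gives a prime below
  \<open>P\<close> and a regular sequence of length one, while a regular sequence of length two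
  would give dimension two.\<close>

lemma cohen_macaulay_dim_1I:
  assumes "noetherian_ring R" "krull_dim R = 1"
    and nzd: "\<And>P. maximalideal P R \<Longrightarrow> \<exists>x\<in>P. nonzerodivisor R x"
  shows "cohen_macaulay R"
  unfolding cohen_macaulay_def
proof (intro conjI allI impI is_cring assms(1))
  fix P assume max: "maximalideal P R"
  have P: "primeideal P R" using maximalideal_prime[OF max] .
  interpret P: primeideal P R by fact
  obtain x where x: "x \<in> P" "nonzerodivisor R x" using nzd[OF max] by blast
  have x0: "y = \<zero>" if "y \<in> carrier R" "x \<otimes> y = \<zero>" for y
    using x that by (auto simp: nonzerodivisor_def)
  have "{\<zero>} \<subseteq> P" using ideal_zero_closed[OF P.is_ideal] by simp
  then obtain Q where "primeideal Q R" "Q \<subset> P"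
    using exists_smaller_prime[OF P zeroideal _ x(1)] x0 by blast
  hence "1 \<le> height R P" using one_le_height P by blast
  moreover have "height R P \<le> 1" using height_le_krull_dim assms(2) by metis
  moreover have "depth R P \<le> 1" unfolding depth_def
  proof (rule Sup_least, clarify)
    fix xs assume xs: "set xs \<subseteq> P" "regular_sequence R xs"
    have "\<not> 2 \<le> length xs"
    proof
      assume "2 \<le> length xs"
      hence "(2::enat) \<le> 1" using regular_sequence_length_2[OF P xs] assms(2) by simp
      thus False by (simp add: numeral_eq_enat one_enat_def)
    qed
    thus "enat (length xs) \<le> 1" by (simp add: one_enat_def)
  qed
  moreover have "1 \<le> depth R P"
  proof -
    have xc: "x \<in> carrier R" using x by simp
    have "Idl {x} \<subseteq> P" using x by (intro genideal_minimal) (auto simp: P.is_ideal)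
    hence "Idl {x} \<noteq> carrier R" using P.I_notcarr P.Icarr by blast
    hence "regular_sequence R [x]"
      using xc x0 by (auto simp: regular_sequence_def Idl_empty)
    hence "enat (length [x]) \<le> depth R P" unfolding depth_def using x
      by (intro Sup_upper CollectI exI[of _ "[x]"]) auto
    thus ?thesis by (simp add: one_enat_def)
  qed
  ultimately show "depth R P = height R P" by (metis order_antisym)
qed

end

section \<open>Noetherian local rings\<close>

lemma (in noetherian_ring) exists_maximal_element:
  assumes "S V" "\<And>V. S V \<Longrightarrow> ideal V R"
  obtains M where "S M" "\<And>V. S V \<Longrightarrow> M \<subseteq> V \<Longrightarrow> V = M"
proof -
  have "\<exists>M\<in>Collect S. \<forall>V\<in>Collect S. M \<subseteq> V \<longrightarrow> V = M"
  proof (rule subset_Zorn_nonempty)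
    fix C assume C: "C \<noteq> {}" "subset.chain (Collect S) C"
    hence "subset.chain {I. ideal I R} C" using assms(2) by (auto simp: pred_on.chain_def)
    hence "\<Union>C \<in> C" using ideal_chain_is_trivial C by blast
    thus "\<Union>C \<in> Collect S" using C by (auto simp: pred_on.chain_def)
  qed (use assms(1) in blast)
  thus ?thesis using that by blast
qed

context ring
begin

lemma l_coset_iff: "y \<in> a <# H \<longleftrightarrow> (\<exists>h\<in>H. y = a \<otimes> h)"
  by (auto simp: l_coset_def)

lemma l_coset_mono: "H \<subseteq> H' \<Longrightarrow> a <# H \<subseteq> a <# H'"
  unfolding l_coset_def by blast

lemma set_add_mono: "H \<subseteq> H' \<Longrightarrow> K \<subseteq> K' \<Longrightarrow> H <+> K \<subseteq> H' <+> K'"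
  unfolding set_add_def' by blast

lemma set_add_iff: "y \<in> H <+> K \<longleftrightarrow> (\<exists>h\<in>H. \<exists>k\<in>K. y = h \<oplus> k)"
  by (auto simp: set_add_def')

lemma ideal_prod_subset_iff:
  assumes "ideal N R"
  shows "I \<cdot> J \<subseteq> N \<longleftrightarrow> (\<forall>i\<in>I. \<forall>j\<in>J. i \<otimes> j \<in> N)"
proof
  assume *: "\<forall>i\<in>I. \<forall>j\<in>J. i \<otimes> j \<in> N"
  show "I \<cdot> J \<subseteq> N"
  proof
    fix s assume "s \<in> I \<cdot> J" thus "s \<in> N"
      by (induct s rule: ideal_prod.induct) (use * assms ideal_add_closed in auto)
  qed
qed (auto intro: ideal_prod.prod)

lemma ideal_prod_mono: "I \<subseteq> I' \<Longrightarrow> J \<subseteq> J' \<Longrightarrow> I \<cdot> J \<subseteq> I' \<cdot> J'"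
proof
  fix s assume *: "I \<subseteq> I'" "J \<subseteq> J'" and "s \<in> I \<cdot> J" from this(3) show "s \<in> I' \<cdot> J'"
    by (induct s rule: ideal_prod.induct) (use * in \<open>auto intro: ideal_prod.intros\<close>)
qed

lemma ideal_prod_subset: "ideal I R \<Longrightarrow> ideal J R \<Longrightarrow> I \<cdot> J \<subseteq> J"
  using ideal_prod_inter[of I J] by auto

end

section \<open>Products and powers of ideals\<close>

context cring
begin

lemma l_coset_ideal:
  assumes "ideal N R" "a \<in> carrier R"
  shows "ideal (a <# N) R"
proof (rule idealI)
  interpret N: ideal N R by fact
  show "subgroup (a <# N) (add_monoid R)"
  proof (rule add.subgroupI)
    show "a <# N \<noteq> {}" using ideal_zero_closed[OF assms(1)] unfolding l_coset_def by blast
    fix x assume "x \<in> a <# N"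
    then obtain y where "y \<in> N" "x = a \<otimes> y" by (auto simp: l_coset_iff)
    moreover from this have "\<ominus> x = a \<otimes> (\<ominus> y)" using assms(2) by (simp add: r_minus)
    ultimately show "\<ominus> x \<in> a <# N" by (auto simp: l_coset_iff)
  next
    fix x y assume "x \<in> a <# N" "y \<in> a <# N"
    then obtain x' y' where "x' \<in> N" "x = a \<otimes> x'" "y' \<in> N" "y = a \<otimes> y'"
      by (auto simp: l_coset_iff)
    moreover from this have "x \<oplus> y = a \<otimes> (x' \<oplus> y')" using assms(2) by (simp add: r_distr)
    ultimately show "x \<oplus> y \<in> a <# N" by (auto simp: l_coset_iff)
  qed (use assms(2) in \<open>auto simp: l_coset_iff\<close>)
  fix x r assume x: "x \<in> a <# N" and r: "r \<in> carrier R"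
  then obtain y where y: "y \<in> N" "x = a \<otimes> y" by (auto simp: l_coset_iff)
  hence "r \<otimes> x = a \<otimes> (r \<otimes> y)" using r assms(2) by (simp add: m_ac)
  thus *: "r \<otimes> x \<in> a <# N" using y r N.I_l_closed by (auto simp: l_coset_iff)
  have "x \<otimes> r = r \<otimes> x" using y r assms(2) by (simp add: m_ac)
  thus "x \<otimes> r \<in> a <# N" using * by simp
qed (rule ring_axioms)

text \<open>For a principal factor the products already form an ideal, so every element of the
  product is a single multiple of \<open>a\<close>. This is what later allows \<open>a\<close> to be
  cancelled elementwise.\<close>

lemma PIdl_prod:
  assumes "ideal N R" "a \<in> carrier R"
  shows "(PIdl a) \<cdot> N = a <# N"
proof
  interpret N: ideal N R by fact
  show "(PIdl a) \<cdot> N \<subseteq> a <# N"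
  proof (subst ideal_prod_subset_iff[OF l_coset_ideal[OF assms]], clarify)
    fix i j assume "i \<in> PIdl a" and j: "j \<in> N"
    then obtain c where c: "c \<in> carrier R" "i = c \<otimes> a" by (auto simp: cgenideal_def)
    hence "i \<otimes> j = a \<otimes> (c \<otimes> j)" using j assms(2) by (simp add: m_ac)
    thus "i \<otimes> j \<in> a <# N" using c j N.I_l_closed by (auto simp: l_coset_iff)
  qed
  show "a <# N \<subseteq> (PIdl a) \<cdot> N"
    using cgenideal_self[OF assms(2)] by (auto simp: l_coset_iff intro: ideal_prod.prod)
qed

lemma ideal_pow_ideal: "ideal L R \<Longrightarrow> ideal (ideal_pow R L n) R"
  by (induction n) (auto simp: oneideal ideal_prod_is_ideal)

lemma ideal_prod_carrier: "ideal L R \<Longrightarrow> carrier R \<cdot> L = L" "ideal L R \<Longrightarrow> L \<cdot> carrier R = L"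
  using ideal_prod_one ideal_prod_commute oneideal by metis+

lemma ideal_pow_1: "ideal L R \<Longrightarrow> ideal_pow R L (Suc 0) = L"
  by (simp add: ideal_prod_carrier)

lemma ideal_pow_add:
  assumes "ideal L R"
  shows "ideal_pow R L (i + j) = ideal_pow R L i \<cdot> ideal_pow R L j"
  by (induction i) (simp_all add: assms ideal_prod_carrier ideal_pow_ideal ideal_prod_assoc)

lemma ideal_pow_mult_closed:
  "ideal L R \<Longrightarrow> x \<in> ideal_pow R L i \<Longrightarrow> y \<in> ideal_pow R L j \<Longrightarrow> x \<otimes> y \<in> ideal_pow R L (i + j)"
  by (simp add: ideal_pow_add ideal_prod.prod)

lemma pow_in_ideal_pow:
  assumes "ideal L R" "x \<in> L"
  shows "x [^] n \<in> ideal_pow R L n"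
proof (induction n)
  case (Suc n)
  have "x \<in> carrier R" using assms ideal.Icarr by metis
  thus ?case using Suc assms by (simp add: m_comm[of _ x] ideal_prod.prod)
qed simp

lemma ideal_pow_PIdl:
  assumes "a \<in> carrier R"
  shows "ideal_pow R (PIdl a) n = PIdl (a [^] n)"
proof (induction n)
  case 0 thus ?case using genideal_one cgenideal_eq_genideal[OF one_closed] by simp
next
  case (Suc n)
  have "ideal_pow R (PIdl a) (Suc n) = (PIdl a) \<cdot> (PIdl (a [^] n))" using Suc by simp
  also have "\<dots> = a <# (PIdl (a [^] n))" using PIdl_prod cgenideal_ideal assms by simp
  also have "\<dots> = PIdl (a \<otimes> a [^] n)"
  proof -
    have "a \<otimes> (c \<otimes> a [^] n) = c \<otimes> (a \<otimes> a [^] n)" if "c \<in> carrier R" for c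
      using that assms by (simp add: m_lcomm)
    thus ?thesis by (auto simp: set_eq_iff l_coset_iff cgenideal_def)
  qed
  finally show ?case using assms by (simp add: m_comm)
qed

lemma Idl_insert:
  assumes "x \<in> carrier R" "S \<subseteq> carrier R"
  shows "Idl (insert x S) = PIdl x <+> Idl S"
proof
  have I: "ideal (PIdl x) R" "ideal (Idl S) R" "ideal (Idl (insert x S)) R"
    using assms cgenideal_ideal genideal_ideal by auto
  show "Idl (insert x S) \<subseteq> PIdl x <+> Idl S"
    using set_add_upper[OF I(1,2)] cgenideal_self[OF assms(1)] genideal_self[OF assms(2)]
    by (intro genideal_minimal add_ideals I) auto
  show "PIdl x <+> Idl S \<subseteq> Idl (insert x S)"
    unfolding set_add_subset_iff[OF I]
    using genideal_self[of "insert x S"] assms I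
    by (intro conjI cgenideal_minimal genideal_minimal) auto
qed

end

section \<open>Units, Nakayama's lemma and numbers of generators\<close>

context noetherian_local_ring
begin

lemma m_ideal: "ideal m R"
  using maximal maximalideal.axioms(1) by blast

lemma m_prime: "primeideal m R"
  using maximalideal_prime[OF maximal] .

lemma one_notin_m: "\<one> \<notin> m"
  using m_prime ideal.one_imp_carrier[OF m_ideal] primeideal.I_notcarr by blast

text \<open>If \<open>x\<close> were not a unit, a maximal element among the proper ideals
  containing \<open>x\<close> would be a maximal ideal, hence equal to \<open>m\<close>.\<close>

lemma unit_of_notin_m:
  assumes "x \<in> carrier R" "x \<notin> m"
  shows "\<exists>y\<in>carrier R. y \<otimes> x = \<one>"
proof (rule ccontr)
  assume *: "\<not> ?thesis"
  have "\<one> \<notin> PIdl x" using * by (force simp: cgenideal_def)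
  let ?S = "\<lambda>V. ideal V R \<and> x \<in> V \<and> \<one> \<notin> V"
  have "?S (PIdl x)" using cgenideal_ideal cgenideal_self assms \<open>\<one> \<notin> PIdl x\<close> by auto
  then obtain M where M: "ideal M R" "x \<in> M" "\<one> \<notin> M"
    and max: "\<And>V. ?S V \<Longrightarrow> M \<subseteq> V \<Longrightarrow> V = M"
    using exists_maximal_element[of ?S "PIdl x"] by metis
  have "maximalideal M R"
  proof (rule maximalidealI)
    show "carrier R \<noteq> M" using M by auto
    fix J assume J: "ideal J R" "M \<subseteq> J" "J \<subseteq> carrier R"
    show "J = M \<or> J = carrier R"
      using max[of J] J M ideal.one_imp_carrier[OF J(1)] by blast
  qed (rule M)
  hence "M = m" using maximal_unique by simp
  thus False using M assms by simp
qed

lemma one_minus_unit: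
  assumes "c \<in> m"
  shows "\<exists>y\<in>carrier R. y \<otimes> (\<one> \<ominus> c) = \<one>"
proof (rule unit_of_notin_m)
  have c: "c \<in> carrier R" using assms ideal.Icarr[OF m_ideal] by simp
  thus "\<one> \<ominus> c \<in> carrier R" by simp
  show "\<one> \<ominus> c \<notin> m"
  proof
    assume "\<one> \<ominus> c \<in> m"
    hence "(\<one> \<ominus> c) \<oplus> c \<in> m" using assms ideal_add_closed[OF m_ideal] by blast
    moreover have "(\<one> \<ominus> c) \<oplus> c = \<one>" using c by algebra
    ultimately show False using one_notin_m by simp
  qed
qed

theorem nakayama:
  assumes N: "ideal N R" and L: "ideal L R" "L \<subseteq> N" and le: "N \<subseteq> m \<cdot> N <+> L"
  shows "N = L"
proof (rule ccontr)
  assume "N \<noteq> L"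
  let ?S = "\<lambda>V. ideal V R \<and> L \<subseteq> V \<and> V \<subset> N"
  have "?S L" using L \<open>N \<noteq> L\<close> by auto
  then obtain V where V: "ideal V R" "L \<subseteq> V" "V \<subset> N"
    and max: "\<And>W. ?S W \<Longrightarrow> V \<subseteq> W \<Longrightarrow> W = V"
    using exists_maximal_element[of ?S L] by metis
  obtain x where x: "x \<in> N" "x \<notin> V" using V by blast
  have xc: "x \<in> carrier R" using x ideal.Icarr[OF N] by blast
  note PI = cgenideal_ideal[OF xc]
  have "V <+> PIdl x \<subseteq> N"
    using V x cgenideal_minimal[OF N, of x] by (subst set_add_subset_iff[OF V(1) PI N]) auto
  moreover have "V <+> PIdl x \<noteq> V"
    using set_add_upper(2)[OF V(1) PI] cgenideal_self[OF xc] x by blast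
  ultimately have Neq: "V <+> PIdl x = N"
    using max[of "V <+> PIdl x"] add_ideals[OF V(1) PI] set_add_upper(1)[OF V(1) PI] V(2) by blast
  have I: "ideal (x <# m) R" using l_coset_ideal[OF m_ideal xc] .
  have "m \<cdot> N \<subseteq> V <+> (x <# m)"
  proof (subst ideal_prod_subset_iff[OF add_ideals[OF V(1) I]], clarify)
    fix i n assume i: "i \<in> m" and "n \<in> N"
    then obtain v d where vd: "v \<in> V" "d \<in> carrier R" "n = v \<oplus> d \<otimes> x"
      using Neq by (auto simp: set_add_iff cgenideal_def)
    have c: "i \<in> carrier R" "v \<in> carrier R" using i vd V m_ideal ideal.Icarr by metis+
    have "i \<otimes> n = i \<otimes> v \<oplus> x \<otimes> (i \<otimes> d)" using vd c xc by algebra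
    moreover have "i \<otimes> v \<in> V" "i \<otimes> d \<in> m"
      using ideal.I_l_closed[OF V(1) vd(1) c(1)] ideal.I_r_closed[OF m_ideal i vd(2)] by auto
    moreover from this have "x \<otimes> (i \<otimes> d) \<in> x <# m" by (auto simp: l_coset_iff)
    ultimately show "i \<otimes> n \<in> V <+> (x <# m)" unfolding set_add_iff by blast
  qed
  hence "m \<cdot> N <+> L \<subseteq> V <+> (x <# m)"
    using set_add_upper(1)[OF V(1) I] V L
    by (subst set_add_subset_iff[OF ideal_prod_is_ideal[OF m_ideal N] L(1) add_ideals[OF V(1) I]]) auto
  hence "x \<in> V <+> (x <# m)" using le x by blast
  then obtain v c where vc: "v \<in> V" "c \<in> m" "x = v \<oplus> x \<otimes> c"
    by (auto simp: set_add_iff Bex_def l_coset_iff)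
  have c: "v \<in> carrier R" "c \<in> carrier R" using vc V m_ideal ideal.Icarr by metis+
  have "v = (v \<oplus> x \<otimes> c) \<ominus> x \<otimes> c" using c xc by algebra
  also have "\<dots> = x \<ominus> x \<otimes> c" using vc(3) by simp
  also have "\<dots> = (\<one> \<ominus> c) \<otimes> x" using c xc by algebra
  finally have v: "v = (\<one> \<ominus> c) \<otimes> x" .
  obtain y where y: "y \<in> carrier R" "y \<otimes> (\<one> \<ominus> c) = \<one>" using one_minus_unit[OF vc(2)] by blast
  have "y \<otimes> v = x" using v y c xc m_assoc[of y "\<one> \<ominus> c" x] by simp
  thus False using x ideal.I_l_closed[OF V(1) vc(1) y(1)] by simp
qed

text \<open>The quotient is generated by \<open>x\<close> and killed by \<open>m\<close>, so it has
  dimension at most one over the residue field: if \<open>l + c x\<close> is outside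
  \<open>L\<close>, then \<open>c\<close> is a unit and \<open>x\<close> can be recovered.\<close>

lemma ideal_length_add_principal:
  assumes L: "ideal L R" and x: "x \<in> carrier R" "\<And>c. c \<in> m \<Longrightarrow> c \<otimes> x \<in> L"
  shows "ideal_length R L (L <+> PIdl x) \<le> 1"
proof (rule ideal_length_le_1[OF L])
  note PI = cgenideal_ideal[OF x(1)]
  show "L \<subseteq> L <+> PIdl x" using set_add_upper(1)[OF L PI] .
  fix V assume V: "ideal V R" "L \<subseteq> V" "V \<subseteq> L <+> PIdl x"
  show "V = L \<or> V = L <+> PIdl x"
  proof (rule disjCI)
    assume "V \<noteq> L <+> PIdl x"
    hence "\<not> L <+> PIdl x \<subseteq> V" using V by blast
    hence xV: "x \<notin> V" using V cgenideal_minimal[OF V(1)] by (auto simp: set_add_subset_iff[OF L PI V(1)])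
    show "V = L"
    proof (rule ccontr)
      assume "V \<noteq> L"
      then obtain y where y: "y \<in> V" "y \<notin> L" using V by blast
      then obtain l c where lc: "l \<in> L" "c \<in> carrier R" "y = l \<oplus> c \<otimes> x"
        using V(3) by (auto simp: set_add_iff cgenideal_def subset_iff)
      have lc': "l \<in> carrier R" using lc L ideal.Icarr by metis
      have "c \<notin> m" using y lc x(2) ideal_add_closed[OF L] by metis
      then obtain d where d: "d \<in> carrier R" "d \<otimes> c = \<one>" using unit_of_notin_m lc by blast
      have "d \<otimes> (y \<ominus> l) = (d \<otimes> c) \<otimes> x" using lc lc' d(1) x(1) by algebra
      moreover have "d \<otimes> (y \<ominus> l) \<in> V"
        using y lc V by (intro ideal.I_l_closed[OF V(1)] d ideal_minus_closed) auto
      ultimately show False using d x xV by simp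
    qed
  qed
qed

lemma ideal_length_add_generators:
  assumes L: "ideal L R" and S: "finite S" "S \<subseteq> carrier R" "\<And>c x. c \<in> m \<Longrightarrow> x \<in> S \<Longrightarrow> c \<otimes> x \<in> L"
  shows "ideal_length R L (L <+> Idl S) \<le> enat (card S)"
  using S
proof (induction rule: finite_induct)
  case empty
  have "L <+> {\<zero>} = L" using set_add_absorb[OF zeroideal L] set_add_comm ideal_zero_closed[OF L]
      ideal_subset_carrier[OF L] by simp
  thus ?case using ideal_length_same[OF L] by (simp add: Idl_empty)
next
  case (insert x S)
  have x: "x \<in> carrier R" and S: "S \<subseteq> carrier R" using insert by auto
  note I = cgenideal_ideal[OF x] genideal_ideal[OF S]
  note LS = add_ideals[OF L I(2)]
  have eq: "L <+> Idl (insert x S) = (L <+> Idl S) <+> PIdl x"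
    using Idl_insert[OF x S] set_add_comm[of "PIdl x" "Idl S"] add.set_mult_assoc
      ideal_subset_carrier I L by (simp add: set_add_def)
  have "ideal_length R L (L <+> Idl (insert x S)) =
      ideal_length R L (L <+> Idl S) + ideal_length R (L <+> Idl S) ((L <+> Idl S) <+> PIdl x)"
    unfolding eq using L LS I(1) add_ideals[OF LS I(1)] set_add_upper(1)[OF LS I(1)]
      set_add_upper(1)[OF L I(2)] by (intro ideal_length_add)
  also have "\<dots> \<le> enat (card S) + 1"
    using insert set_add_upper(1)[OF L I(2)] x
    by (intro add_mono ideal_length_add_principal[OF LS]) auto
  finally show ?case using insert by (simp add: one_enat_def)
qed

lemma m_prod_ideal: "ideal N R \<Longrightarrow> ideal (m \<cdot> N) R"
  using ideal_prod_is_ideal m_ideal by blast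

lemma m_prod_subset: "ideal N R \<Longrightarrow> m \<cdot> N \<subseteq> N"
  using ideal_prod_subset m_ideal by blast

text \<open>Adding generators one at a time bounds the length from above. For a generating set of
  least size the resulting chain is strict, which gives the lower bound.\<close>

theorem ideal_length_min_gens:
  assumes N: "ideal N R"
  shows "ideal_length R (m \<cdot> N) N = enat (min_gens R N)"
proof -
  note mN = m_prod_ideal[OF N] m_prod_subset[OF N]
  let ?P = "\<lambda>k. \<exists>S. S \<subseteq> carrier R \<and> finite S \<and> card S = k \<and> Idl S = N"
  have "\<exists>k. ?P k" using finetely_gen[OF N] by metis
  from LeastI_ex[OF this] obtain S where S: "S \<subseteq> carrier R" "finite S" "card S = min_gens R N" "Idl S = N"
    unfolding min_gens_def by blast
  have least: "min_gens R N \<le> card T" if "T \<subseteq> carrier R" "finite T" "Idl T = N" for T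
    unfolding min_gens_def by (rule Least_le) (use that in blast)
  have SN: "S \<subseteq> N" using S genideal_self by blast
  have "m \<cdot> N <+> N = N" using set_add_absorb mN N by blast
  hence le: "ideal_length R (m \<cdot> N) N \<le> enat (min_gens R N)"
    using ideal_length_add_generators[OF mN(1) S(2,1)] S SN by (auto intro: ideal_prod.prod)
  obtain f where f: "bij_betw f {..<card S} S" using ex_bij_betw_nat_finite[OF S(2)] atLeast0LessThan by auto
  let ?c = "\<lambda>i. m \<cdot> N <+> Idl (f ` {..<i})"
  have fS: "f ` {..<i} \<subseteq> S" if "i \<le> card S" for i
    using f that by (auto simp: bij_betw_def)
  have idl: "ideal (Idl (f ` {..<i})) R" if "i \<le> card S" for i
    using fS[OF that] S by (intro genideal_ideal) auto
  have "ideal_chain R (m \<cdot> N) N (card S)" unfolding ideal_chain_def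
  proof (intro exI[of _ ?c] conjI allI impI)
    fix i assume i: "i \<le> card S"
    show "ideal (?c i) R" using add_ideals mN idl i by blast
    show "m \<cdot> N \<subseteq> ?c i" using set_add_upper(1) mN idl i by blast
    show "?c i \<subseteq> N" using mN fS[OF i] SN genideal_minimal[OF N]
      by (subst set_add_subset_iff[OF mN(1) idl[OF i] N]) auto
  next
    fix i assume i: "i < card S"
    have i': "i \<le> card S" "Suc i \<le> card S" using i by auto
    have fi: "f i \<in> S" using fS[OF i'(2)] by auto
    have T: "S - {f i} \<subseteq> carrier R" "finite (S - {f i})" using S by auto
    note TI = genideal_ideal[OF T(1)]
    have sub: "f ` {..<i} \<subseteq> S - {f i}"
      using fS[OF i'(1)] f i by (auto simp: bij_betw_def inj_on_def)
    \<comment> \<open>Otherwise \<open>f i\<close> is redundant modulo \<open>m N\<close>, and by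
      Nakayama the other generators suffice, against the choice of \<open>S\<close>.\<close>
    have "f i \<notin> ?c i"
    proof
      assume "f i \<in> ?c i"
      also have "?c i \<subseteq> m \<cdot> N <+> Idl (S - {f i})"
        using subset_Idl_subset[OF T(1) sub] by (intro set_add_mono) auto
      finally have "f i \<in> m \<cdot> N <+> Idl (S - {f i})" .
      moreover have "S - {f i} \<subseteq> m \<cdot> N <+> Idl (S - {f i})"
        using genideal_self[OF T(1)] set_add_upper(2)[OF mN(1) TI] by blast
      ultimately have "N \<subseteq> m \<cdot> N <+> Idl (S - {f i})"
        unfolding S(4)[symmetric] using add_ideals[OF mN(1) TI] S(4) by (intro genideal_minimal) auto
      moreover have "Idl (S - {f i}) \<subseteq> N" using SN genideal_minimal[OF N] by blast
      ultimately have "N = Idl (S - {f i})" using nakayama[OF N TI] by blast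
      hence "card S \<le> card (S - {f i})" using least[OF T] S by simp
      thus False using fi S(2) by (metis card_Diff1_less not_less)
    qed
    moreover have "f i \<in> ?c (Suc i)"
      using set_add_upper(2)[OF mN(1) idl[OF i'(2)]] genideal_self[of "f ` {..<Suc i}"] fS[OF i'(2)] S(1)
      by auto
    moreover have "Idl (f ` {..<i}) \<subseteq> Idl (f ` {..<Suc i})"
      using fS[OF i'(2)] S(1) by (intro subset_Idl_subset) auto
    hence "?c i \<subseteq> ?c (Suc i)" by (intro set_add_mono) auto
    ultimately show "?c i \<subset> ?c (Suc i)" by blast
  qed
  hence "enat (card S) \<le> ideal_length R (m \<cdot> N) N" using le_ideal_length_iff mN by blast
  thus ?thesis using le S by simp
qed

end

section \<open>The fiber cone as a graded ring\<close>

lemma (in cring) ideal_finsum_closed: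
  assumes "ideal N R" "finite S" "\<And>i. i \<in> S \<Longrightarrow> g i \<in> N"
  shows "(\<Oplus>i\<in>S. g i) \<in> N"
  using quot_finsum[OF assms(1,1,2), of g] assms(3) by simp

locale fiber_ring = noetherian_local_ring R m for R (structure) and m +
  fixes L
  assumes L_ideal: "ideal L R"
begin

abbreviation pw where "pw \<equiv> ideal_pow R L"
abbreviation mpw where "mpw n \<equiv> m \<cdot> ideal_pow R L n"
abbreviation F where "F \<equiv> fiber_cone R m L"

text \<open>Elements of \<open>F(L)\<close> are represented by polynomials over \<open>R\<close> with \<open>n\<close>-th coefficient in \<open>L\<^sup>n\<close>, that
  is, by elements of the Rees algebra of \<open>L\<close>.\<close>

definition rees where "rees = {p. (\<forall>n. p n \<in> pw n) \<and> (\<exists>n. \<forall>k>n. p k = \<zero>)}"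

definition conv where "conv p q = (\<lambda>n::nat. \<Oplus>i\<in>{..n}. p i \<otimes> q (n - i))"

definition fib where "fib p = (\<lambda>n. mpw n +> p n)"

definition mono where "mono n x = (\<lambda>k::nat. if k = n then x else \<zero>)"

definition homog where "homog n x = fib (mono n x)"

lemma pw_ideal: "ideal (pw n) R" and mpw_ideal: "ideal (mpw n) R" and mpw_subset: "mpw n \<subseteq> pw n"
  using L_ideal ideal_pow_ideal m_prod_ideal m_prod_subset by blast+

lemma pw_carrier: "x \<in> pw n \<Longrightarrow> x \<in> carrier R" and mpw_pw: "x \<in> mpw n \<Longrightarrow> x \<in> pw n"
  and mpw_carrier: "x \<in> mpw n \<Longrightarrow> x \<in> carrier R"
  using ideal.Icarr[OF pw_ideal] mpw_subset by blast+

lemma pw_mult: "x \<in> pw i \<Longrightarrow> y \<in> pw j \<Longrightarrow> x \<otimes> y \<in> pw (i + j)"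
  using ideal_pow_mult_closed L_ideal by blast

lemma mpw_mult: 
  assumes "x \<in> pw i" "y \<in> mpw j" shows "x \<otimes> y \<in> mpw (i + j)"
proof -
  have "pw i \<cdot> mpw j = (pw i \<cdot> m) \<cdot> pw j"
    using ideal_prod_assoc pw_ideal m_ideal by simp
  also have "\<dots> = m \<cdot> (pw i \<cdot> pw j)"
    using ideal_prod_assoc pw_ideal m_ideal ideal_prod_commute[OF pw_ideal m_ideal] by metis
  also have "\<dots> = mpw (i + j)" using ideal_pow_add L_ideal by simp
  finally show ?thesis using assms by (auto intro: ideal_prod.prod)
qed

lemma mpw_mult': "x \<in> mpw i \<Longrightarrow> y \<in> pw j \<Longrightarrow> x \<otimes> y \<in> mpw (i + j)"
  using mpw_mult[of y j x i] by (simp add: m_comm mpw_carrier pw_carrier add.commute)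

lemma m_mult_pw: "c \<in> m \<Longrightarrow> x \<in> pw n \<Longrightarrow> c \<otimes> x \<in> mpw n"
  by (rule ideal_prod.prod)

lemma mpw_0: "mpw 0 = m"
  using ideal_prod_carrier m_ideal by auto

lemma reesI: "(\<And>n. p n \<in> pw n) \<Longrightarrow> (\<And>k. k > n \<Longrightarrow> p k = \<zero>) \<Longrightarrow> p \<in> rees"
  unfolding rees_def by blast

lemma rees_pw: "p \<in> rees \<Longrightarrow> p n \<in> pw n" by (simp add: rees_def)

lemma rees_carrier: "p \<in> rees \<Longrightarrow> p n \<in> carrier R" using rees_pw pw_carrier by blast

lemma pw_zero: "\<zero> \<in> pw n" using ideal_zero_closed pw_ideal by blast

lemma mono_rees: "x \<in> pw n \<Longrightarrow> mono n x \<in> rees"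
  by (rule reesI[of _ n]) (auto simp: mono_def pw_zero)

lemma upd_zero_rees: "p \<in> rees \<Longrightarrow> p(n := \<zero>) \<in> rees"
  by (auto simp: rees_def pw_zero)

lemma conv_pw:
  assumes "p \<in> rees" "q \<in> rees" shows "conv p q n \<in> pw n"
proof -
  have "p i \<otimes> q (n - i) \<in> pw n" if "i \<in> {..n}" for i
    using pw_mult[OF rees_pw[OF assms(1), of i] rees_pw[OF assms(2), of "n - i"]] that by simp
  thus ?thesis unfolding conv_def by (intro ideal_finsum_closed pw_ideal) auto
qed

lemma rees_UP: "rees \<subseteq> carrier (UP R)"
  unfolding rees_def UP_def using pw_carrier by (auto simp: up_def bound_def)

lemma minus_rees: "p \<in> rees \<Longrightarrow> (\<lambda>n. \<ominus> p n) \<in> rees"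
  using pw_ideal unfolding rees_def by (auto simp: additive_subgroup.a_inv_closed ideal.axioms(1)) (metis minus_zero)

lemma UP_ops:
  assumes "p \<in> rees" "q \<in> rees"
  shows "p \<otimes>\<^bsub>UP R\<^esub> q = conv p q" "p \<oplus>\<^bsub>UP R\<^esub> q = (\<lambda>n. p n \<oplus> q n)"
    "\<ominus>\<^bsub>UP R\<^esub> p = (\<lambda>n. \<ominus> p n)"
proof -
  interpret U: UP_cring R "UP R" by unfold_locales (rule reflexive)
  have c: "p \<in> up R" "q \<in> up R" using assms rees_UP by (auto simp: UP_def)
  show "p \<otimes>\<^bsub>UP R\<^esub> q = conv p q" "p \<oplus>\<^bsub>UP R\<^esub> q = (\<lambda>n. p n \<oplus> q n)"
    unfolding UP_def conv_def using c by simp_all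
  have m: "(\<lambda>n. \<ominus> p n) \<in> up R"
    using minus_rees[OF assms(1)] rees_UP by (auto simp: UP_def)
  have pc: "p \<in> carrier (UP R)" "(\<lambda>n. \<ominus> p n) \<in> carrier (UP R)"
    using minus_rees assms rees_UP by blast+
  have eq: "(\<lambda>n. \<ominus> p n) \<oplus>\<^bsub>UP R\<^esub> p = \<zero>\<^bsub>UP R\<^esub>"
    unfolding UP_def using m c(1) rees_carrier[OF assms(1)] by (simp add: l_neg)
  show "\<ominus>\<^bsub>UP R\<^esub> p = (\<lambda>n. \<ominus> p n)" by (rule U.P.minus_equality[OF eq pc])
qed

lemma conv_rees:
  assumes "p \<in> rees" "q \<in> rees" shows "conv p q \<in> rees"
proof -
  interpret U: UP_cring R "UP R" by unfold_locales (rule reflexive)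
  have "p \<otimes>\<^bsub>UP R\<^esub> q \<in> carrier (UP R)" using assms rees_UP by blast
  hence "conv p q \<in> up R" unfolding UP_ops(1)[OF assms] by (simp add: UP_def)
  then obtain n where "bound \<zero> n (conv p q)" unfolding up_def by blast
  hence "\<exists>n. \<forall>k>n. conv p q k = \<zero>" unfolding bound_def by blast
  thus ?thesis using conv_pw[OF assms] by (simp add: rees_def)
qed

lemma add_rees: 
  assumes "p \<in> rees" "q \<in> rees" shows "(\<lambda>n. p n \<oplus> q n) \<in> rees"
proof -
  obtain i j where ij: "\<And>k. k > i \<Longrightarrow> p k = \<zero>" "\<And>k. k > j \<Longrightarrow> q k = \<zero>"
    using assms by (auto simp: rees_def)
  show ?thesis by (rule reesI[of _ "max i j"]) (use ij assms rees_pw pw_ideal ideal_add_closed in auto)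
qed

lemma piece_zero: "\<zero>\<^bsub>fiber_piece R m L n\<^esub> = mpw n"
  by (simp add: fiber_piece_def quot_module_def)

lemma piece_carrier: "carrier (fiber_piece R m L n) = (\<lambda>x. mpw n +> x) ` pw n"
  by (simp add: fiber_piece_def quot_module_def)

lemma fib_eq_iff: "p \<in> rees \<Longrightarrow> q \<in> rees \<Longrightarrow> fib p = fib q \<longleftrightarrow> (\<forall>n. p n \<ominus> q n \<in> mpw n)"
  unfolding fib_def fun_eq_iff using coset_eq_iff[OF mpw_ideal] rees_carrier by simp

lemma fib_closed:
  assumes "p \<in> rees" shows "fib p \<in> carrier F"
proof -
  obtain k where k: "\<And>j. j > k \<Longrightarrow> p j = \<zero>" using assms by (auto simp: rees_def)
  have "{n. fib p n \<noteq> mpw n} \<subseteq> {..k}"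
    using k coset_zero[OF mpw_ideal] by (force simp: fib_def not_le[symmetric])
  hence "finite {n. fib p n \<noteq> mpw n}" using finite_subset by blast
  thus ?thesis using rees_pw[OF assms]
    by (simp add: fiber_cone_def piece_zero piece_carrier) (simp add: fib_def)
qed

lemma fib_surj:
  assumes "f \<in> carrier F" shows "\<exists>p\<in>rees. f = fib p"
proof -
  have f: "\<forall>n. \<exists>x\<in>pw n. f n = mpw n +> x" "finite {n. f n \<noteq> mpw n}"
    using assms by (auto simp: fiber_cone_def piece_zero piece_carrier)
  then obtain x where x: "\<And>n. x n \<in> pw n" "\<And>n. f n = mpw n +> x n" by metis
  \<comment> \<open>Zero cosets get the representative zero; an arbitrary choice of representatives
    need not have finite support.\<close>
  define p where "p n = (if f n = mpw n then \<zero> else x n)" for n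
  obtain k where "\<And>n. f n \<noteq> mpw n \<Longrightarrow> n \<le> k" using f(2) unfolding finite_nat_set_iff_bounded_le by auto
  hence "p \<in> rees" using x pw_zero by (intro reesI[of _ k]) (force simp: p_def)+
  moreover have "f = fib p"
  proof
    fix n show "f n = fib p n" using x(2)[of n] coset_zero[OF mpw_ideal, of n] by (simp add: fib_def p_def)
  qed
  ultimately show ?thesis by blast
qed

lemma fib_zero: "\<zero>\<^bsub>F\<^esub> = fib (\<lambda>n. \<zero>)"
  using coset_zero[OF mpw_ideal] by (simp add: fiber_cone_def piece_zero fib_def)

lemma fib_one: "\<one>\<^bsub>F\<^esub> = homog 0 \<one>"
  using coset_zero[OF mpw_ideal] unfolding homog_def fib_def mono_def
  by (auto simp: fiber_cone_def piece_zero fun_eq_iff)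

lemma fib_add:
  "p \<in> rees \<Longrightarrow> q \<in> rees \<Longrightarrow> fib p \<oplus>\<^bsub>F\<^esub> fib q = fib (\<lambda>n. p n \<oplus> q n)"
  unfolding fib_def using rees_carrier quot_add[OF mpw_ideal]
  by (simp add: fiber_cone_def fiber_piece_def)

lemma fib_mult:
  assumes "p \<in> rees" "q \<in> rees" shows "fib p \<otimes>\<^bsub>F\<^esub> fib q = fib (conv p q)"
proof -
  \<comment> \<open>The union over all pairs of representatives collapses to one coset, since
    changing a factor by an element of \<open>mpw\<close> changes the product by an element of
    \<open>mpw n\<close>.\<close>
  have coset: "rcoset_mult R (mpw n) (fib p i) (fib q (n - i)) = mpw n +> (p i \<otimes> q (n - i))"
    if i: "i \<le> n" for i n
  proof -
    have *: "mpw n +> (x \<otimes> y) = mpw n +> (p i \<otimes> q (n - i))"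
      if x: "x \<in> mpw i +> p i" and y: "y \<in> mpw (n - i) +> q (n - i)" for x y
    proof -
      obtain k where k: "k \<in> mpw i" "x = k \<oplus> p i" using x unfolding a_r_coset_def' by blast
      obtain l where l: "l \<in> mpw (n - i)" "y = l \<oplus> q (n - i)" using y unfolding a_r_coset_def' by blast
      note c = mpw_carrier[OF k(1)] mpw_carrier[OF l(1)] rees_carrier[OF assms(1), of i] rees_carrier[OF assms(2), of "n - i"]
      have "x \<otimes> y \<ominus> p i \<otimes> q (n - i) = k \<otimes> (l \<oplus> q (n - i)) \<oplus> p i \<otimes> l"
        unfolding k(2) l(2) using c by algebra
      moreover have "k \<otimes> (l \<oplus> q (n - i)) \<in> mpw n"
        using mpw_mult'[OF k(1), of "l \<oplus> q (n - i)" "n - i"] i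
          ideal_add_closed[OF pw_ideal mpw_pw[OF l(1)] rees_pw[OF assms(2)]] by simp
      moreover have "p i \<otimes> l \<in> mpw n"
        using mpw_mult[OF rees_pw[OF assms(1), of i] l(1)] i by simp
      ultimately have "x \<otimes> y \<ominus> p i \<otimes> q (n - i) \<in> mpw n" using ideal_add_closed[OF mpw_ideal] by simp
      thus ?thesis using coset_eq_iff[OF mpw_ideal] c k(2) l(2) by simp
    qed
    have "rcoset_mult R (mpw n) (fib p i) (fib q (n - i)) =
        (\<Union>x\<in>mpw i +> p i. \<Union>y\<in>mpw (n - i) +> q (n - i). mpw n +> (x \<otimes> y))"
      by (simp add: rcoset_mult_def fib_def)
    also have "\<dots> = (\<Union>x\<in>mpw i +> p i. \<Union>y\<in>mpw (n - i) +> q (n - i). mpw n +> (p i \<otimes> q (n - i)))"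
      by (intro SUP_cong refl *)
    also have "\<dots> = mpw n +> (p i \<otimes> q (n - i))"
      using coset_self[OF mpw_ideal rees_carrier[OF assms(1), of i]]
        coset_self[OF mpw_ideal rees_carrier[OF assms(2), of "n - i"]] by blast
    finally show ?thesis .
  qed
  have "(fib p \<otimes>\<^bsub>F\<^esub> fib q) n = fib (conv p q) n" for n
  proof -
    interpret Q: abelian_group "quot_module R (pw n) (mpw n)"
      using quot_abelian_group mpw_ideal pw_ideal by blast
    have pq: "p i \<otimes> q (n - i) \<in> pw n" if "i \<le> n" for i
      using pw_mult[OF rees_pw[OF assms(1), of i] rees_pw[OF assms(2), of "n - i"]] that by simp
    have "(fib p \<otimes>\<^bsub>F\<^esub> fib q) n =
        (\<Oplus>\<^bsub>quot_module R (pw n) (mpw n)\<^esub>i\<in>{..n}. rcoset_mult R (mpw n) (fib p i) (fib q (n - i)))"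
      by (simp add: fiber_cone_def fiber_piece_def)
    also have "\<dots> = (\<Oplus>\<^bsub>quot_module R (pw n) (mpw n)\<^esub>i\<in>{..n}. mpw n +> (p i \<otimes> q (n - i)))"
      using coset pq by (intro Q.finsum_cong') (auto simp: quot_carrier)
    also have "\<dots> = mpw n +> (conv p q n)"
      unfolding conv_def using quot_finsum[OF mpw_ideal pw_ideal, of "{..n}"] pq by auto
    finally show ?thesis by (simp add: fib_def)
  qed
  thus ?thesis by blast
qed

lemma one_rees: "mono 0 \<one> \<in> rees" by (rule mono_rees) simp

lemma zero_rees: "(\<lambda>n. \<zero>) \<in> rees" by (rule reesI) (auto simp: pw_zero)

lemma UP_one: "\<one>\<^bsub>UP R\<^esub> = mono 0 \<one>" and UP_zero: "\<zero>\<^bsub>UP R\<^esub> = (\<lambda>n. \<zero>)"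
  by (auto simp: UP_def mono_def)

lemma F_carrier: "carrier F = fib ` rees"
  using fib_closed fib_surj by blast

text \<open>\<open>F\<close> is the image of the subring \<open>rees\<close> of the polynomial ring
  \<open>UP R\<close> under the ring homomorphism \<open>fib\<close>. The ring laws are inherited
  instead of being checked on sums of cosets.\<close>

lemma F_cring: "cring F"
proof -
  interpret U: UP_cring R "UP R" by unfold_locales (rule reflexive)
  have sub: "subring rees (UP R)"
    by (rule U.P.subringI)
      (use rees_UP UP_ops minus_rees conv_rees add_rees one_rees UP_one in auto)
  let ?R = "(UP R)\<lparr>carrier := rees\<rparr>"
  interpret S: ring ?R by (rule U.P.subring_is_ring[OF sub])
  have "fib \<in> ring_hom ?R F"
    by (rule ring_hom_memI) (auto simp: fib_closed UP_ops fib_mult fib_add fib_one homog_def UP_one)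
  hence "ring (F\<lparr>carrier := fib ` rees, zero := fib \<zero>\<^bsub>UP R\<^esub>\<rparr>)"
    using S.ring_hom_imp_img_ring[of fib F] by simp
  moreover have "F\<lparr>carrier := fib ` rees, zero := fib \<zero>\<^bsub>UP R\<^esub>\<rparr> = F"
    unfolding F_carrier[symmetric] UP_zero fib_zero[symmetric] by simp
  ultimately interpret FR: ring F by simp
  show ?thesis
  proof (intro cring.intro FR.ring_axioms comm_monoid.intro FR.monoid_axioms comm_monoid_axioms.intro)
    fix f g assume "f \<in> carrier F" "g \<in> carrier F"
    then obtain p q where pq: "p \<in> rees" "q \<in> rees" "f = fib p" "g = fib q" using F_carrier by auto
    have "p \<otimes>\<^bsub>UP R\<^esub> q = q \<otimes>\<^bsub>UP R\<^esub> p" by (rule U.P.m_comm) (use rees_UP pq in auto)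
    hence "conv p q = conv q p" using UP_ops(1) pq(1,2) by simp
    thus "f \<otimes>\<^bsub>F\<^esub> g = g \<otimes>\<^bsub>F\<^esub> f" using pq fib_mult by simp
  qed
qed

lemma conv_mono:
  assumes "x \<in> pw k" "p \<in> rees"
  shows "conv (mono k x) p = (\<lambda>n. if n < k then \<zero> else x \<otimes> p (n - k))"
proof
  fix n
  show "conv (mono k x) p n = (if n < k then \<zero> else x \<otimes> p (n - k))"
  proof (cases "n < k")
    case True
    have "conv (mono k x) p n = (\<Oplus>i\<in>{..n}. \<zero>)"
      unfolding conv_def using True rees_carrier[OF assms(2)] by (intro finsum_cong') (auto simp: mono_def)
    thus ?thesis using True by simp
  next
    case False
    have "conv (mono k x) p n = (\<Oplus>i\<in>{..n}. if k = i then x \<otimes> p (n - i) else \<zero>)"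
      unfolding conv_def using rees_carrier[OF assms(2)] pw_carrier[OF assms(1)]
      by (intro finsum_cong') (auto simp: mono_def)
    also have "\<dots> = x \<otimes> p (n - k)"
      using rees_carrier[OF assms(2)] pw_carrier[OF assms(1)] False
      by (intro finsum_singleton) auto
    finally show ?thesis using False by simp
  qed
qed

lemma homog_closed: "x \<in> pw n \<Longrightarrow> homog n x \<in> carrier F"
  unfolding homog_def by (intro fib_closed mono_rees)

lemma homog_mult_fib:
  assumes "x \<in> pw k" "p \<in> rees"
  shows "homog k x \<otimes>\<^bsub>F\<^esub> fib p = fib (\<lambda>n. if n < k then \<zero> else x \<otimes> p (n - k))"
  unfolding homog_def using fib_mult[OF mono_rees] conv_mono assms by simp

lemma homog_mult:
  assumes "x \<in> pw i" "y \<in> pw j"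
  shows "homog i x \<otimes>\<^bsub>F\<^esub> homog j y = homog (i + j) (x \<otimes> y)"
proof -
  have "homog i x \<otimes>\<^bsub>F\<^esub> homog j y = fib (\<lambda>n. if n < i then \<zero> else x \<otimes> mono j y (n - i))"
    unfolding homog_def[of j] by (rule homog_mult_fib[OF assms(1) mono_rees[OF assms(2)]])
  also have "(\<lambda>n. if n < i then \<zero> else x \<otimes> mono j y (n - i)) = mono (i + j) (x \<otimes> y)"
    using pw_carrier[OF assms(1)] by (auto simp: mono_def fun_eq_iff)
  finally show ?thesis by (simp add: homog_def)
qed

lemma homog_add:
  assumes "x \<in> pw n" "y \<in> pw n"
  shows "homog n x \<oplus>\<^bsub>F\<^esub> homog n y = homog n (x \<oplus> y)"
proof -
  have "(\<lambda>k. mono n x k \<oplus> mono n y k) = mono n (x \<oplus> y)" by (auto simp: mono_def)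
  thus ?thesis unfolding homog_def using fib_add[OF mono_rees mono_rees] assms by simp
qed

lemma fib_eq_zero_iff:
  assumes "p \<in> rees" shows "fib p = \<zero>\<^bsub>F\<^esub> \<longleftrightarrow> (\<forall>n. p n \<in> mpw n)"
  unfolding fib_zero fib_eq_iff[OF assms zero_rees] using rees_carrier[OF assms]
  by (simp add: a_minus_def)

lemma homog_eq_zero_iff: "x \<in> pw n \<Longrightarrow> homog n x = \<zero>\<^bsub>F\<^esub> \<longleftrightarrow> x \<in> mpw n"
  unfolding homog_def using fib_eq_zero_iff[OF mono_rees] ideal_zero_closed[OF mpw_ideal]
  by (auto simp: mono_def)

lemma homog_zero: "homog n \<zero> = \<zero>\<^bsub>F\<^esub>"
  using homog_eq_zero_iff[OF pw_zero] ideal_zero_closed[OF mpw_ideal] by blast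

lemma fib_split:
  assumes "p \<in> rees" shows "fib p = fib (p(n := \<zero>)) \<oplus>\<^bsub>F\<^esub> homog n (p n)"
proof -
  have "(\<lambda>k. (p(n := \<zero>)) k \<oplus> mono n (p n) k) = p"
    using rees_carrier[OF assms] by (auto simp: mono_def)
  thus ?thesis unfolding homog_def
    using fib_add[OF upd_zero_rees[OF assms] mono_rees[OF rees_pw[OF assms]]] by simp
qed

text \<open>The lowest-degree argument for a family \<open>Q\<close> that behaves like a prime: for
  the least \<open>i\<close> and \<open>j\<close> with \<open>p i\<close> and \<open>q j\<close>
  outside, every other term of the coefficient in degree \<open>i + j\<close> lies in
  \<open>Q\<close>. It serves homogeneous primes and also forms over the residue field, where the
  bounds \<open>i0\<close> and \<open>j0\<close> keep the coefficient in range.\<close>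

lemma conv_lowest:
  assumes pq: "\<And>i. p i \<in> N i" "\<And>i. q i \<in> N i"
    and Q: "\<And>n. ideal (Q n) R" "\<And>i. N i \<subseteq> carrier R"
      "\<And>i j x y. x \<in> N i \<Longrightarrow> y \<in> Q j \<Longrightarrow> x \<otimes> y \<in> Q (i + j)"
      "\<And>i j x y. x \<in> N i \<Longrightarrow> y \<in> N j \<Longrightarrow> x \<otimes> y \<in> Q (i + j) \<Longrightarrow> x \<in> Q i \<or> y \<in> Q j"
    and out: "p i0 \<notin> Q i0" "q j0 \<notin> Q j0"
  shows "\<exists>i j. i \<le> i0 \<and> j \<le> j0 \<and> conv p q (i + j) \<notin> Q (i + j)"
proof -
  define i where "i = (LEAST i. p i \<notin> Q i)"
  define j where "j = (LEAST j. q j \<notin> Q j)"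
  have i: "p i \<notin> Q i" "\<And>k. k < i \<Longrightarrow> p k \<in> Q k" "i \<le> i0"
    unfolding i_def using LeastI[of "\<lambda>i. p i \<notin> Q i", OF out(1)] not_less_Least Least_le[of "\<lambda>i. p i \<notin> Q i", OF out(1)] by blast+
  have j: "q j \<notin> Q j" "\<And>k. k < j \<Longrightarrow> q k \<in> Q k" "j \<le> j0"
    unfolding j_def using LeastI[of "\<lambda>i. q i \<notin> Q i", OF out(2)] not_less_Least Least_le[of "\<lambda>i. q i \<notin> Q i", OF out(2)] by blast+
  have c: "p k \<in> carrier R" "q k \<in> carrier R" for k using pq Q(2) by blast+
  let ?n = "i + j"
  have in_Q: "p k \<otimes> q (?n - k) \<in> Q ?n" if k: "k \<in> {..?n} - {i}" for k
  proof (cases "k < i")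
    case True
    have "q (?n - k) \<otimes> p k \<in> Q (?n - k + k)" using Q(3)[OF pq(2) i(2)[OF True]] .
    thus ?thesis using k c m_comm by simp
  next
    case False
    hence "?n - k < j" "k \<le> ?n" using k by auto
    thus ?thesis using Q(3)[OF pq(1) j(2), of "?n - k" k] by simp
  qed
  have "conv p q ?n = (\<Oplus>k\<in>insert i ({..?n} - {i}). p k \<otimes> q (?n - k))"
    unfolding conv_def by (intro arg_cong[of _ _ "\<lambda>S. finsum R _ S"]) auto
  also have "\<dots> = p i \<otimes> q j \<oplus> (\<Oplus>k\<in>{..?n} - {i}. p k \<otimes> q (?n - k))"
    using c by (subst finsum_insert) auto
  finally have eq: "conv p q ?n = p i \<otimes> q j \<oplus> (\<Oplus>k\<in>{..?n} - {i}. p k \<otimes> q (?n - k))" (is "_ = _ \<oplus> ?rest") .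
  have rest: "?rest \<in> Q ?n" using in_Q by (intro ideal_finsum_closed Q(1)) auto
  have rc: "?rest \<in> carrier R" using rest Q(1) ideal.Icarr by metis
  have "conv p q ?n \<notin> Q ?n"
  proof
    assume "conv p q ?n \<in> Q ?n"
    hence "conv p q ?n \<ominus> ?rest \<in> Q ?n" using ideal_minus_closed[OF Q(1)] rest by blast
    moreover have "conv p q ?n \<ominus> ?rest = p i \<otimes> q j"
    proof -
      have "(x \<oplus> y) \<ominus> y = x" if "x \<in> carrier R" "y \<in> carrier R" for x y using that by algebra
      thus ?thesis unfolding eq using c rc by simp
    qed
    ultimately show False using Q(4)[OF pq(1) pq(2)] i j by metis
  qed
  thus ?thesis using i j by blast
qed

section \<open>Homogeneous ideals and primes of the fiber cone\<close>

text \<open>Homogeneous ideals and homogeneous primes of \<open>F(L)\<close> are encoded by their graded pieces, pulled back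
  to ideals of \<open>R\<close> between \<open>mL\<^sup>n\<close> and \<open>L\<^sup>n\<close>.\<close>

definition hideal where
  "hideal Q \<longleftrightarrow> (\<forall>n. ideal (Q n) R \<and> mpw n \<subseteq> Q n \<and> Q n \<subseteq> pw n) \<and>
     (\<forall>i j x y. x \<in> pw i \<longrightarrow> y \<in> Q j \<longrightarrow> x \<otimes> y \<in> Q (i + j))"

definition hprime where
  "hprime Q \<longleftrightarrow> hideal Q \<and> \<one> \<notin> Q 0 \<and>
     (\<forall>i j x y. x \<in> pw i \<longrightarrow> y \<in> pw j \<longrightarrow> x \<otimes> y \<in> Q (i + j) \<longrightarrow> x \<in> Q i \<or> y \<in> Q j)"

definition hset where "hset Q = fib ` {p \<in> rees. \<forall>n. p n \<in> Q n}"

lemma hidealD: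
  assumes "hideal Q"
  shows "ideal (Q n) R" "mpw n \<subseteq> Q n" "Q n \<subseteq> pw n" "x \<in> pw i \<Longrightarrow> y \<in> Q j \<Longrightarrow> x \<otimes> y \<in> Q (i + j)"
  using assms unfolding hideal_def by blast+

text \<open>Membership does not depend on the representative because \<open>Q n\<close> contains
  \<open>mpw n\<close>.\<close>

lemma fib_hset:
  assumes Q: "hideal Q" and p: "p \<in> rees"
  shows "fib p \<in> hset Q \<longleftrightarrow> (\<forall>n. p n \<in> Q n)"
proof
  assume "fib p \<in> hset Q"
  then obtain q where q: "q \<in> rees" "\<And>n. q n \<in> Q n" "fib p = fib q" unfolding hset_def by auto
  show "\<forall>n. p n \<in> Q n"
  proof
    fix n
    have "p n \<ominus> q n \<in> Q n" using q(3) fib_eq_iff[OF p q(1)] hidealD(2)[OF Q] by blast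
    hence "(p n \<ominus> q n) \<oplus> q n \<in> Q n" using q(2) ideal_add_closed hidealD(1)[OF Q] by blast
    moreover have "(p n \<ominus> q n) \<oplus> q n = p n"
      using rees_carrier[OF p, of n] rees_carrier[OF q(1), of n] by algebra
    ultimately show "p n \<in> Q n" by simp
  qed
qed (use p in \<open>auto simp: hset_def\<close>)

lemma conv_hideal:
  assumes Q: "hideal Q" and "p \<in> rees" "q \<in> rees" "\<And>n. q n \<in> Q n"
  shows "conv p q n \<in> Q n"
proof -
  have "p i \<otimes> q (n - i) \<in> Q n" if "i \<in> {..n}" for i
    using hidealD(4)[OF Q rees_pw[OF assms(2), of i] assms(4), of "n - i"] that by simp
  thus ?thesis unfolding conv_def by (intro ideal_finsum_closed hidealD(1)[OF Q]) auto
qed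

lemma hset_ideal:
  assumes Q: "hideal Q" shows "ideal (hset Q) F"
proof -
  interpret F: cring F by (rule F_cring)
  have sub: "hset Q \<subseteq> carrier F" unfolding hset_def F_carrier by auto
  have l: "x \<otimes>\<^bsub>F\<^esub> a \<in> hset Q" if ax: "a \<in> hset Q" "x \<in> carrier F" for a x
  proof -
    obtain p q where *: "p \<in> rees" "q \<in> rees" "\<And>n. q n \<in> Q n" "x = fib p" "a = fib q"
      using ax unfolding hset_def F_carrier by blast
    hence "x \<otimes>\<^bsub>F\<^esub> a = fib (conv p q)" using fib_mult by simp
    thus ?thesis using conv_rees conv_hideal[OF Q] * unfolding hset_def by blast
  qed
  have add: "a \<oplus>\<^bsub>F\<^esub> b \<in> hset Q" if ab: "a \<in> hset Q" "b \<in> hset Q" for a b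
  proof -
    obtain p q where *: "p \<in> rees" "q \<in> rees" "\<And>n. q n \<in> Q n" "\<And>n. p n \<in> Q n" "a = fib p" "b = fib q"
      using ab unfolding hset_def by blast
    hence "a \<oplus>\<^bsub>F\<^esub> b = fib (\<lambda>n. p n \<oplus> q n)" using fib_add by simp
    thus ?thesis using add_rees ideal_add_closed[OF hidealD(1)[OF Q]] * unfolding hset_def by blast
  qed
  show ?thesis
  proof (rule idealI[OF F.ring_axioms])
    show "subgroup (hset Q) (add_monoid F)"
    proof (rule F.add.subgroupI)
      have "\<zero>\<^bsub>F\<^esub> \<in> hset Q" unfolding fib_zero using fib_hset[OF Q zero_rees] ideal_zero_closed hidealD(1)[OF Q] by blast
      thus "hset Q \<noteq> {}" by blast
      fix a assume a: "a \<in> hset Q"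
      hence "\<ominus>\<^bsub>F\<^esub> \<one>\<^bsub>F\<^esub> \<otimes>\<^bsub>F\<^esub> a \<in> hset Q" using l by simp
      moreover have "a \<in> carrier F" using a sub by blast
      ultimately show "\<ominus>\<^bsub>F\<^esub> a \<in> hset Q" by (simp add: F.l_minus)
    qed (use sub add in auto)
    fix a x assume "a \<in> hset Q" "x \<in> carrier F"
    thus "x \<otimes>\<^bsub>F\<^esub> a \<in> hset Q" "a \<otimes>\<^bsub>F\<^esub> x \<in> hset Q" using l[of a x] F.m_comm[of a x] sub by auto
  qed
qed

lemma homog_hset: "hideal Q \<Longrightarrow> x \<in> pw n \<Longrightarrow> homog n x \<in> hset Q \<longleftrightarrow> x \<in> Q n"
  unfolding homog_def using fib_hset[OF _ mono_rees] ideal_zero_closed[OF hidealD(1)]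
  by (auto simp: mono_def)

text \<open>Primeness need only be tested on homogeneous elements: the lowest components outside
  \<open>Q\<close> multiply to a component outside \<open>Q\<close>.\<close>

lemma hset_prime:
  assumes Q: "hprime Q" shows "primeideal (hset Q) F"
proof (rule primeidealI)
  interpret F: cring F by (rule F_cring)
  have hQ: "hideal Q" using Q by (simp add: hprime_def)
  show "ideal (hset Q) F" by (rule hset_ideal[OF hQ])
  show "cring F" by (rule F_cring)
  have "\<one>\<^bsub>F\<^esub> \<notin> hset Q" using homog_hset[OF hQ, of \<one> 0] Q fib_one by (simp add: hprime_def)
  thus "carrier F \<noteq> hset Q" by auto
  fix a b assume ab: "a \<in> carrier F" "b \<in> carrier F" "a \<otimes>\<^bsub>F\<^esub> b \<in> hset Q"
  then obtain p q where pq: "p \<in> rees" "q \<in> rees" "a = fib p" "b = fib q" unfolding F_carrier by auto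
  have cQ: "\<forall>n. conv p q n \<in> Q n"
    using ab(3) pq fib_mult[OF pq(1,2)] fib_hset[OF hQ conv_rees[OF pq(1,2)]] by simp
  show "a \<in> hset Q \<or> b \<in> hset Q"
  proof (rule ccontr)
    assume "\<not> (a \<in> hset Q \<or> b \<in> hset Q)"
    then obtain i0 j0 where "p i0 \<notin> Q i0" "q j0 \<notin> Q j0" using fib_hset[OF hQ] pq by blast
    hence "\<exists>i j. i \<le> i0 \<and> j \<le> j0 \<and> conv p q (i + j) \<notin> Q (i + j)"
      using Q rees_pw pq pw_carrier hidealD[OF hQ]
      by (intro conv_lowest[where N = pw]) (auto simp: hprime_def)
    thus False using cQ by blast
  qed
qed

lemma hset_mono:
  assumes "hideal Q" "hideal Q'" "\<And>n. Q n \<subseteq> Q' n" "x \<in> Q' n" "x \<notin> Q n"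
  shows "hset Q \<subset> hset Q'"
proof -
  have "x \<in> pw n" using assms(2,4) hidealD(3) by blast
  hence "homog n x \<in> hset Q'" "homog n x \<notin> hset Q" using homog_hset assms by auto
  moreover have "hset Q \<subseteq> hset Q'" unfolding hset_def using assms(3) by blast
  ultimately show ?thesis by blast
qed

text \<open>The homogeneous elements of an arbitrary ideal describe the largest homogeneous ideal
  inside it.\<close>

lemma hideal_of_ideal:
  assumes P: "ideal P F" shows "hideal (\<lambda>n. {x \<in> pw n. homog n x \<in> P})"
proof -
  interpret F: cring F by (rule F_cring)
  have mult: "x \<otimes> y \<in> {x \<in> pw (i + j). homog (i + j) x \<in> P}" if "x \<in> pw i" "y \<in> {x \<in> pw j. homog j x \<in> P}" for i j x y
    using that homog_mult[of x i y j, symmetric] ideal.I_l_closed[OF P _ homog_closed[of x i]] pw_mult by auto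
  have idl: "ideal {x \<in> pw n. homog n x \<in> P} R" for n
  proof (rule idealI[OF ring_axioms])
    have l: "x \<otimes> a \<in> {x \<in> pw n. homog n x \<in> P}" if "a \<in> {x \<in> pw n. homog n x \<in> P}" "x \<in> carrier R" for a x
      using mult[of x 0 a n] that by simp
    show "subgroup {x \<in> pw n. homog n x \<in> P} (add_monoid R)"
    proof (rule add.subgroupI)
      show "{x \<in> pw n. homog n x \<in> P} \<noteq> {}" using pw_zero homog_zero F.ideal_zero_closed[OF P] by force
      fix x assume x: "x \<in> {x \<in> pw n. homog n x \<in> P}"
      have "\<ominus> x = \<ominus> \<one> \<otimes> x" using x pw_carrier[of x n] by (simp add: l_minus)
      thus "\<ominus> x \<in> {x \<in> pw n. homog n x \<in> P}" using l[OF x, of "\<ominus> \<one>"] by simp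
      fix y assume y: "y \<in> {x \<in> pw n. homog n x \<in> P}"
      show "x \<oplus> y \<in> {x \<in> pw n. homog n x \<in> P}"
        using x y homog_add[of x n y] F.ideal_add_closed[OF P] ideal_add_closed[OF pw_ideal]
        by (simp add: homog_add[symmetric])
    qed (use pw_carrier in auto)
    show "x \<otimes> a \<in> {x \<in> pw n. homog n x \<in> P}" if "a \<in> {x \<in> pw n. homog n x \<in> P}" "x \<in> carrier R" for a x
      using l that by blast
    show "a \<otimes> x \<in> {x \<in> pw n. homog n x \<in> P}" if "a \<in> {x \<in> pw n. homog n x \<in> P}" "x \<in> carrier R" for a x
      using l[OF that] that pw_carrier[of a n] m_comm by auto
  qed
  show ?thesis unfolding hideal_def
    using idl mult mpw_pw homog_eq_zero_iff[OF mpw_pw] F.ideal_zero_closed[OF P] by auto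
qed

lemma hprime_of_prime:
  assumes P: "primeideal P F" shows "hprime (\<lambda>n. {x \<in> pw n. homog n x \<in> P})"
proof -
  interpret P: primeideal P F by fact
  have "\<one>\<^bsub>F\<^esub> \<notin> P" using P.one_imp_carrier P.I_notcarr by auto
  moreover have "x \<in> {x \<in> pw i. homog i x \<in> P} \<or> y \<in> {x \<in> pw j. homog j x \<in> P}"
    if "x \<in> pw i" "y \<in> pw j" "x \<otimes> y \<in> {x \<in> pw (i + j). homog (i + j) x \<in> P}" for i j x y
    using P.I_prime[OF homog_closed[OF that(1)] homog_closed[OF that(2)]] that homog_mult[OF that(1,2)] by auto
  ultimately show ?thesis unfolding hprime_def using hideal_of_ideal[OF P.is_ideal] fib_one by auto
qed

text \<open>First a possibly inhomogeneous prime is found that avoids the classes of the elements of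
  \<open>T\<close>. Its homogeneous part is still prime, still contains \<open>K\<close> and still
  avoids them.\<close>

lemma exists_hprime:
  assumes K: "hideal K" and T: "\<And>n. T n \<subseteq> pw n" "\<one> \<in> T 0"
      "\<And>i j x y. x \<in> T i \<Longrightarrow> y \<in> T j \<Longrightarrow> x \<otimes> y \<in> T (i + j)"
    and disj: "\<And>n. K n \<inter> T n = {}"
  shows "\<exists>Q. hprime Q \<and> (\<forall>n. K n \<subseteq> Q n \<and> Q n \<inter> T n = {})"
proof -
  interpret F: cring F by (rule F_cring)
  let ?S = "{homog n x | n x. x \<in> T n}"
  have "\<exists>P. primeideal P F \<and> hset K \<subseteq> P \<and> P \<inter> ?S = {}"
  proof (rule F.exists_prime_avoiding[OF hset_ideal[OF K]])
    show "?S \<subseteq> carrier F" using T(1) homog_closed by blast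
    show "\<one>\<^bsub>F\<^esub> \<in> ?S" using T(2) fib_one by blast
    show "s \<otimes>\<^bsub>F\<^esub> t \<in> ?S" if st: "s \<in> ?S" "t \<in> ?S" for s t
    proof -
      obtain i j x y where "x \<in> T i" "y \<in> T j" "s = homog i x" "t = homog j y" using st by blast
      moreover from this have "s \<otimes>\<^bsub>F\<^esub> t = homog (i + j) (x \<otimes> y)" using homog_mult T(1) by blast
      ultimately show ?thesis using T(3) by blast
    qed
    show "hset K \<inter> ?S = {}" using homog_hset[OF K] T(1) disj by blast
  qed
  then obtain P where P: "primeideal P F" "hset K \<subseteq> P" "P \<inter> ?S = {}" by blast
  have "K n \<subseteq> {x \<in> pw n. homog n x \<in> P}" for n
    using hidealD(3)[OF K, of n] homog_hset[OF K] P(2) by blast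
  moreover have "{x \<in> pw n. homog n x \<in> P} \<inter> T n = {}" for n using P(3) by blast
  ultimately show ?thesis using hprime_of_prime[OF P(1)]
    by (intro exI[of _ "\<lambda>n. {x \<in> pw n. homog n x \<in> P}"]) auto
qed

text \<open>In degree zero the piece is \<open>m\<close>, which represents the zero of the residue
  field.\<close>

definition irrelevant where "irrelevant n = (if n = 0 then m else pw n)"

lemma irrelevant_hprime: "hprime irrelevant"
proof -
  have "hideal irrelevant" unfolding hideal_def irrelevant_def
    using m_ideal pw_ideal mpw_0 mpw_subset pw_mult ideal.I_l_closed[OF m_ideal] ideal_subset_carrier[OF m_ideal]
      ideal.I_r_closed[OF pw_ideal] ideal.I_l_closed[OF pw_ideal] by auto
  thus ?thesis unfolding hprime_def irrelevant_def
    using one_notin_m primeideal.I_prime[OF m_prime] by auto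
qed

text \<open>An element of \<open>Q 0\<close> outside \<open>m\<close> is a unit and would bring
  \<open>1\<close> into \<open>Q 0\<close>.\<close>

lemma hprime_subset_irrelevant:
  assumes "hprime Q" shows "Q n \<subseteq> irrelevant n"
proof (cases "n = 0")
  case True
  have Q: "hideal Q" using assms by (simp add: hprime_def)
  have "x \<in> m" if x: "x \<in> Q 0" for x
  proof (rule ccontr)
    assume "x \<notin> m"
    moreover have "x \<in> carrier R" using x Q hidealD(1) ideal.Icarr by metis
    ultimately obtain y where "y \<in> carrier R" "y \<otimes> x = \<one>" using unit_of_notin_m by blast
    hence "\<one> \<in> Q 0" using hidealD(4)[OF Q, of y 0 x 0] x by simp
    thus False using assms by (simp add: hprime_def)
  qed
  thus ?thesis using True by (auto simp: irrelevant_def)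
qed (use assms hidealD(3) in \<open>auto simp: irrelevant_def hprime_def\<close>)

end

section \<open>Principal reductions\<close>

text \<open>List polynomials have a non-zero leading coefficient, hence the detour through
  \<open>normalize\<close>. One non-zero entry keeps the list from collapsing, and finitely many
  roots cannot exhaust an infinite carrier.\<close>

lemma (in domain) eval_normalize_nonroot:
  assumes "infinite (carrier R)" "set p \<subseteq> carrier R" "a \<in> set p" "a \<noteq> \<zero>"
  shows "\<exists>x\<in>carrier R. eval p x \<noteq> \<zero>"
proof -
  have ne: "normalize q \<noteq> []" if "a \<in> set q" for q
    using that assms(4) by (induction q) auto
  have "finite {x. is_root (normalize p) x}"
    using finite_number_of_roots normalize_gives_polynomial[OF assms(2)] univ_poly_carrier by blast
  then obtain x where x: "x \<in> carrier R" "\<not> is_root (normalize p) x"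
    using assms(1) by (metis (mono_tags, lifting) finite_subset mem_Collect_eq subsetI)
  thus ?thesis using ne[OF assms(3)] eval_normalize[OF assms(2) x(1)] by (auto simp: is_root_def)
qed

lemma (in cring) colon_ideal:
  assumes K: "ideal K R" and a: "a \<in> carrier R"
  shows "ideal (colon R K a) R"
proof (rule idealI[OF ring_axioms])
  have l: "y \<otimes> x \<in> colon R K a" if "x \<in> colon R K a" "y \<in> carrier R" for x y
    using that ideal.I_l_closed[OF K, of "a \<otimes> x" y] a by (simp add: colon_def m_lcomm)
  show "subgroup (colon R K a) (add_monoid R)"
  proof (rule add.subgroupI)
    show "colon R K a \<noteq> {}" using a ideal_zero_closed[OF K] by (auto simp: colon_def intro!: exI[of _ \<zero>])
    fix x assume x: "x \<in> colon R K a"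
    hence "\<ominus> \<one> \<otimes> x \<in> colon R K a" using l by simp
    thus "\<ominus> x \<in> colon R K a" using x by (simp add: colon_def l_minus)
    fix y assume "y \<in> colon R K a"
    thus "x \<oplus> y \<in> colon R K a" using x a ideal_add_closed[OF K] by (simp add: colon_def r_distr)
  qed (auto simp: colon_def)
  fix x y assume "x \<in> colon R K a" "y \<in> carrier R"
  thus "y \<otimes> x \<in> colon R K a" "x \<otimes> y \<in> colon R K a" using l by (auto simp: colon_def m_comm)
qed

text \<open>Multiplication by \<open>a\<close> maps \<open>N/K\<close> onto \<open>aN/aK\<close>,
  and ideals are pulled back by intersecting \<open>N\<close> with a colon ideal. Surjectivity makes
  the pullback strict, whether or not \<open>a\<close> is a zero-divisor.\<close>

lemma (in cring) ideal_length_l_coset_le: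
  assumes K: "ideal K R" "ideal N R" "K \<subseteq> N" and a: "a \<in> carrier R"
  shows "ideal_length R (a <# K) (a <# N) \<le> ideal_length R K N"
proof (rule ideal_length_order_embedding[where f = "\<lambda>Z. N \<inter> colon R Z a"])
  have Nc: "x \<in> N \<Longrightarrow> x \<in> carrier R" for x using ideal.Icarr[OF K(2)] .
  show "ideal (N \<inter> colon R Z a) R \<and> K \<subseteq> N \<inter> colon R Z a \<and> N \<inter> colon R Z a \<subseteq> N"
    if "ideal Z R" "a <# K \<subseteq> Z" for Z
  proof (intro conjI)
    show "ideal (N \<inter> colon R Z a) R" using i_intersect[OF K(2) colon_ideal[OF that(1) a]] .
    show "K \<subseteq> N \<inter> colon R Z a"
    proof
      fix k assume k: "k \<in> K"
      hence "a \<otimes> k \<in> a <# K" by (auto simp: l_coset_iff)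
      thus "k \<in> N \<inter> colon R Z a" using k that(2) K(3) Nc by (auto simp: colon_def)
    qed
  qed simp
  show "N \<inter> colon R V a \<subset> N \<inter> colon R Y a"
    if VY: "ideal V R" "V \<subset> Y" "Y \<subseteq> a <# N" for V Y
  proof -
    obtain y where y: "y \<in> Y" "y \<notin> V" using VY by blast
    then obtain z where z: "z \<in> N" "y = a \<otimes> z" using VY(3) by (auto simp: l_coset_def)
    hence "z \<in> N \<inter> colon R Y a" "z \<notin> N \<inter> colon R V a" using y Nc by (auto simp: colon_def)
    thus ?thesis using VY(2) by (auto simp: colon_def)
  qed
qed (use K a l_coset_ideal l_coset_mono in auto)

text \<open>Here the infinite residue field enters: a polynomial with a unit coefficient is non-zero
  over the residue field, so some \<open>u\<close> is not a root.\<close>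

lemma (in noetherian_local_ring) exists_nonroot_mod_m:
  fixes c :: "nat \<Rightarrow> 'a"
  assumes inf: "infinite (carrier (R Quot m))" and c: "\<And>i. c i \<in> carrier R" "c j \<notin> m" "j \<le> e"
  shows "\<exists>u\<in>carrier R. (\<Oplus>i\<in>{..e}. c i \<otimes> u [^] i) \<notin> m"
proof -
  let ?k = "R Quot m" and ?h = "(+>) m"
  have zero: "\<zero>\<^bsub>?k\<^esub> = m" by (simp add: FactRing_def)
  interpret k: "domain" ?k by (rule primeideal.quotient_is_domain[OF m_prime])
  interpret h: ring_hom_ring R ?k ?h by (rule ideal.rcos_ring_hom_ring[OF m_ideal])
  have h0: "?h x = \<zero>\<^bsub>?k\<^esub> \<longleftrightarrow> x \<in> m" if "x \<in> carrier R" for x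
    unfolding zero by (rule coset_eq_zero_iff[OF m_ideal that])
  \<comment> \<open>\<open>eval\<close> reads the leading coefficient first, hence the reversed
    index list; the degree stays variable for the induction below.\<close>
  let ?p = "\<lambda>e. map (\<lambda>i. ?h (c i)) (rev [0..<Suc e])"
  have ev: "k.eval (?p e) (?h u) = ?h (\<Oplus>i\<in>{..e}. c i \<otimes> u [^] i)" if u: "u \<in> carrier R" for e u
  proof (induction e)
    case 0 thus ?case using c u by simp
  next
    case (Suc e)
    have "k.eval (?p (Suc e)) (?h u) = ?h (c (Suc e)) \<otimes>\<^bsub>?k\<^esub> ?h u [^]\<^bsub>?k\<^esub> (Suc e) \<oplus>\<^bsub>?k\<^esub> k.eval (?p e) (?h u)"
      by simp
    also have "\<dots> = ?h (c (Suc e) \<otimes> u [^] (Suc e) \<oplus> (\<Oplus>i\<in>{..e}. c i \<otimes> u [^] i))"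
      unfolding Suc using c u by (simp add: h.hom_nat_pow Pi_def del: nat_pow_Suc k.nat_pow_Suc)
    also have "c (Suc e) \<otimes> u [^] (Suc e) \<oplus> (\<Oplus>i\<in>{..e}. c i \<otimes> u [^] i) = (\<Oplus>i\<in>{..Suc e}. c i \<otimes> u [^] i)"
      using c u by (simp add: Pi_def)
    finally show ?case .
  qed
  have "?h (c j) \<in> set (?p e)" unfolding set_map by (rule imageI) (use c(3) in auto)
  moreover have "set (?p e) \<subseteq> carrier ?k" using c(1) by auto
  moreover have "?h (c j) \<noteq> \<zero>\<^bsub>?k\<^esub>" using h0 c by blast
  ultimately obtain x where x: "x \<in> carrier ?k" "k.eval (?p e) x \<noteq> \<zero>\<^bsub>?k\<^esub>"
    using k.eval_normalize_nonroot[OF inf] by blast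
  have "carrier ?k = ?h ` carrier R"
    unfolding FactRing_def A_RCOSETS_def' by (simp only: partial_object.simps UNION_singleton_eq_range)
  then obtain u where u: "u \<in> carrier R" "x = ?h u" using x(1) by blast
  let ?s = "\<Oplus>i\<in>{..e}. c i \<otimes> u [^] i"
  have "?s \<in> carrier R" using c(1) u(1) by (simp add: Pi_def)
  moreover have "?h ?s \<noteq> \<zero>\<^bsub>?k\<^esub>" using x(2) unfolding u(2) ev[OF u(1)] .
  ultimately show ?thesis using h0 u(1) by blast
qed

context fiber_ring
begin

lemma exists_nonzero_pow:
  assumes "regular_ideal R L" shows "\<exists>x\<in>pw n. x \<noteq> \<zero>"
proof -
  obtain x where x: "x \<in> L" "nonzerodivisor R x" using assms by (auto simp: regular_ideal_def)
  have xc: "x \<in> carrier R" using x by (simp add: nonzerodivisor_def)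
  have "x [^] n \<noteq> \<zero>" for n :: nat
  proof (induction n)
    case 0 thus ?case using one_notin_m ideal_zero_closed[OF m_ideal] by auto
  next
    case (Suc n) thus ?case using x(2) xc by (auto simp: nonzerodivisor_def m_comm)
  qed
  thus ?thesis using pow_in_ideal_pow[OF L_ideal x(1)] by blast
qed

lemma reduction_stable:
  assumes J: "ideal J R" and "pw (s + 1) = J \<cdot> pw s" "s \<le> n"
  shows "pw (Suc n) = J \<cdot> pw n"
proof -
  have "pw (Suc n) = pw (n - s) \<cdot> pw (s + 1)"
    using ideal_pow_add[OF L_ideal, of "n - s" "s + 1"] assms(3) by simp
  also have "\<dots> = (pw (n - s) \<cdot> J) \<cdot> pw s"
    using assms(2) ideal_prod_assoc pw_ideal J by simp
  also have "\<dots> = J \<cdot> (pw (n - s) \<cdot> pw s)"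
    using ideal_prod_commute[OF pw_ideal J] ideal_prod_assoc pw_ideal J by simp
  also have "pw (n - s) \<cdot> pw s = pw n"
    using ideal_pow_add[OF L_ideal, of "n - s" s] assms(3) by simp
  finally show ?thesis .
qed

text \<open>The graded pieces of the ideal of \<open>F(L)\<close> generated by the classes of \<open>W \<subseteq> L\<close> in degree one. Degree zero
  is separate because of the truncated subtraction.\<close>

definition gen_part where "gen_part W n = (mpw n <+> (if n = 0 then {\<zero>} else W \<cdot> pw (n - 1)))"

lemma hideal_gen_part:
  assumes W: "ideal W R" "W \<subseteq> L" shows "hideal (gen_part W)"
  unfolding hideal_def
proof (intro conjI allI impI)
  let ?W = "\<lambda>n. if n = 0 then {\<zero>} else W \<cdot> pw (n - 1)"
  have I: "ideal (?W n) R" for n using zeroideal ideal_prod_is_ideal[OF W(1) pw_ideal] by auto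
  have Wle: "?W n \<subseteq> pw n" for n
  proof (cases n)
    case (Suc k) thus ?thesis using ideal_prod_mono[OF W(2) subset_refl] by simp
  qed (use pw_zero in auto)
  fix n
  show "ideal (gen_part W n) R" unfolding gen_part_def using add_ideals[OF mpw_ideal I] .
  show "mpw n \<subseteq> gen_part W n" unfolding gen_part_def using set_add_upper(1)[OF mpw_ideal I] .
  show "gen_part W n \<subseteq> pw n" unfolding gen_part_def
    using mpw_subset Wle by (subst set_add_subset_iff[OF mpw_ideal I pw_ideal]) auto
next
  let ?W = "\<lambda>n. if n = 0 then {\<zero>} else W \<cdot> pw (n - 1)"
  have I: "ideal (?W n) R" for n using zeroideal ideal_prod_is_ideal[OF W(1) pw_ideal] by auto
  fix i j x y assume x: "x \<in> pw i" and "y \<in> gen_part W j"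
  then obtain k z where kz: "k \<in> mpw j" "z \<in> ?W j" "y = k \<oplus> z"
    unfolding gen_part_def set_add_iff by blast
  have c: "x \<in> carrier R" "k \<in> carrier R" "z \<in> carrier R"
    using x kz pw_carrier mpw_carrier ideal.Icarr[OF I] by blast+
  have "x \<otimes> z \<in> ?W (i + j)"
  proof (cases j)
    case (Suc j')
    have "x \<otimes> z \<in> pw i \<cdot> (W \<cdot> pw j')" using x kz(2) Suc by (auto intro: ideal_prod.prod)
    also have "pw i \<cdot> (W \<cdot> pw j') = W \<cdot> (pw i \<cdot> pw j')"
      using ideal_prod_assoc pw_ideal W(1) ideal_prod_commute[OF pw_ideal W(1)] by metis
    also have "\<dots> = W \<cdot> pw (i + j')" using ideal_pow_add[OF L_ideal] by simp
    finally show ?thesis using Suc by simp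
  next
    case 0
    hence "x \<otimes> z = \<zero>" using kz c by simp
    thus ?thesis using ideal_zero_closed[OF I, of "i + j"] by simp
  qed
  moreover have "x \<otimes> k \<in> mpw (i + j)" using mpw_mult x kz by blast
  moreover have "x \<otimes> y = x \<otimes> k \<oplus> x \<otimes> z" using kz c by (simp add: r_distr)
  ultimately show "x \<otimes> y \<in> gen_part W (i + j)" unfolding gen_part_def set_add_iff by blast
qed

lemma hideal_add:
  assumes "hideal P" "hideal Q" shows "hideal (\<lambda>n. P n <+> Q n)"
  unfolding hideal_def
proof (intro conjI allI impI)
  fix n
  show "ideal (P n <+> Q n) R" using assms hidealD(1) add_ideals by blast
  show "mpw n \<subseteq> P n <+> Q n" using assms hidealD(1,2) set_add_upper(1) by blast
  show "P n <+> Q n \<subseteq> pw n"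
    using hidealD(3) assms by (subst set_add_subset_iff[OF hidealD(1)[OF assms(1)] hidealD(1)[OF assms(2)] pw_ideal]) auto
next
  fix i j x y assume x: "x \<in> pw i" and "y \<in> P j <+> Q j"
  then obtain k z where kz: "k \<in> P j" "z \<in> Q j" "y = k \<oplus> z" unfolding set_add_iff by blast
  have c: "x \<in> carrier R" "k \<in> carrier R" "z \<in> carrier R"
    using x kz pw_carrier hidealD(3) assms by blast+
  have "x \<otimes> y = x \<otimes> k \<oplus> x \<otimes> z" using kz c by (simp add: r_distr)
  thus "x \<otimes> y \<in> P (i + j) <+> Q (i + j)"
    unfolding set_add_iff using hidealD(4) assms x kz by blast
qed

text \<open>By Nakayama it is enough to generate \<open>L^(n+1)\<close> modulo \<open>m\<close>, so
  reductions can be recognized in the fiber cone.\<close>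

lemma reduction_of_gen_part:
  assumes W: "ideal W R" "W \<subseteq> L" and le: "pw (Suc n) \<subseteq> gen_part W (Suc n)"
  shows "reduction R L W"
proof -
  have "pw (Suc n) = W \<cdot> pw n"
  proof (rule nakayama[OF pw_ideal])
    show "ideal (W \<cdot> pw n) R" using ideal_prod_is_ideal W(1) pw_ideal by blast
    show "W \<cdot> pw n \<subseteq> pw (Suc n)" using ideal_prod_mono[OF W(2) subset_refl] by simp
    show "pw (Suc n) \<subseteq> mpw (Suc n) <+> W \<cdot> pw n" using le by (simp add: gen_part_def)
  qed
  thus ?thesis using W unfolding reduction_def by auto
qed

lemma gen_part_mem:
  assumes "ideal W R" "x \<in> W" "y \<in> pw n" shows "x \<otimes> y \<in> gen_part W (Suc n)"
proof -
  have "x \<otimes> y \<in> W \<cdot> pw n" using assms by (auto intro: ideal_prod.prod)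
  hence "x \<otimes> y \<in> mpw (Suc n) <+> W \<cdot> pw n"
    using set_add_upper(2)[OF mpw_ideal ideal_prod_is_ideal[OF assms(1) pw_ideal]] by blast
  thus ?thesis by (simp add: gen_part_def)
qed

end

text \<open>Two generators \<open>x\<close>, \<open>y\<close> of a reduction, modulo the ideal \<open>W\<close> of the remaining ones.\<close>

locale two_generators = fiber_ring +
  fixes x y W s
  assumes x: "x \<in> L" and y: "y \<in> L" and W: "ideal W R" "W \<subseteq> L"
    and red: "pw (s + 1) = (PIdl x <+> (PIdl y <+> W)) \<cdot> pw s"
begin

lemma xy_carrier: "x \<in> carrier R" "y \<in> carrier R" "x \<in> pw (Suc 0)" "y \<in> pw (Suc 0)"
  using x y ideal.Icarr[OF L_ideal] ideal_pow_1[OF L_ideal] by auto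

text \<open>Only the multiples of \<open>x\<close> and \<open>y\<close> are tracked; whatever comes
  from \<open>W\<close> is absorbed by \<open>gen_part W\<close>.\<close>

lemma reduction_split:
  assumes "s \<le> n" "w \<in> pw (Suc n)"
  shows "\<exists>u\<in>pw n. \<exists>v\<in>pw n. \<exists>z\<in>gen_part W (Suc n). w = x \<otimes> u \<oplus> y \<otimes> v \<oplus> z"
proof -
  note PI = cgenideal_ideal[OF xy_carrier(1)] cgenideal_ideal[OF xy_carrier(2)]
  have J: "ideal (PIdl x <+> (PIdl y <+> W)) R" using add_ideals PI W by blast
  note g = hidealD(1)[OF hideal_gen_part[OF W]]
  note xyi = l_coset_ideal[OF pw_ideal xy_carrier(1)] l_coset_ideal[OF pw_ideal xy_carrier(2)]
  have I: "ideal (((x <# pw n) <+> (y <# pw n)) <+> gen_part W (Suc n)) R"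
    using add_ideals[OF add_ideals[OF xyi] g] .
  have "(PIdl x <+> (PIdl y <+> W)) \<cdot> pw n \<subseteq> ((x <# pw n) <+> (y <# pw n)) <+> gen_part W (Suc n)"
  proof (subst ideal_prod_subset_iff[OF I], intro ballI)
    fix i j assume "i \<in> PIdl x <+> (PIdl y <+> W)" and j: "j \<in> pw n"
    then obtain h k where hk: "h \<in> PIdl x" "k \<in> PIdl y <+> W" "i = h \<oplus> k"
      unfolding set_add_iff[of i] by blast
    obtain l z where lz: "l \<in> PIdl y" "z \<in> W" "k = l \<oplus> z" using hk(2) unfolding set_add_iff[of k] by blast
    obtain a b where "a \<in> carrier R" "h = a \<otimes> x" "b \<in> carrier R" "l = b \<otimes> y"
      using hk(1) lz(1) unfolding cgenideal_def by blast
    hence abz: "a \<in> carrier R" "b \<in> carrier R" "z \<in> W" "i = a \<otimes> x \<oplus> (b \<otimes> y \<oplus> z)"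
      using hk lz by auto
    have c: "j \<in> carrier R" "z \<in> carrier R"
      by (rule pw_carrier[OF j]) (rule ideal.Icarr[OF W(1) abz(3)])
    have "i \<otimes> j = (x \<otimes> (a \<otimes> j) \<oplus> y \<otimes> (b \<otimes> j)) \<oplus> z \<otimes> j"
      using abz c xy_carrier(1,2) by algebra
    moreover have "a \<otimes> j \<in> pw n" "b \<otimes> j \<in> pw n" using ideal.I_l_closed[OF pw_ideal j] abz by auto
    hence "x \<otimes> (a \<otimes> j) \<in> x <# pw n" "y \<otimes> (b \<otimes> j) \<in> y <# pw n" by (auto simp: l_coset_iff)
    moreover have "z \<otimes> j \<in> gen_part W (Suc n)" by (rule gen_part_mem[OF W(1) abz(3) j])
    moreover from calculation(2,3)
    have "x \<otimes> (a \<otimes> j) \<oplus> y \<otimes> (b \<otimes> j) \<in> (x <# pw n) <+> (y <# pw n)" unfolding set_add_iff by blast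
    ultimately show "i \<otimes> j \<in> ((x <# pw n) <+> (y <# pw n)) <+> gen_part W (Suc n)"
      unfolding set_add_iff[of "i \<otimes> j"] by blast
  qed
  hence "w \<in> ((x <# pw n) <+> (y <# pw n)) <+> gen_part W (Suc n)"
    using assms reduction_stable[OF J red assms(1)] by blast
  thus ?thesis unfolding set_add_iff l_coset_iff by (auto simp: Bex_def set_add_iff l_coset_iff)
qed

text \<open>Modulo \<open>D\<close> one has \<open>x = u y\<close>, so every element of degree
  \<open>s + j\<close> becomes \<open>y^j\<close> times one of degree \<open>s\<close>. This is used
  with \<open>u\<close> a non-root and with \<open>u = 0\<close>.\<close>

lemma pw_subset_add_power:
  assumes D: "hideal D" "\<And>n. gen_part W n \<subseteq> D n" and u: "u \<in> carrier R" "x \<ominus> u \<otimes> y \<in> D (Suc 0)"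
  shows "w \<in> pw (s + j) \<Longrightarrow> \<exists>d\<in>D (s + j). \<exists>p\<in>pw s. w = d \<oplus> y [^] j \<otimes> p"
proof (induction j arbitrary: w)
  case 0
  hence "w \<in> pw s" "w = \<zero> \<oplus> y [^] (0::nat) \<otimes> w" using pw_carrier[of w s] by auto
  thus ?case using ideal_zero_closed[OF hidealD(1)[OF D(1)]] by blast
next
  case (Suc j)
  then obtain a b z where abz: "a \<in> pw (s + j)" "b \<in> pw (s + j)" "z \<in> gen_part W (Suc (s + j))"
    "w = x \<otimes> a \<oplus> y \<otimes> b \<oplus> z"
    using reduction_split[of "s + j" w] by auto
  have zD: "z \<in> D (Suc (s + j))" using abz(3) D(2) by blast
  \<comment> \<open>Write \<open>x a + y b\<close> as \<open>(x - u y) a + y (u a + b)\<close>: the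
    first term lies in \<open>D\<close>, and \<open>u a + b\<close> has lower degree.\<close>
  have "u \<otimes> a \<oplus> b \<in> pw (s + j)"
    using ideal_add_closed[OF pw_ideal ideal.I_l_closed[OF pw_ideal abz(1) u(1)] abz(2)] .
  then obtain d p where dp: "d \<in> D (s + j)" "p \<in> pw s" "u \<otimes> a \<oplus> b = d \<oplus> y [^] j \<otimes> p"
    using Suc.IH by blast
  have c: "a \<in> carrier R" "b \<in> carrier R" "z \<in> carrier R" "d \<in> carrier R" "p \<in> carrier R"
    using abz dp zD pw_carrier ideal.Icarr[OF hidealD(1)[OF D(1)]] by blast+
  have "w = ((x \<ominus> u \<otimes> y) \<otimes> a \<oplus> y \<otimes> (u \<otimes> a \<oplus> b)) \<oplus> z"
    unfolding abz(4) using c u xy_carrier(1,2) by algebra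
  also have "\<dots> = ((a \<otimes> (x \<ominus> u \<otimes> y) \<oplus> y \<otimes> d) \<oplus> z) \<oplus> y [^] (Suc j) \<otimes> p"
  proof -
    have q: "y [^] j \<in> carrier R" "x \<ominus> u \<otimes> y \<in> carrier R" using xy_carrier u by auto
    have "(t \<otimes> a \<oplus> y \<otimes> (d \<oplus> q \<otimes> p)) \<oplus> z = ((a \<otimes> t \<oplus> y \<otimes> d) \<oplus> z) \<oplus> (q \<otimes> y) \<otimes> p"
      if "q \<in> carrier R" "t \<in> carrier R" for q t using that c xy_carrier(1,2) by algebra
    thus ?thesis unfolding dp(3) using q by simp
  qed
  finally have w: "w = ((a \<otimes> (x \<ominus> u \<otimes> y) \<oplus> y \<otimes> d) \<oplus> z) \<oplus> y [^] (Suc j) \<otimes> p" .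
  have "a \<otimes> (x \<ominus> u \<otimes> y) \<in> D (Suc (s + j))"
    using hidealD(4)[OF D(1) abz(1) u(2)] by simp
  moreover have "y \<otimes> d \<in> D (Suc (s + j))"
    using hidealD(4)[OF D(1) xy_carrier(4) dp(1)] by simp
  ultimately have "(a \<otimes> (x \<ominus> u \<otimes> y) \<oplus> y \<otimes> d) \<oplus> z \<in> D (Suc (s + j))"
    using zD ideal_add_closed[OF hidealD(1)[OF D(1)]] by blast
  thus ?case using w dp(2) by auto
qed

lemma pw_subset_of_power:
  assumes D: "hideal D" "\<And>n. gen_part W n \<subseteq> D n" and u: "u \<in> carrier R" "x \<ominus> u \<otimes> y \<in> D (Suc 0)"
    and p: "y [^] j \<in> D j"
  shows "pw (s + j) \<subseteq> D (s + j)"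
proof
  fix w assume "w \<in> pw (s + j)"
  then obtain d p where dp: "d \<in> D (s + j)" "p \<in> pw s" "w = d \<oplus> y [^] j \<otimes> p"
    using pw_subset_add_power[OF D u] by blast
  have "y [^] j \<otimes> p = p \<otimes> y [^] j" using pw_carrier[OF dp(2)] xy_carrier(2) by (simp add: m_comm)
  hence "y [^] j \<otimes> p \<in> D (s + j)" using hidealD(4)[OF D(1) dp(2) p] by simp
  thus "w \<in> D (s + j)" using dp ideal_add_closed[OF hidealD(1)[OF D(1)]] by blast
qed

section \<open>Forms in two generators over the residue field\<close>

definition form :: "nat \<Rightarrow> (nat \<Rightarrow> 'a) \<Rightarrow> 'a" where
  "form e c = (\<Oplus>i\<in>{..e}. c i \<otimes> (x [^] i \<otimes> y [^] (e - i)))"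

text \<open>The values of all forms that are non-zero over the residue field. Avoiding them
  expresses that the classes of \<open>x\<close> and \<open>y\<close> are algebraically independent
  modulo the ideal in question.\<close>

definition forms where
  "forms e = {form e c | c. (\<forall>i. c i \<in> carrier R) \<and> (\<exists>i\<le>e. c i \<notin> m)}"

lemma monomial_carrier: "x [^] (i::nat) \<otimes> y [^] (j::nat) \<in> carrier R" using xy_carrier by simp

lemma form_pw: assumes "\<And>i. c i \<in> carrier R" shows "form e c \<in> pw e"
  unfolding form_def
proof (intro ideal_finsum_closed pw_ideal)
  fix i assume "i \<in> {..e}"
  hence "x [^] i \<otimes> y [^] (e - i) \<in> pw e"
    using pw_mult[OF pow_in_ideal_pow[OF L_ideal x, of i] pow_in_ideal_pow[OF L_ideal y, of "e - i"]] by simp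
  thus "c i \<otimes> (x [^] i \<otimes> y [^] (e - i)) \<in> pw e" using ideal.I_l_closed[OF pw_ideal] assms by blast
qed simp

lemma form_add:
  assumes "\<And>i. c i \<in> carrier R" "\<And>i. d i \<in> carrier R"
  shows "form e (\<lambda>i. c i \<oplus> d i) = form e c \<oplus> form e d"
proof -
  have "(\<lambda>i. c i \<otimes> (x [^] i \<otimes> y [^] (e - i))) \<in> {..e} \<rightarrow> carrier R"
    "(\<lambda>i. d i \<otimes> (x [^] i \<otimes> y [^] (e - i))) \<in> {..e} \<rightarrow> carrier R"
    using assms monomial_carrier by auto
  from finsum_addf[OF this] show ?thesis unfolding form_def
    using assms monomial_carrier by (simp add: l_distr)
qed

lemma form_smult:
  assumes "\<And>i. c i \<in> carrier R" "a \<in> carrier R"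
  shows "form e (\<lambda>i. a \<otimes> c i) = a \<otimes> form e c"
  unfolding form_def using assms monomial_carrier
  by (subst finsum_rdistr) (auto simp: m_assoc intro!: finsum_cong')

lemma form_single:
  assumes "k \<le> e" shows "form e (\<lambda>i. if k = i then \<one> else \<zero>) = x [^] k \<otimes> y [^] (e - k)"
proof -
  have "form e (\<lambda>i. if k = i then \<one> else \<zero>) = (\<Oplus>i\<in>{..e}. if k = i then x [^] i \<otimes> y [^] (e - i) else \<zero>)"
    unfolding form_def using monomial_carrier by (intro finsum_cong') auto
  also have "\<dots> = x [^] k \<otimes> y [^] (e - k)"
    using assms monomial_carrier by (intro finsum_singleton) auto
  finally show ?thesis .
qed

text \<open>Vanishing beyond the degree matters: \<open>conv\<close> also sees coefficients of index
  above \<open>e\<close>, for which the truncated exponent \<open>e - i\<close> would be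
  wrong.\<close>

lemma form_mult:
  assumes c: "\<And>i. c i \<in> carrier R" "\<And>i. i > e \<Longrightarrow> c i = \<zero>"
    and d: "\<And>i. d i \<in> carrier R" "\<And>i. i > f \<Longrightarrow> d i = \<zero>"
  shows "form e c \<otimes> form f d = form (e + f) (conv c d)"
proof -
  let ?c = "\<lambda>i. c i \<otimes> (x [^] i \<otimes> y [^] (e - i))" and ?d = "\<lambda>i. d i \<otimes> (x [^] i \<otimes> y [^] (f - i))"
  have cd: "?c i \<in> carrier R" "?d i \<in> carrier R" for i using c d monomial_carrier by auto
  have "bound \<zero> e ?c" "bound \<zero> f ?d" unfolding bound_def using c(2) d(2) monomial_carrier by (metis l_null)+
  hence "form e c \<otimes> form f d = (\<Oplus>k\<in>{..e + f}. \<Oplus>i\<in>{..k}. ?c i \<otimes> ?d (k - i))"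
    unfolding form_def using cd by (intro cauchy_product[symmetric]) auto
  also have "\<dots> = (\<Oplus>k\<in>{..e + f}. conv c d k \<otimes> (x [^] k \<otimes> y [^] (e + f - k)))"
  proof (intro finsum_cong' refl)
    fix k assume k: "k \<in> {..e + f}"
    have *: "?c i \<otimes> ?d (k - i) = (c i \<otimes> d (k - i)) \<otimes> (x [^] k \<otimes> y [^] (e + f - k))" if i: "i \<in> {..k}" for i
    proof (cases "i \<le> e \<and> k - i \<le> f")
      case True
      have xs: "x [^] i \<otimes> x [^] (k - i) = x [^] k" using nat_pow_mult[OF xy_carrier(1), of i "k - i"] i by simp
      have ys: "y [^] (e - i) \<otimes> y [^] (f - (k - i)) = y [^] (e + f - k)"
        using nat_pow_mult[OF xy_carrier(2), of "e - i" "f - (k - i)"] i True by simp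
      have "(a \<otimes> (p \<otimes> q)) \<otimes> (b \<otimes> (p' \<otimes> q')) = (a \<otimes> b) \<otimes> ((p \<otimes> p') \<otimes> (q \<otimes> q'))"
        if "a \<in> carrier R" "b \<in> carrier R" "p \<in> carrier R" "q \<in> carrier R" "p' \<in> carrier R" "q' \<in> carrier R"
        for a b p q p' q' using that by algebra
      thus ?thesis using c d xy_carrier(1,2) xs ys by simp
    next
      case False
      hence "c i = \<zero> \<or> d (k - i) = \<zero>" using c(2) d(2) by (meson not_le)
      thus ?thesis using c(1) d(1) monomial_carrier by auto
    qed
    have "(\<Oplus>i\<in>{..k}. ?c i \<otimes> ?d (k - i)) = (\<Oplus>i\<in>{..k}. (c i \<otimes> d (k - i)) \<otimes> (x [^] k \<otimes> y [^] (e + f - k)))"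
      using * c d monomial_carrier by (intro finsum_cong') auto
    also have "\<dots> = conv c d k \<otimes> (x [^] k \<otimes> y [^] (e + f - k))"
      unfolding conv_def using c d monomial_carrier by (subst finsum_ldistr) auto
    finally show "(\<Oplus>i\<in>{..k}. ?c i \<otimes> ?d (k - i)) = conv c d k \<otimes> (x [^] k \<otimes> y [^] (e + f - k))" .
  qed (use c d monomial_carrier in \<open>auto simp: conv_def Pi_def\<close>)
  finally show ?thesis by (simp add: form_def)
qed

text \<open>As in Gauss's lemma: \<open>m\<close> is prime, so the product of two polynomials with a
  unit coefficient has a unit coefficient.\<close>

lemma forms_mult:
  assumes "v \<in> forms e" "w \<in> forms f" shows "v \<otimes> w \<in> forms (e + f)"
proof -
  obtain c d i0 j0 where cd: "\<And>i. c i \<in> carrier R" "i0 \<le> e" "c i0 \<notin> m" "v = form e c"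
    "\<And>i. d i \<in> carrier R" "j0 \<le> f" "d j0 \<notin> m" "w = form f d"
    using assms unfolding forms_def by blast
  \<comment> \<open>Above the degree the coefficients in \<open>forms\<close> are arbitrary; they
    are cut off before multiplying.\<close>
  let ?c = "\<lambda>i. if i \<le> e then c i else \<zero>" and ?d = "\<lambda>i. if i \<le> f then d i else \<zero>"
  have "v = form e ?c" "w = form f ?d"
    unfolding cd form_def using cd monomial_carrier by (auto intro!: finsum_cong')
  hence vw: "v \<otimes> w = form (e + f) (conv ?c ?d)" using cd by (simp add: form_mult)
  have "\<exists>i j. i \<le> i0 \<and> j \<le> j0 \<and> conv ?c ?d (i + j) \<notin> m"
    using cd m_ideal ideal.I_l_closed[OF m_ideal] primeideal.I_prime[OF m_prime]
    by (intro conv_lowest[where N = "\<lambda>_. carrier R" and Q = "\<lambda>_. m"]) auto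
  then obtain i j where "i \<le> i0" "j \<le> j0" "conv ?c ?d (i + j) \<notin> m" by blast
  moreover have "conv ?c ?d k \<in> carrier R" for k unfolding conv_def using cd by (auto simp: Pi_def)
  ultimately show ?thesis unfolding forms_def vw using cd
    by (intro CollectI exI[of _ "conv ?c ?d"]) (auto intro!: exI[of _ "i + j"])
qed

end

context fiber_ring
begin

lemma gen_part_mono: "W \<subseteq> V \<Longrightarrow> gen_part W n \<subseteq> gen_part V n"
  unfolding gen_part_def using ideal_prod_mono[of W V] by (intro set_add_mono) auto

end

section \<open>Algebraic independence and the dimension of the fiber cone\<close>

context two_generators
begin

text \<open>A change of coordinates as in Noether normalization. If a non-zero form vanished modulo
  \<open>W\<close>, put \<open>t = x - u y\<close> with \<open>u\<close> not a root of the
  dehomogenized form. Modulo \<open>(t) + W\<close> the form becomes a unit times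
  \<open>y^e\<close>, so \<open>y\<close> is nilpotent there and the quotient vanishes in high
  degrees. Then \<open>(t) + W\<close> is a reduction, which \<open>nred\<close> forbids.\<close>

lemma forms_disjoint_gen_part:
  assumes inf: "infinite (carrier (R Quot m))"
    and nred: "\<And>u. u \<in> carrier R \<Longrightarrow> \<not> reduction R L (PIdl (x \<ominus> u \<otimes> y) <+> W)"
  shows "gen_part W e \<inter> forms e = {}"
proof (rule ccontr)
  assume "gen_part W e \<inter> forms e \<noteq> {}"
  then obtain v where v: "v \<in> gen_part W e" "v \<in> forms e" by blast
  then obtain c j where c: "\<And>i. c i \<in> carrier R" "j \<le> e" "c j \<notin> m" "v = form e c"
    unfolding forms_def by blast
  obtain u where u: "u \<in> carrier R" "(\<Oplus>i\<in>{..e}. c i \<otimes> u [^] i) \<notin> m"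
    using exists_nonroot_mod_m[where c = c, OF inf c(1,3,2)] by blast
  let ?P = "\<Oplus>i\<in>{..e}. c i \<otimes> u [^] i"
  have Pc: "?P \<in> carrier R" using c u by (simp add: Pi_def)
  define t where "t = x \<ominus> u \<otimes> y"
  define V where "V = PIdl t <+> W"
  have tL: "t \<in> L" unfolding t_def using x y u ideal_minus_closed[OF L_ideal] ideal.I_l_closed[OF L_ideal] by blast
  have tc: "t \<in> carrier R" using tL ideal.Icarr[OF L_ideal] by blast
  note PI = cgenideal_ideal[OF tc]
  have V: "ideal V R" "V \<subseteq> L"
    unfolding V_def using add_ideals[OF PI W(1)] cgenideal_minimal[OF L_ideal tL] W
    by (auto simp: set_add_subset_iff[OF PI W(1) L_ideal])
  have tV: "t \<in> V" "W \<subseteq> V"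
    using set_add_upper[OF PI W(1)] cgenideal_self[OF tc] unfolding V_def by blast+
  define D where "D = gen_part V"
  have D: "hideal D" "\<And>n. gen_part W n \<subseteq> D n"
    unfolding D_def using hideal_gen_part[OF V] gen_part_mono[OF tV(2)] by blast+
  have DI: "ideal (D n) R" for n using hidealD(1)[OF D(1)] .
  have t1: "t \<in> D (Suc 0)"
    using gen_part_mem[OF V(1) tV(1), of \<one> 0] tc unfolding D_def by simp
  \<comment> \<open>Replacing the factors \<open>x\<close> by \<open>u y\<close> one at a time
    changes a monomial only by multiples of \<open>t\<close>.\<close>
  have "x [^] i \<otimes> y [^] (e - i) \<ominus> u [^] i \<otimes> y [^] e \<in> D e" if "i \<le> e" for i
    using that
  proof (induction i)
    case 0
    have "\<one> \<otimes> y [^] e \<ominus> \<one> \<otimes> y [^] e = \<zero>" using xy_carrier(2) by (simp add: a_minus_def r_neg)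
    thus ?case using ideal_zero_closed[OF DI] by simp
  next
    case (Suc i)
    have e: "e - i = Suc (e - Suc i)" using Suc.prems by auto
    have "x [^] i \<otimes> y [^] (e - Suc i) \<in> pw (i + (e - Suc i))"
      by (rule pw_mult[OF pow_in_ideal_pow[OF L_ideal x] pow_in_ideal_pow[OF L_ideal y]])
    from hidealD(4)[OF D(1) this t1] have 1: "(x [^] i \<otimes> y [^] (e - Suc i)) \<otimes> t \<in> D e"
      using Suc.prems by simp
    have 2: "u \<otimes> (x [^] i \<otimes> y [^] (e - i) \<ominus> u [^] i \<otimes> y [^] e) \<in> D e"
      using Suc ideal.I_l_closed[OF DI _ u(1)] by simp
    have alg: "(a \<otimes> x) \<otimes> b \<ominus> (g \<otimes> u) \<otimes> h = (a \<otimes> b) \<otimes> (x \<ominus> u \<otimes> y) \<oplus> u \<otimes> (a \<otimes> (b \<otimes> y) \<ominus> g \<otimes> h)"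
      if "a \<in> carrier R" "b \<in> carrier R" "g \<in> carrier R" "h \<in> carrier R" for a b g h
      using that xy_carrier(1,2) u(1) by algebra
    have "x [^] (Suc i) \<otimes> y [^] (e - Suc i) \<ominus> u [^] (Suc i) \<otimes> y [^] e =
        (x [^] i \<otimes> y [^] (e - Suc i)) \<otimes> t \<oplus> u \<otimes> (x [^] i \<otimes> y [^] (e - i) \<ominus> u [^] i \<otimes> y [^] e)"
      unfolding e t_def nat_pow_Suc using xy_carrier(1,2) u(1) by (intro alg) auto
    thus ?case using ideal_add_closed[OF DI 1 2] by simp
  qed
  hence terms: "c i \<otimes> (x [^] i \<otimes> y [^] (e - i) \<ominus> u [^] i \<otimes> y [^] e) \<in> D e" if "i \<in> {..e}" for i
    using that ideal.I_l_closed[OF DI _ c(1)] by simp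
  let ?S = "\<Oplus>i\<in>{..e}. c i \<otimes> (x [^] i \<otimes> y [^] (e - i) \<ominus> u [^] i \<otimes> y [^] e)"
  have S: "?S \<in> D e" using terms by (intro ideal_finsum_closed DI) auto
  have cc: "x [^] i \<in> carrier R" "y [^] i \<in> carrier R" "u [^] i \<in> carrier R" for i :: nat
    using xy_carrier(1,2) u(1) by auto
  \<comment> \<open>From each monomial its value under \<open>x = u y\<close> is split off; the
    remainders add up to an element of \<open>D e\<close>.\<close>
  have "form e c = (\<Oplus>i\<in>{..e}. c i \<otimes> (x [^] i \<otimes> y [^] (e - i) \<ominus> u [^] i \<otimes> y [^] e) \<oplus> (c i \<otimes> u [^] i) \<otimes> y [^] e)"
    unfolding form_def
  proof (intro finsum_cong' refl)
    fix i
    have "a \<otimes> p = a \<otimes> (p \<ominus> q \<otimes> h) \<oplus> (a \<otimes> q) \<otimes> h"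
      if "a \<in> carrier R" "p \<in> carrier R" "q \<in> carrier R" "h \<in> carrier R" for a p q h using that by algebra
    thus "c i \<otimes> (x [^] i \<otimes> y [^] (e - i)) =
        c i \<otimes> (x [^] i \<otimes> y [^] (e - i) \<ominus> u [^] i \<otimes> y [^] e) \<oplus> (c i \<otimes> u [^] i) \<otimes> y [^] e"
      using c(1) cc by simp
  qed (use c(1) cc in auto)
  also have "\<dots> = ?S \<oplus> (\<Oplus>i\<in>{..e}. (c i \<otimes> u [^] i) \<otimes> y [^] e)"
    using c(1) cc by (intro finsum_addf) auto
  also have "(\<Oplus>i\<in>{..e}. (c i \<otimes> u [^] i) \<otimes> y [^] e) = ?P \<otimes> y [^] e"
    using c(1) cc by (subst finsum_ldistr) auto
  finally have eq: "form e c = ?S \<oplus> ?P \<otimes> y [^] e" .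
  have "form e c \<ominus> ?S \<in> D e"
    using ideal_minus_closed[OF DI _ S] v(1) D(2) c(4) by blast
  moreover have "form e c \<ominus> ?S = ?P \<otimes> y [^] e"
  proof -
    have "(p \<oplus> q) \<ominus> p = q" if "p \<in> carrier R" "q \<in> carrier R" for p q using that by algebra
    thus ?thesis unfolding eq using Pc cc ideal.Icarr[OF DI S] by simp
  qed
  ultimately have Pe: "?P \<otimes> y [^] e \<in> D e" by simp
  obtain z where z: "z \<in> carrier R" "z \<otimes> ?P = \<one>" using unit_of_notin_m[OF Pc u(2)] by blast
  have "z \<otimes> (?P \<otimes> y [^] e) = y [^] e" using m_assoc[OF z(1) Pc cc(2)[of e], symmetric] z(2) cc by simp
  hence ye: "y [^] e \<in> D e" using ideal.I_l_closed[OF DI Pe z(1)] by simp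
  \<comment> \<open>One more factor \<open>y\<close> makes the final degree a successor, as
    \<open>reduction_of_gen_part\<close> requires.\<close>
  have "y \<otimes> y [^] e \<in> D (Suc 0 + e)" using hidealD(4)[OF D(1) xy_carrier(4) ye] .
  hence "y [^] (Suc e) \<in> D (Suc e)" using xy_carrier(2) by (simp add: m_comm)
  hence "pw (s + Suc e) \<subseteq> D (s + Suc e)"
    using pw_subset_of_power[OF D u(1)] t1 unfolding t_def by blast
  hence "reduction R L V"
    using reduction_of_gen_part[OF V, of "s + e"] unfolding D_def by simp
  thus False using nred[OF u(1)] unfolding V_def t_def by blast
qed

text \<open>Only monomials with fewer than \<open>l\<close> factors \<open>x\<close> occur; these
  ideals provide the steps of the chain in \<open>forms_length\<close>.\<close>

lemma ideal_forms_below: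
  "ideal {form e b | b. (\<forall>i. b i \<in> carrier R) \<and> (\<forall>i\<ge>l. b i = \<zero>)} R" (is "ideal ?F R")
proof (rule idealI[OF ring_axioms])
  have fc: "form e b \<in> carrier R" if "\<And>i. b i \<in> carrier R" for b using form_pw that pw_carrier by blast
  have l: "a \<otimes> z \<in> ?F" if z: "z \<in> ?F" and a: "a \<in> carrier R" for a z
  proof -
    obtain b where b: "\<And>i. b i \<in> carrier R" "\<And>i. i \<ge> l \<Longrightarrow> b i = \<zero>" "z = form e b" using z by blast
    hence "a \<otimes> z = form e (\<lambda>i. a \<otimes> b i)" using form_smult a by simp
    thus ?thesis using b a by auto
  qed
  show "subgroup ?F (add_monoid R)"
  proof (rule add.subgroupI)
    show "?F \<subseteq> carrier R" using fc by blast
    have "form e (\<lambda>_. \<zero>) \<in> ?F" by auto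
    thus "?F \<noteq> {}" by blast
    fix z assume z: "z \<in> ?F"
    have "\<ominus> \<one> \<otimes> z \<in> ?F" using l[OF z] by blast
    moreover have "z \<in> carrier R" using z fc by blast
    ultimately show "\<ominus> z \<in> ?F" by (simp add: l_minus)
    fix w assume w: "w \<in> ?F"
    obtain b where b: "\<And>i. b i \<in> carrier R" "\<And>i. i \<ge> l \<Longrightarrow> b i = \<zero>" "z = form e b" using z by blast
    obtain c where c: "\<And>i. c i \<in> carrier R" "\<And>i. i \<ge> l \<Longrightarrow> c i = \<zero>" "w = form e c" using w by blast
    have "z \<oplus> w = form e (\<lambda>i. b i \<oplus> c i)" using form_add b c by simp
    thus "z \<oplus> w \<in> ?F" using b c by auto
  qed
  fix z a assume z: "z \<in> ?F" and a: "a \<in> carrier R"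
  show "a \<otimes> z \<in> ?F" by (rule l[OF z a])
  moreover have "z \<in> carrier R" using z fc by blast
  ultimately show "z \<otimes> a \<in> ?F" using m_comm a by simp
qed

text \<open>The monomials of degree \<open>e\<close> are independent modulo \<open>Q\<close>: a
  relation among them would be a form with coefficient one that lies in \<open>Q\<close>.\<close>

lemma forms_length:
  assumes Q: "hideal Q" "Q e \<inter> forms e = {}" and t: "t \<le> e"
  shows "enat (Suc t) \<le> ideal_length R (Q e) (pw e)"
proof -
  note I = hidealD(1)[OF Q(1), of e]
  let ?B = "\<lambda>l. {form e b | b. (\<forall>i. b i \<in> carrier R) \<and> (\<forall>i\<ge>l. b i = \<zero>)}"
  let ?c = "\<lambda>l. Q e <+> ?B l"
  have "ideal_chain R (Q e) (pw e) (Suc t)" unfolding ideal_chain_def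
  proof (intro exI[of _ ?c] conjI allI impI)
    fix l
    show "ideal (?c l) R" using add_ideals[OF I ideal_forms_below] .
    show "Q e \<subseteq> ?c l" using set_add_upper(1)[OF I ideal_forms_below] .
    have "?B l \<subseteq> pw e" using form_pw by blast
    thus "?c l \<subseteq> pw e"
      using hidealD(3)[OF Q(1)] by (subst set_add_subset_iff[OF I ideal_forms_below pw_ideal]) auto
  next
    fix l assume l: "l < Suc t"
    let ?w = "x [^] l \<otimes> y [^] (e - l)"
    have w: "form e (\<lambda>i. if l = i then \<one> else \<zero>) = ?w" using form_single[of l e] l t by simp
    have "?B l \<subseteq> ?B (Suc l)" by (rule Collect_mono) (metis Suc_leD)
    hence le: "?c l \<subseteq> ?c (Suc l)" using set_add_mono subset_refl by blast
    have "?w \<in> ?B (Suc l)" unfolding w[symmetric] by auto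
    hence "?w \<in> ?c (Suc l)" using set_add_upper(2)[OF I ideal_forms_below] by blast
    moreover have "?w \<notin> ?c l"
    proof
      assume "?w \<in> ?c l"
      then obtain q b where q: "q \<in> Q e" "\<And>i. b i \<in> carrier R" "\<And>i. i \<ge> l \<Longrightarrow> b i = \<zero>" "?w = q \<oplus> form e b"
        unfolding set_add_iff by blast
      have qc: "q \<in> carrier R" "form e b \<in> carrier R"
        using q ideal.Icarr[OF I] form_pw pw_carrier by blast+
      \<comment> \<open>The coefficient at \<open>l\<close> stays one because \<open>b\<close>
        vanishes from \<open>l\<close> on.\<close>
      let ?b = "\<lambda>i. (if l = i then \<one> else \<zero>) \<oplus> \<ominus> \<one> \<otimes> b i"
      have "form e ?b = ?w \<oplus> \<ominus> \<one> \<otimes> form e b"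
        using form_add[of "\<lambda>i. if l = i then \<one> else \<zero>" "\<lambda>i. \<ominus> \<one> \<otimes> b i"] form_smult[of b "\<ominus> \<one>"] w q(2) by simp
      also have "\<dots> = q" unfolding q(4) using qc by algebra
      finally have "q = form e ?b" by simp
      moreover have "?b l = \<one>" using q(3)[of l] by simp
      hence "?b l \<notin> m" using one_notin_m by simp
      ultimately have "q \<in> forms e" unfolding forms_def using q(2) l t
        by (intro CollectI exI[of _ ?b]) (auto intro!: exI[of _ l])
      thus False using Q(2) q(1) by blast
    qed
    ultimately show "?c l \<subset> ?c (Suc l)" using le by blast
  qed
  thus ?thesis using le_ideal_length_iff[OF I hidealD(3)[OF Q(1)]] by blast
qed

text \<open>The primes are \<open>P0\<close>, avoiding all nonzero forms in \<open>x\<close> and \<open>y\<close>, then \<open>P1\<close>, containing \<open>P0\<close> and \<open>x\<close> but no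
  power of \<open>y\<close>, and the irrelevant ideal. If a power of \<open>y\<close> were in \<open>P0 + (x)\<close>, the graded pieces of
  \<open>F(L)/P0\<close> would have bounded length; but in degree \<open>e\<close> they contain \<open>e + 1\<close> independent monomials in
  \<open>x\<close> and \<open>y\<close>.\<close>

lemma krull_dim_fiber_cone_ge_2:
  assumes disj: "\<And>e. gen_part W e \<inter> forms e = {}"
  shows "2 \<le> krull_dim F"
proof -
  have one_form: "\<one> \<in> forms 0"
  proof -
    have "form 0 (\<lambda>i. if 0 = i then \<one> else \<zero>) = \<one>" using form_single[of 0 0] by simp
    thus ?thesis unfolding forms_def using one_notin_m
      by (intro CollectI exI[of _ "\<lambda>i. if 0 = i then \<one> else \<zero>"]) auto
  qed
  have xy_forms: "x \<in> forms (Suc 0)"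
  proof -
    have "form (Suc 0) (\<lambda>i. if Suc 0 = i then \<one> else \<zero>) = x" using form_single[of "Suc 0" "Suc 0"] xy_carrier(1) by simp
    thus ?thesis unfolding forms_def using one_notin_m
      by (intro CollectI exI[of _ "\<lambda>i. if Suc 0 = i then \<one> else \<zero>"]) auto
  qed
  have fpw: "forms e \<subseteq> pw e" for e unfolding forms_def using form_pw by blast
  have "\<exists>Q. hprime Q \<and> (\<forall>n. gen_part W n \<subseteq> Q n \<and> Q n \<inter> forms n = {})"
    by (rule exists_hprime[OF hideal_gen_part[OF W]]) (use fpw one_form forms_mult disj in blast)+
  then obtain P0 where P0: "hprime P0" "\<And>n. gen_part W n \<subseteq> P0 n" "\<And>n. P0 n \<inter> forms n = {}" by blast
  have hP0: "hideal P0" using P0(1) by (simp add: hprime_def)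
  note PIx = cgenideal_ideal[OF xy_carrier(1)] cgenideal_minimal[OF L_ideal x]
  define K where "K n = P0 n <+> gen_part (PIdl x) n" for n
  have hK: "hideal K" unfolding K_def using hideal_add[OF hP0 hideal_gen_part[OF PIx]] .
  have P0K: "P0 n \<subseteq> K n" and gK: "gen_part (PIdl x) n \<subseteq> K n" for n
    unfolding K_def using set_add_upper[OF hidealD(1)[OF hP0] hidealD(1)[OF hideal_gen_part[OF PIx]]] by blast+
  have WK: "gen_part W n \<subseteq> K n" for n using P0(2) P0K by blast
  have xK: "x \<in> K (Suc 0)"
    using gK[of "Suc 0"] gen_part_mem[OF PIx(1) cgenideal_self[OF xy_carrier(1)], of \<one> 0] xy_carrier(1) by auto
  have yK: "y [^] i \<notin> K i" for i :: nat
  proof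
    assume yi: "y [^] i \<in> K i"
    \<comment> \<open>From degree \<open>N\<close> on a factor \<open>y^i\<close> can be split off
      beside the \<open>s\<close> degrees of the reduction, so everything falls into
      \<open>K\<close>.\<close>
    define N where "N = s + i"
    have "pw n \<subseteq> K n" if n: "N \<le> n" for n
    proof -
      have "y [^] (n - s - i) \<otimes> y [^] i \<in> K (n - s - i + i)"
        by (rule hidealD(4)[OF hK pow_in_ideal_pow[OF L_ideal y] yi])
      hence "y [^] (n - s) \<in> K (n - s)" using n xy_carrier(2) by (simp add: nat_pow_mult N_def)
      \<comment> \<open>The case \<open>u = 0\<close>, since \<open>x\<close> itself lies in
        \<open>K\<close>.\<close>
      moreover have "x \<ominus> \<zero> \<otimes> y \<in> K (Suc 0)" using xK xy_carrier(1,2) by (simp add: a_minus_def)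
      ultimately have "pw (s + (n - s)) \<subseteq> K (s + (n - s))"
        using pw_subset_of_power[OF hK WK zero_closed] by blast
      thus ?thesis using n by (simp add: N_def)
    qed
    hence step: "\<exists>p\<in>P0 (Suc n). \<exists>v\<in>pw n. w = p \<oplus> x \<otimes> v" if n: "N \<le> n" and w: "w \<in> pw (Suc n)" for n w
    proof -
      have "w \<in> P0 (Suc n) <+> gen_part (PIdl x) (Suc n)"
        using w n \<open>\<And>n. N \<le> n \<Longrightarrow> pw n \<subseteq> K n\<close>[of "Suc n"] unfolding K_def by auto
      then obtain p g where pg: "p \<in> P0 (Suc n)" "g \<in> gen_part (PIdl x) (Suc n)" "w = p \<oplus> g"
        unfolding set_add_iff by blast
      have eq: "gen_part (PIdl x) (Suc n) = mpw (Suc n) <+> (x <# pw n)"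
        unfolding gen_part_def using PIdl_prod[OF pw_ideal xy_carrier(1)] by simp
      obtain k h where kh: "k \<in> mpw (Suc n)" "h \<in> x <# pw n" "g = k \<oplus> h"
        using pg(2) unfolding eq set_add_iff by blast
      then obtain v where kv: "k \<in> mpw (Suc n)" "v \<in> pw n" "g = k \<oplus> x \<otimes> v"
        unfolding l_coset_iff by blast
      have kP: "k \<in> P0 (Suc n)" using kv(1) hidealD(2)[OF hP0] by blast
      have "p \<in> carrier R" "k \<in> carrier R" "v \<in> carrier R"
        using pg(1) kP kv(2) ideal.Icarr[OF hidealD(1)[OF hP0]] pw_carrier by blast+
      hence "w = (p \<oplus> k) \<oplus> x \<otimes> v" using pg kv xy_carrier(1) by (simp add: a_assoc)
      thus ?thesis using ideal_add_closed[OF hidealD(1)[OF hP0] pg(1) kP] kv(2) by blast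
    qed
    have iter: "w \<in> pw (N + j) \<Longrightarrow> \<exists>p\<in>P0 (N + j). \<exists>v\<in>pw N. w = p \<oplus> x [^] j \<otimes> v" for j w
    proof (induction j arbitrary: w)
      case 0
      hence "w = \<zero> \<oplus> x [^] (0::nat) \<otimes> w" using pw_carrier[of w N] by simp
      thus ?case using 0 ideal_zero_closed[OF hidealD(1)[OF hP0]] by auto
    next
      case (Suc j)
      obtain p v where pv: "p \<in> P0 (Suc (N + j))" "v \<in> pw (N + j)" "w = p \<oplus> x \<otimes> v"
        using step[of "N + j" w] Suc.prems by auto
      obtain p' v' where pv': "p' \<in> P0 (N + j)" "v' \<in> pw N" "v = p' \<oplus> x [^] j \<otimes> v'"
        using Suc.IH[OF pv(2)] by blast
      have xp: "x \<otimes> p' \<in> P0 (Suc (N + j))" using hidealD(4)[OF hP0 xy_carrier(3) pv'(1)] by simp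
      have c: "p \<in> carrier R" "p' \<in> carrier R" "v' \<in> carrier R" "x [^] j \<in> carrier R"
        using pv(1) pv'(1,2) ideal.Icarr[OF hidealD(1)[OF hP0]] pw_carrier xy_carrier(1) by auto
      have "p \<oplus> x \<otimes> (p' \<oplus> q \<otimes> v') = (p \<oplus> x \<otimes> p') \<oplus> (q \<otimes> x) \<otimes> v'" if "q \<in> carrier R" for q
        using that c xy_carrier(1) by algebra
      hence "w = (p \<oplus> x \<otimes> p') \<oplus> x [^] (Suc j) \<otimes> v'" unfolding pv pv'(3) using c(4) by simp
      moreover have "p \<oplus> x \<otimes> p' \<in> P0 (N + Suc j)"
        using ideal_add_closed[OF hidealD(1)[OF hP0] pv(1) xp] by simp
      ultimately show ?case using pv'(2) by blast
    qed
    \<comment> \<open>\<open>t\<close> is the length of \<open>L^N/mL^N\<close>, and degree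
      \<open>e = N + t\<close> has room for \<open>t + 1\<close> independent monomials.\<close>
    define t where "t = min_gens R (pw N)"
    define e where "e = N + t"
    define B where "B = x [^] t <# pw N"
    have xt: "x [^] t \<in> carrier R" using xy_carrier(1) by simp
    have BI: "ideal B R" unfolding B_def using l_coset_ideal[OF pw_ideal xt] .
    have Bpw: "B \<subseteq> pw e"
      using pw_mult[OF pow_in_ideal_pow[OF L_ideal x, of t]] unfolding B_def e_def
      by (auto simp: l_coset_iff add.commute)
    note P0e = hidealD(1-3)[OF hP0, of e]
    have "pw e \<subseteq> P0 e <+> B"
    proof
      fix w assume "w \<in> pw e"
      then obtain p v where "p \<in> P0 e" "v \<in> pw N" "w = p \<oplus> x [^] t \<otimes> v" using iter unfolding e_def by blast
      moreover from this have "x [^] t \<otimes> v \<in> B" unfolding B_def l_coset_iff by blast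
      ultimately show "w \<in> P0 e <+> B" unfolding set_add_iff by blast
    qed
    hence pwe: "pw e = P0 e <+> B"
      using set_add_subset_iff[OF P0e(1) BI pw_ideal[of e]] P0e(3) Bpw by blast
    have mB: "x [^] t <# mpw N \<subseteq> P0 e \<inter> B"
    proof
      fix w assume "w \<in> x [^] t <# mpw N"
      then obtain k where k: "k \<in> mpw N" "w = x [^] t \<otimes> k" by (auto simp: l_coset_iff)
      have "x [^] t \<otimes> k \<in> mpw (t + N)" using mpw_mult[OF pow_in_ideal_pow[OF L_ideal x] k(1)] .
      hence "w \<in> P0 e" using k(2) P0e(2) unfolding e_def by (auto simp: add.commute)
      moreover have "w \<in> B" unfolding B_def l_coset_iff using k mpw_pw by blast
      ultimately show "w \<in> P0 e \<inter> B" by blast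
    qed
    \<comment> \<open>Modulo \<open>P0\<close> the degree \<open>e\<close> part is a quotient of
      \<open>x^t L^N / x^t mL^N\<close>, hence of \<open>L^N/mL^N\<close>.\<close>
    have "ideal_length R (P0 e) (pw e) = ideal_length R (P0 e \<inter> B) B"
      unfolding pwe using ideal_length_inter_sum[OF P0e(1) BI] by simp
    also have "\<dots> \<le> ideal_length R (x [^] t <# mpw N) B"
      using ideal_length_add[OF l_coset_ideal[OF mpw_ideal xt] i_intersect[OF P0e(1) BI] BI mB] by simp
    also have "\<dots> \<le> ideal_length R (mpw N) (pw N)"
      unfolding B_def using ideal_length_l_coset_le[OF mpw_ideal pw_ideal mpw_subset xt] .
    also have "\<dots> = enat t" unfolding t_def using ideal_length_min_gens[OF pw_ideal] .
    finally have "ideal_length R (P0 e) (pw e) \<le> enat t" .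
    moreover have "enat (Suc t) \<le> ideal_length R (P0 e) (pw e)"
      by (rule forms_length[OF hP0 P0(3)]) (simp add: e_def)
    ultimately have "enat (Suc t) \<le> enat t" by (rule order_trans[rotated])
    thus False by simp
  qed
  have "\<exists>Q. hprime Q \<and> (\<forall>n. K n \<subseteq> Q n \<and> Q n \<inter> {y [^] n} = {})"
    by (rule exists_hprime[OF hK])
      (use yK pow_in_ideal_pow[OF L_ideal y] xy_carrier(2) in \<open>auto simp: nat_pow_mult\<close>)
  then obtain P1 where P1: "hprime P1" "\<And>n. K n \<subseteq> P1 n" "\<And>n. P1 n \<inter> {y [^] n} = {}" by blast
  have hP1: "hideal P1" using P1(1) by (simp add: hprime_def)
  have hI: "hideal irrelevant" using irrelevant_hprime by (simp add: hprime_def)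
  have "hset P0 \<subset> hset P1"
  proof (rule hset_mono[OF hP0 hP1])
    show "P0 n \<subseteq> P1 n" for n using P0K P1(2) by blast
    show "x \<in> P1 (Suc 0)" using xK P1(2) by blast
    show "x \<notin> P0 (Suc 0)" using xy_forms P0(3) by blast
  qed
  moreover have "hset P1 \<subset> hset irrelevant"
  proof (rule hset_mono[OF hP1 hI])
    show "P1 n \<subseteq> irrelevant n" for n by (rule hprime_subset_irrelevant[OF P1(1)])
    show "y \<in> irrelevant (Suc 0)" using xy_carrier(4) by (simp add: irrelevant_def)
    show "y \<notin> P1 (Suc 0)" using P1(3)[of "Suc 0"] xy_carrier(2) by auto
  qed
  ultimately show ?thesis
    using krull_dim_ge_2 hset_prime[OF P0(1)] hset_prime[OF P1(1)] hset_prime[OF irrelevant_hprime] by blast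
qed

end

section \<open>Minimal reductions are principal\<close>

context fiber_ring
begin

lemma minimal_reduction_unique:
  "minimal_reduction R L J \<Longrightarrow> reduction R L K \<Longrightarrow> K \<subseteq> J \<Longrightarrow> K = J"
  by (simp add: minimal_reduction_def)

text \<open>Any reduction inside \<open>J\<close> equals \<open>J\<close>, so fewer elements of
  \<open>J\<close> than a least generating set has never generate a reduction. In particular
  \<open>x\<close> and \<open>y\<close> cannot be replaced by a single \<open>x - u y\<close>, and
  two or more generators force dimension two.\<close>

theorem minimal_reduction_principal:
  assumes inf: "infinite (carrier (R Quot m))" and reg: "regular_ideal R L"
    and dim: "krull_dim F = 1" and J: "minimal_reduction R L J"
  shows "\<exists>a\<in>carrier R. J = PIdl a"
proof -
  have Jred: "reduction R L J" using J by (simp add: minimal_reduction_def)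
  hence JI: "ideal J R" "J \<subseteq> L" by (auto simp: reduction_def)
  let ?P = "\<lambda>S. finite S \<and> S \<subseteq> carrier R \<and> Idl S = J"
  have "\<exists>S. ?P S" using finetely_gen[OF JI(1)] by metis
  then obtain S where S: "?P S" and least: "\<And>T. ?P T \<Longrightarrow> card S \<le> card T"
    using ex_has_least_nat[of ?P _ card] by metis
  have SJ: "S \<subseteq> J" using S genideal_self by blast
  have small: "\<not> reduction R L (Idl T)" if "finite T" "T \<subseteq> J" "card T < card S" for T
  proof
    assume r: "reduction R L (Idl T)"
    have "Idl T = J" using minimal_reduction_unique[OF J r] genideal_minimal[OF JI(1) that(2)] by blast
    hence "card S \<le> card T" using least[of T] that JI ideal.Icarr[OF JI(1)] by blast
    thus False using that by simp
  qed
  consider "card S = 0" | "card S = 1" | "2 \<le> card S" by linarith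
  thus ?thesis
  proof cases
    case 1
    \<comment> \<open>The zero ideal is no reduction: a power of \<open>L\<close> would vanish,
      although it contains a power of a non-zero-divisor.\<close>
    hence "J = {\<zero>}" using S Idl_empty by auto
    hence "\<exists>n. pw (n + 1) = {\<zero>} \<cdot> pw n" using Jred by (auto simp: reduction_def)
    then obtain n where "pw (n + 1) = {\<zero>}"
      using ideal_prod_zero[OF pw_ideal] ideal_prod_commute[OF zeroideal pw_ideal] by metis
    thus ?thesis using exists_nonzero_pow[OF reg, of "n + 1"] by auto
  next
    case 2
    then obtain a where "S = {a}" using card_1_singletonE by blast
    thus ?thesis using S cgenideal_eq_genideal by auto
  next
    case 3
    have "S \<noteq> {}" using 3 by auto
    then obtain x where x: "x \<in> S" by blast
    have "S - {x} \<noteq> {}"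
    proof
      assume "S - {x} = {}" hence "S = {x}" using x by blast
      thus False using 3 by simp
    qed
    then obtain y where y: "y \<in> S - {x}" by blast
    define Z where "Z = S - {x} - {y}"
    have S': "S = insert x (insert y Z)" using x y by (auto simp: Z_def)
    have "card S = Suc (card (S - {x}))" using S x by (intro card.remove) auto
    also have "card (S - {x}) = Suc (card Z)" unfolding Z_def using S y by (intro card.remove) auto
    finally have Zf: "finite Z" "card Z + 2 = card S" "Z \<subseteq> J" using S SJ unfolding Z_def by auto
    have c: "x \<in> carrier R" "y \<in> carrier R" "Z \<subseteq> carrier R" "insert y Z \<subseteq> carrier R" using S S' by auto
    obtain s where s: "pw (s + 1) = J \<cdot> pw s" using Jred by (auto simp: reduction_def)
    have WL: "ideal (Idl Z) R" "Idl Z \<subseteq> L"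
      using genideal_ideal[OF c(3)] genideal_minimal[OF L_ideal, of Z] Zf(3) JI(2) by auto
    have Jeq: "J = PIdl x <+> (PIdl y <+> Idl Z)"
      using S S' Idl_insert[OF c(1,4)] Idl_insert[OF c(2,3)] by simp
    have xyJ: "x \<in> J" "y \<in> J" using SJ x y by blast+
    hence xyL: "x \<in> L" "y \<in> L" using JI(2) by blast+
    have "pw (s + 1) = (PIdl x <+> (PIdl y <+> Idl Z)) \<cdot> pw s" using s unfolding Jeq .
    hence tg: "two_generators R m L x y (Idl Z) s"
      by (intro two_generators.intro two_generators_axioms.intro fiber_ring_axioms xyL WL)
    interpret two_generators R m L x y "Idl Z" s
      by (rule tg)
    have "gen_part (Idl Z) e \<inter> forms e = {}" for e
    proof (rule forms_disjoint_gen_part[OF inf])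
      fix u assume u: "u \<in> carrier R"
      have tJ: "x \<ominus> u \<otimes> y \<in> J" using ideal_minus_closed[OF JI(1)] ideal.I_l_closed[OF JI(1)] xyJ u by blast
      hence "Idl (insert (x \<ominus> u \<otimes> y) Z) = PIdl (x \<ominus> u \<otimes> y) <+> Idl Z"
        using Idl_insert[OF _ c(3)] ideal.Icarr[OF JI(1)] by blast
      moreover have "card (insert (x \<ominus> u \<otimes> y) Z) < card S"
        using card_insert_le_m1[of "card S - 1" Z] Zf by (simp add: card_insert_if)
      hence "\<not> reduction R L (Idl (insert (x \<ominus> u \<otimes> y) Z))"
        using tJ Zf by (intro small) auto
      ultimately show "\<not> reduction R L (PIdl (x \<ominus> u \<otimes> y) <+> Idl Z)" by simp
    qed
    hence "2 \<le> krull_dim F" using krull_dim_fiber_cone_ge_2 by blast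
    thus ?thesis using dim by (simp add: numeral_eq_enat one_enat_def)
  qed
qed

end

section \<open>Cohen-Macaulayness and multiplication by a principal reduction\<close>

lemma nonzerodivisorD:
  "nonzerodivisor R x \<Longrightarrow> y \<in> carrier R \<Longrightarrow> x \<otimes>\<^bsub>R\<^esub> y = \<zero>\<^bsub>R\<^esub> \<Longrightarrow> y = \<zero>\<^bsub>R\<^esub>"
  unfolding nonzerodivisor_def by blast

text \<open>\<open>r\<close> is any degree from which on the powers of \<open>L\<close> arise by
  multiplication with \<open>a\<close>. The locale is also instantiated with the ideal
  \<open>(a)\<close> itself and \<open>r = 0\<close>.\<close>

locale principal_reduction = fiber_ring +
  fixes a r
  assumes a: "a \<in> L" and nzd: "nonzerodivisor R a" and red: "pw (Suc r) = a <# pw r"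
begin

abbreviation A where "A \<equiv> homog (Suc 0) a"

definition inj_at where "inj_at n \<longleftrightarrow> (\<forall>x\<in>pw n. a \<otimes> x \<in> mpw (Suc n) \<longrightarrow> x \<in> mpw n)"

lemma a_carrier: "a \<in> carrier R" using a ideal.Icarr[OF L_ideal] by blast

lemma a_pw: "a \<in> pw (Suc 0)" using a ideal_pow_1[OF L_ideal] by simp

lemma A_closed: "A \<in> carrier F" by (rule homog_closed[OF a_pw])

lemma a_cancel: "x \<in> carrier R \<Longrightarrow> y \<in> carrier R \<Longrightarrow> a \<otimes> x = a \<otimes> y \<Longrightarrow> x = y"
proof -
  assume x: "x \<in> carrier R" and y: "y \<in> carrier R" and eq: "a \<otimes> x = a \<otimes> y"
  have "a \<otimes> (x \<ominus> y) = a \<otimes> x \<ominus> a \<otimes> y" using x y a_carrier by algebra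
  also have "\<dots> = \<zero>" unfolding eq using y a_carrier by (simp add: a_minus_def r_neg)
  finally have "x \<ominus> y = \<zero>" by (rule nonzerodivisorD[OF nzd, rotated]) (use x y in simp)
  moreover have "x = (x \<ominus> y) \<oplus> y" using x y by algebra
  ultimately show ?thesis using y by simp
qed

lemma a_coset_cancel: "x \<in> carrier R \<Longrightarrow> N \<subseteq> carrier R \<Longrightarrow> a \<otimes> x \<in> a <# N \<longleftrightarrow> x \<in> N"
  using a_cancel by (auto simp: l_coset_iff)

lemma a_pow_cancel:
  "x \<in> carrier R \<Longrightarrow> a [^] (n::nat) \<otimes> x = \<zero> \<Longrightarrow> x = \<zero>"
proof (induction n)
  case (Suc n)
  have "a \<otimes> (a [^] n \<otimes> x) = \<zero>" using Suc.prems a_carrier by (simp add: m_ac)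
  hence "a [^] n \<otimes> x = \<zero>" by (rule nonzerodivisorD[OF nzd, rotated]) (use Suc.prems a_carrier in simp)
  thus ?case using Suc by blast
qed simp

lemma pw_Suc: assumes "r \<le> n" shows "pw (Suc n) = a <# pw n"
proof -
  have "pw (r + 1) = (PIdl a) \<cdot> pw r" using red PIdl_prod[OF pw_ideal a_carrier] by simp
  from reduction_stable[OF cgenideal_ideal[OF a_carrier] this assms] show ?thesis
    using PIdl_prod[OF pw_ideal a_carrier] by simp
qed

lemma mpw_Suc: assumes "r \<le> n" shows "mpw (Suc n) = a <# mpw n"
proof -
  note PI = cgenideal_ideal[OF a_carrier]
  have "mpw (Suc n) = m \<cdot> ((PIdl a) \<cdot> pw n)" using pw_Suc[OF assms] PIdl_prod[OF pw_ideal a_carrier] by simp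
  also have "\<dots> = (PIdl a) \<cdot> mpw n"
    using ideal_prod_assoc ideal_prod_commute[OF m_ideal PI] m_ideal PI pw_ideal by metis
  also have "\<dots> = a <# mpw n" using PIdl_prod[OF mpw_ideal a_carrier] .
  finally show ?thesis .
qed

lemma pw_add_power: "r \<le> n \<Longrightarrow> x \<in> pw (n + k) \<Longrightarrow> \<exists>y\<in>pw n. x = a [^] k \<otimes> y"
proof (induction k arbitrary: x)
  case 0
  hence "x \<in> pw n" "x = a [^] (0::nat) \<otimes> x" using pw_carrier[of x n] by auto
  thus ?case by blast
next
  case (Suc k)
  hence "x \<in> a <# pw (n + k)" using pw_Suc[of "n + k"] by simp
  then obtain z where z: "z \<in> pw (n + k)" "x = a \<otimes> z" by (auto simp: l_coset_iff)
  then obtain y where y: "y \<in> pw n" "z = a [^] k \<otimes> y" using Suc by blast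
  have "x = a [^] (Suc k) \<otimes> y" using y z pw_carrier a_carrier by (simp add: m_ac)
  thus ?case using y by blast
qed

text \<open>Otherwise \<open>L^(r+n) = a^n L^r\<close> would lie in \<open>mL^(r+n)\<close> and
  vanish by Nakayama, although it contains \<open>a^(r+n)\<close>. So the class of \<open>a\<close>
  is not nilpotent in the fiber cone.\<close>

lemma power_notin_mpw: "a [^] n \<notin> mpw n"
proof
  assume an: "a [^] n \<in> mpw n"
  have "pw (r + n) \<subseteq> mpw (r + n)"
  proof
    fix x assume "x \<in> pw (r + n)"
    then obtain y where y: "y \<in> pw r" "x = a [^] n \<otimes> y" using pw_add_power[of r x n] by blast
    have "a [^] n \<otimes> y \<in> mpw (n + r)" using mpw_mult'[OF an y(1)] .
    thus "x \<in> mpw (r + n)" using y by (simp add: add.commute)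
  qed
  also have "mpw (r + n) \<subseteq> mpw (r + n) <+> {\<zero>}"
    using set_add_upper(1)[OF mpw_ideal zeroideal] .
  finally have "pw (r + n) = {\<zero>}"
    using nakayama[OF pw_ideal zeroideal] pw_zero by blast
  hence "a [^] (r + n) = \<zero>" using pow_in_ideal_pow[OF L_ideal a, of "r + n"] by blast
  hence "\<one> = \<zero>" using a_pow_cancel[of \<one> "r + n"] a_carrier by simp
  thus False using one_notin_m ideal_zero_closed[OF m_ideal] by simp
qed

lemma inj_at_0: "inj_at 0"
  unfolding inj_at_def
proof (intro ballI impI)
  fix x assume x: "x \<in> pw 0" "a \<otimes> x \<in> mpw (Suc 0)"
  have xc: "x \<in> carrier R" using x by simp
  have "x \<in> m"
  proof (rule ccontr)
    assume "x \<notin> m"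
    then obtain y where y: "y \<in> carrier R" "y \<otimes> x = \<one>" using unit_of_notin_m xc by blast
    have "y \<otimes> (a \<otimes> x) = a \<otimes> (y \<otimes> x)" using y(1) xc a_carrier by (simp add: m_lcomm)
    also have "\<dots> = a" using y a_carrier by simp
    finally have "a \<in> mpw (Suc 0)" using ideal.I_l_closed[OF mpw_ideal x(2) y(1)] by simp
    thus False using power_notin_mpw[of "Suc 0"] a_carrier by simp
  qed
  thus "x \<in> mpw 0" using mpw_0 by simp
qed

lemma inj_at_ge: "r \<le> n \<Longrightarrow> inj_at n"
  unfolding inj_at_def mpw_Suc using a_coset_cancel pw_carrier mpw_carrier by (metis subsetI)

lemma all_inj_iff: "(\<forall>n. inj_at n) \<longleftrightarrow> (\<forall>n. 1 \<le> n \<and> n \<le> r - 1 \<longrightarrow> inj_at n)"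
proof
  assume *: "\<forall>n. 1 \<le> n \<and> n \<le> r - 1 \<longrightarrow> inj_at n"
  show "\<forall>n. inj_at n"
  proof
    fix n
    \<comment> \<open>For \<open>r = 0\<close> the subtraction truncates and the middle range is
      empty.\<close>
    consider "n = 0" | "1 \<le> n \<and> n \<le> r - 1" | "r \<le> n" by linarith
    thus "inj_at n" using * inj_at_0 inj_at_ge by cases auto
  qed
qed blast

lemma colon_condition_iff: "pw n \<inter> colon R (mpw (n + 1)) a = mpw n \<longleftrightarrow> inj_at n"
proof -
  have "mpw n \<subseteq> pw n \<inter> colon R (mpw (n + 1)) a"
    using mpw_mult[OF a_pw] mpw_pw mpw_carrier by (auto simp: colon_def)
  thus ?thesis unfolding inj_at_def colon_def using pw_carrier by auto
qed

lemma coset_condition_iff: "(a <# pw n) \<inter> mpw (n + 1) = a <# mpw n \<longleftrightarrow> inj_at n"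
proof
  have sub: "a <# mpw n \<subseteq> (a <# pw n) \<inter> mpw (n + 1)"
    using mpw_mult[OF a_pw, of _ n] mpw_pw unfolding l_coset_def by auto
  {
    assume eq: "(a <# pw n) \<inter> mpw (n + 1) = a <# mpw n"
    show "inj_at n" unfolding inj_at_def
    proof (intro ballI impI)
      fix x assume x: "x \<in> pw n" "a \<otimes> x \<in> mpw (Suc n)"
      hence "a \<otimes> x \<in> a <# mpw n" unfolding eq[symmetric] by (auto simp: l_coset_iff)
      thus "x \<in> mpw n" using a_coset_cancel[of x "mpw n"] pw_carrier[OF x(1)] mpw_carrier by blast
    qed
  }
  assume inj: "inj_at n"
  have "z \<in> a <# mpw n" if "z \<in> a <# pw n" "z \<in> mpw (n + 1)" for z
    using that inj unfolding inj_at_def l_coset_iff by auto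
  thus "(a <# pw n) \<inter> mpw (n + 1) = a <# mpw n" using sub by blast
qed

lemma inj_at_power:
  assumes "\<forall>n. inj_at n"
  shows "x \<in> pw k \<Longrightarrow> a [^] j \<otimes> x \<in> mpw (k + j) \<Longrightarrow> x \<in> mpw k"
proof (induction j arbitrary: x k)
  case 0 thus ?case using pw_carrier by simp
next
  case (Suc j)
  have xc: "x \<in> carrier R" using Suc.prems pw_carrier by blast
  have "a \<otimes> x \<in> pw (Suc k)" using pw_mult[OF a_pw Suc.prems(1)] by simp
  moreover have "a [^] j \<otimes> (a \<otimes> x) \<in> mpw (Suc k + j)"
    using Suc.prems(2) xc a_carrier by (simp add: m_assoc)
  ultimately have "a \<otimes> x \<in> mpw (Suc k)" using Suc.IH by blast
  thus ?case using assms Suc.prems(1) unfolding inj_at_def by blast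
qed

text \<open>Whatever \<open>a\<close> kills is killed by \<open>a^(r-k)\<close>, so injectivity of
  the power in degree \<open>k\<close> gives that of \<open>a\<close>. Conversely, injectivity of
  \<open>a\<close> is iterated from degree \<open>k\<close> up to \<open>r\<close>.\<close>

lemma colon_power_condition_iff:
  "(\<forall>k. 1 \<le> k \<and> k \<le> r - 1 \<longrightarrow> pw k \<inter> colon R (mpw r) (a [^] (r - k)) = mpw k) \<longleftrightarrow> (\<forall>n. inj_at n)"
  (is "?lhs \<longleftrightarrow> _")
proof
  assume inj: "\<forall>n. inj_at n"
  show ?lhs
  proof (intro allI impI equalityI subsetI)
    fix k x assume k: "1 \<le> k \<and> k \<le> r - 1"
    { assume "x \<in> pw k \<inter> colon R (mpw r) (a [^] (r - k))"
      thus "x \<in> mpw k" using inj_at_power[OF inj, of x k "r - k"] k by (auto simp: colon_def) }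
    assume x: "x \<in> mpw k"
    have "a [^] (r - k) \<otimes> x \<in> mpw (r - k + k)" using mpw_mult[OF pow_in_ideal_pow[OF L_ideal a] x] .
    thus "x \<in> pw k \<inter> colon R (mpw r) (a [^] (r - k))"
      using x k mpw_pw mpw_carrier by (auto simp: colon_def)
  qed
next
  assume *: ?lhs
  show "\<forall>n. inj_at n" unfolding all_inj_iff
  proof (intro allI impI)
    fix k assume k: "1 \<le> k \<and> k \<le> r - 1"
    show "inj_at k" unfolding inj_at_def
    proof (intro ballI impI)
      fix x assume x: "x \<in> pw k" "a \<otimes> x \<in> mpw (Suc k)"
      have xc: "x \<in> carrier R" using x pw_carrier by blast
      have "a [^] (r - Suc k) \<otimes> (a \<otimes> x) \<in> mpw (r - Suc k + Suc k)"
        using mpw_mult[OF pow_in_ideal_pow[OF L_ideal a] x(2)] .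
      moreover have "r - k = Suc (r - Suc k)" using k by auto
      ultimately have "a [^] (r - k) \<otimes> x \<in> mpw r" using k xc a_carrier by (simp add: m_assoc)
      thus "x \<in> mpw k" using * k x(1) xc by (auto simp: colon_def)
    qed
  qed
qed

lemma A_mult_fib:
  "p \<in> rees \<Longrightarrow> A \<otimes>\<^bsub>F\<^esub> fib p = fib (\<lambda>n. if n < Suc 0 then \<zero> else a \<otimes> p (n - Suc 0))"
  by (rule homog_mult_fib[OF a_pw])

lemma shift_rees: "p \<in> rees \<Longrightarrow> (\<lambda>n. if n < Suc 0 then \<zero> else a \<otimes> p (n - Suc 0)) \<in> rees"
  using conv_rees[OF mono_rees[OF a_pw]] conv_mono[OF a_pw] by metis

lemma A_nonzerodivisor_iff: "nonzerodivisor F A \<longleftrightarrow> (\<forall>n. inj_at n)"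
proof
  assume nz: "nonzerodivisor F A"
  show "\<forall>n. inj_at n" unfolding inj_at_def
  proof (intro allI ballI impI)
    fix n x assume x: "x \<in> pw n" "a \<otimes> x \<in> mpw (Suc n)"
    have "A \<otimes>\<^bsub>F\<^esub> homog n x = homog (Suc n) (a \<otimes> x)" using homog_mult[OF a_pw x(1)] by simp
    also have "\<dots> = \<zero>\<^bsub>F\<^esub>" using homog_eq_zero_iff x mpw_pw by blast
    finally have "homog n x = \<zero>\<^bsub>F\<^esub>" using nonzerodivisorD[OF nz homog_closed[OF x(1)]] by blast
    thus "x \<in> mpw n" using homog_eq_zero_iff x by blast
  qed
next
  assume inj: "\<forall>n. inj_at n"
  have "f = \<zero>\<^bsub>F\<^esub>" if f: "f \<in> carrier F" "A \<otimes>\<^bsub>F\<^esub> f = \<zero>\<^bsub>F\<^esub>" for f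
  proof -
    obtain p where p: "p \<in> rees" "f = fib p" using fib_surj f by blast
    have z: "\<forall>n. (if n < Suc 0 then \<zero> else a \<otimes> p (n - Suc 0)) \<in> mpw n"
      using f(2) fib_eq_zero_iff[OF shift_rees[OF p(1)]] A_mult_fib[OF p(1)] p(2) by simp
    have "p n \<in> mpw n" for n
      using z[rule_format, of "Suc n"] inj rees_pw[OF p(1)] by (simp add: inj_at_def)
    thus ?thesis using fib_eq_zero_iff p by blast
  qed
  thus "nonzerodivisor F A" using A_closed by (simp add: nonzerodivisor_def)
qed

section \<open>The degree filtration and the irrelevant ideal\<close>

text \<open>The graded pieces of \<open>F(L)\<close> in degrees at least \<open>N\<close>.\<close>

definition trunc where "trunc N n = (if n < N then mpw n else pw n)"

lemma trunc_hideal: "hideal (trunc N)"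
  unfolding hideal_def trunc_def
proof (intro conjI allI impI)
  fix i j x y assume "x \<in> pw i" "y \<in> (if j < N then mpw j else pw j)"
  thus "x \<otimes> y \<in> (if i + j < N then mpw (i + j) else pw (i + j))"
    using mpw_mult pw_mult mpw_pw by (cases "j < N") auto
qed (use mpw_ideal pw_ideal mpw_subset in auto)

lemma trunc_mult:
  assumes "f \<in> hset (trunc (Suc 0))" "g \<in> hset (trunc N)"
  shows "f \<otimes>\<^bsub>F\<^esub> g \<in> hset (trunc (Suc N))"
proof -
  obtain p q where pq: "p \<in> rees" "\<And>n. p n \<in> trunc (Suc 0) n" "f = fib p"
    "q \<in> rees" "\<And>n. q n \<in> trunc N n" "g = fib q"
    using assms unfolding hset_def by blast
  have "conv p q n \<in> trunc (Suc N) n" for n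
  proof (cases "n < Suc N")
    case True
    have "p i \<otimes> q (n - i) \<in> mpw n" if i: "i \<in> {..n}" for i
    proof (cases "i = 0")
      case True
      have "p 0 \<in> mpw 0" using pq(2)[of 0] unfolding trunc_def by (simp split: if_splits)
      from mpw_mult'[OF this rees_pw[OF pq(4)], of n] show ?thesis using True by simp
    next
      case False
      hence "q (n - i) \<in> mpw (n - i)" using pq(5)[of "n - i"] \<open>n < Suc N\<close> i by (auto simp: trunc_def split: if_splits)
      thus ?thesis using mpw_mult[OF rees_pw[OF pq(1)], of "q (n - i)" "n - i" i] i by simp
    qed
    hence "conv p q n \<in> mpw n" unfolding conv_def by (intro ideal_finsum_closed mpw_ideal) auto
    thus ?thesis using True by (simp add: trunc_def)
  next
    case False
    thus ?thesis using conv_pw[OF pq(1,4)] by (simp add: trunc_def)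
  qed
  thus ?thesis using fib_hset[OF trunc_hideal conv_rees[OF pq(1,4)]] fib_mult[OF pq(1,4)] pq by simp
qed

lemma trunc_all_zero:
  assumes "f \<in> carrier F" "\<And>N. f \<in> hset (trunc N)" shows "f = \<zero>\<^bsub>F\<^esub>"
proof -
  obtain p where p: "p \<in> rees" "f = fib p" using fib_surj assms(1) by blast
  have "p n \<in> mpw n" for n
    using assms(2)[of "Suc n"] fib_hset[OF trunc_hideal p(1), of "Suc n"] p(2)
    by (auto simp: trunc_def dest: spec[of _ n])
  thus ?thesis using fib_eq_zero_iff p by blast
qed

lemma A_trunc: "A \<in> hset (trunc (Suc 0))"
  using homog_hset[OF trunc_hideal a_pw] a_pw by (simp add: trunc_def)

text \<open>Outside this ideal the component of degree zero is given by a unit of \<open>R\<close>.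
  Subtracting the components of positive degree brings \<open>1\<close> into any larger
  ideal.\<close>

lemma irrelevant_maximal: "maximalideal (hset irrelevant) F"
proof (rule maximalidealI)
  interpret F: cring F by (rule F_cring)
  interpret P: primeideal "hset irrelevant" F by (rule hset_prime[OF irrelevant_hprime])
  have hI: "hideal irrelevant" using irrelevant_hprime by (simp add: hprime_def)
  show "ideal (hset irrelevant) F" by (rule P.is_ideal)
  show "carrier F \<noteq> hset irrelevant" by (rule P.I_notcarr)
  fix J assume J: "ideal J F" "hset irrelevant \<subseteq> J" "J \<subseteq> carrier F"
  show "J = hset irrelevant \<or> J = carrier F"
  proof (rule disjCI)
    assume "J \<noteq> carrier F"
    show "J = hset irrelevant"
    proof (rule ccontr)
      assume "J \<noteq> hset irrelevant"
      then obtain f where f: "f \<in> J" "f \<notin> hset irrelevant" using J(2) by blast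
      then obtain p where p: "p \<in> rees" "f = fib p" using J(3) fib_surj by blast
      have upd: "fib (p(0 := \<zero>)) \<in> hset irrelevant"
        using fib_hset[OF hI upd_zero_rees[OF p(1)]] rees_pw[OF p(1)] ideal_zero_closed[OF m_ideal]
        by (auto simp: irrelevant_def)
      have h0: "homog 0 (p 0) \<in> carrier F" by (rule homog_closed[OF rees_pw[OF p(1)]])
      have split: "f = fib (p(0 := \<zero>)) \<oplus>\<^bsub>F\<^esub> homog 0 (p 0)" using fib_split[OF p(1)] p(2) by simp
      have "p 0 \<notin> m"
      proof
        assume "p 0 \<in> m"
        hence "homog 0 (p 0) \<in> hset irrelevant"
          using homog_hset[OF hI rees_pw[OF p(1)], of 0] by (simp add: irrelevant_def)
        thus False using f(2) split F.ideal_add_closed[OF P.is_ideal upd] by simp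
      qed
      then obtain c where c: "c \<in> carrier R" "c \<otimes> p 0 = \<one>" using unit_of_notin_m rees_carrier[OF p(1)] by blast
      have uc: "fib (p(0 := \<zero>)) \<in> carrier F" by (rule fib_closed[OF upd_zero_rees[OF p(1)]])
      have "homog 0 (p 0) = f \<ominus>\<^bsub>F\<^esub> fib (p(0 := \<zero>))" unfolding split using uc h0 by (simp add: F.a_ac a_minus_def F.r_neg F.r_neg1 F.r_neg2)
      hence "homog 0 (p 0) \<in> J" using F.ideal_minus_closed[OF J(1) f(1)] upd J(2) by auto
      hence "homog 0 c \<otimes>\<^bsub>F\<^esub> homog 0 (p 0) \<in> J" using ideal.I_l_closed[OF J(1)] homog_closed[of c 0] c by simp
      moreover have "homog 0 c \<otimes>\<^bsub>F\<^esub> homog 0 (p 0) = \<one>\<^bsub>F\<^esub>"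
        using homog_mult[of c 0 "p 0" 0] c rees_carrier[OF p(1)] fib_one by simp
      ultimately have "J = carrier F" using ideal.one_imp_carrier[OF J(1)] by simp
      thus False using \<open>J \<noteq> carrier F\<close> by simp
    qed
  qed
qed

text \<open>No power of the class of \<open>a\<close> vanishes, so some homogeneous prime avoids all
  of them; missing \<open>a\<close>, it lies strictly below.\<close>

lemma irrelevant_height: "1 \<le> height F (hset irrelevant)"
proof -
  \<comment> \<open>\<open>mpw\<close> encodes the zero ideal of the fiber cone.\<close>
  have hM: "hideal mpw" unfolding hideal_def using mpw_ideal mpw_subset mpw_mult by auto
  have "\<exists>Q. hprime Q \<and> (\<forall>n. mpw n \<subseteq> Q n \<and> Q n \<inter> {a [^] n} = {})"
    by (rule exists_hprime[OF hM])
      (use power_notin_mpw pow_in_ideal_pow[OF L_ideal a] a_carrier in \<open>auto simp: nat_pow_mult\<close>)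
  then obtain Q where Q: "hprime Q" "\<And>n. a [^] n \<notin> Q n" by blast
  have "hset Q \<subset> hset irrelevant"
  proof (rule hset_mono)
    show "hideal Q" "hideal irrelevant" using Q irrelevant_hprime by (auto simp: hprime_def)
    show "Q n \<subseteq> irrelevant n" for n by (rule hprime_subset_irrelevant[OF Q(1)])
    show "a \<in> irrelevant (Suc 0)" using a_pw by (simp add: irrelevant_def)
    show "a \<notin> Q (Suc 0)" using Q(2)[of "Suc 0"] a_carrier by simp
  qed
  thus ?thesis using one_le_height hset_prime Q(1) irrelevant_hprime by blast
qed

lemma irrelevant_trunc: "hset irrelevant = hset (trunc (Suc 0))"
proof -
  have "irrelevant = trunc (Suc 0)" using mpw_0 by (auto simp: irrelevant_def trunc_def fun_eq_iff)
  thus ?thesis by simp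
qed

text \<open>\<open>x\<close> may be inhomogeneous, but \<open>x^(r+1)\<close> has components in
  degrees above \<open>r\<close> only, where all elements are multiples of \<open>a\<close>. So it
  kills every \<open>z\<close> that \<open>a\<close> kills, and cancelling \<open>x\<close> gives
  \<open>z = 0\<close>.\<close>

lemma nonzerodivisor_imp_inj:
  assumes x: "x \<in> hset irrelevant" "nonzerodivisor F x"
  shows "inj_at k"
  unfolding inj_at_def
proof (intro ballI impI, rule ccontr)
  interpret F: cring F by (rule F_cring)
  fix z assume z: "z \<in> pw k" "a \<otimes> z \<in> mpw (Suc k)" "z \<notin> mpw k"
  have xc: "x \<in> carrier F" using x by (simp add: nonzerodivisor_def)
  have one: "\<one>\<^bsub>F\<^esub> \<in> hset (trunc 0)"
    using homog_hset[OF trunc_hideal, of \<one> 0 0] fib_one by (simp add: trunc_def)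
  have pow: "x [^]\<^bsub>F\<^esub> N \<in> hset (trunc N)" for N :: nat
  proof (induction N)
    case (Suc N)
    have "x \<otimes>\<^bsub>F\<^esub> x [^]\<^bsub>F\<^esub> N \<in> hset (trunc (Suc N))"
      using trunc_mult[OF _ Suc] x(1) irrelevant_trunc by simp
    thus ?case using xc by (simp add: F.m_comm)
  qed (use one in simp)
  obtain p where p: "p \<in> rees" "\<And>n. p n \<in> trunc (Suc r) n" "x [^]\<^bsub>F\<^esub> (Suc r) = fib p"
    using pow[of "Suc r"] unfolding hset_def by blast
  have "homog k z \<otimes>\<^bsub>F\<^esub> fib p = \<zero>\<^bsub>F\<^esub>"
  proof -
    have rc: "(\<lambda>n. if n < k then \<zero> else z \<otimes> p (n - k)) \<in> rees"
      using conv_rees[OF mono_rees[OF z(1)] p(1)] conv_mono[OF z(1) p(1)] by metis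
    have "z \<otimes> p j \<in> mpw (k + j)" for j
    proof (cases "j < Suc r")
      case True
      thus ?thesis using p(2)[of j] mpw_mult[OF z(1)] by (simp add: trunc_def)
    next
      case False
      then obtain i where i: "j = Suc i" "r \<le> i" by (cases j) auto
      hence "p j \<in> a <# pw i" using rees_pw[OF p(1), of j] pw_Suc[OF i(2)] by simp
      then obtain v where v: "v \<in> pw i" "p j = a \<otimes> v" by (auto simp: l_coset_iff)
      have "v \<otimes> (a \<otimes> z) \<in> mpw (i + Suc k)" by (rule mpw_mult[OF v(1) z(2)])
      moreover have "z \<otimes> p j = v \<otimes> (a \<otimes> z)" using v pw_carrier[OF z(1)] pw_carrier[OF v(1)] a_carrier by (simp add: m_ac)
      ultimately show ?thesis using i by (simp add: add.commute)
    qed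
    hence "(if n < k then \<zero> else z \<otimes> p (n - k)) \<in> mpw n" for n
      using ideal_zero_closed[OF mpw_ideal] by (cases "n < k") (auto, metis le_add_diff_inverse not_le)
    thus ?thesis using homog_mult_fib[OF z(1) p(1)] fib_eq_zero_iff[OF rc] by simp
  qed
  hence zero: "x [^]\<^bsub>F\<^esub> (Suc r) \<otimes>\<^bsub>F\<^esub> homog k z = \<zero>\<^bsub>F\<^esub>"
    unfolding p(3) using F.m_comm homog_closed[OF z(1)] fib_closed[OF p(1)] by simp
  have "x [^]\<^bsub>F\<^esub> N \<otimes>\<^bsub>F\<^esub> homog k z = \<zero>\<^bsub>F\<^esub> \<Longrightarrow> homog k z = \<zero>\<^bsub>F\<^esub>" for N :: nat
  proof (induction N)
    case (Suc N)
    have "x \<otimes>\<^bsub>F\<^esub> (x [^]\<^bsub>F\<^esub> N \<otimes>\<^bsub>F\<^esub> homog k z) = \<zero>\<^bsub>F\<^esub>"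
      using Suc.prems xc homog_closed[OF z(1)] by (simp add: F.m_ac)
    hence "x [^]\<^bsub>F\<^esub> N \<otimes>\<^bsub>F\<^esub> homog k z = \<zero>\<^bsub>F\<^esub>"
      by (rule nonzerodivisorD[OF x(2), rotated]) (use xc homog_closed[OF z(1)] in simp)
    thus ?case by (rule Suc.IH)
  qed (use homog_closed[OF z(1)] in simp)
  thus False using zero homog_eq_zero_iff z by blast
qed

text \<open>Positive height makes the depth positive, and the first member of a regular sequence is
  a non-zero-divisor.\<close>

lemma cohen_macaulay_imp_inj:
  assumes "cohen_macaulay F" shows "inj_at k"
proof -
  interpret F: cring F by (rule F_cring)
  have "depth F (hset irrelevant) = height F (hset irrelevant)"
    using assms irrelevant_maximal by (simp add: cohen_macaulay_def)
  hence d: "1 \<le> depth F (hset irrelevant)" using irrelevant_height by simp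
  have "\<exists>xs. set xs \<subseteq> hset irrelevant \<and> regular_sequence F xs \<and> xs \<noteq> []"
  proof (rule ccontr)
    assume *: "\<not> ?thesis"
    have "depth F (hset irrelevant) \<le> 0" unfolding depth_def
      by (rule Sup_least) (use * in \<open>auto simp: zero_enat_def\<close>)
    thus False using d by simp
  qed
  then obtain x xs where xs: "set (x # xs) \<subseteq> hset irrelevant" "regular_sequence F (x # xs)"
    by (metis neq_Nil_conv)
  have "x \<in> carrier F" using xs(2) by (simp add: regular_sequence_def)
  moreover have "y = \<zero>\<^bsub>F\<^esub>" if "y \<in> carrier F" "x \<otimes>\<^bsub>F\<^esub> y = \<zero>\<^bsub>F\<^esub>" for y
    using xs(2) that unfolding regular_sequence_def by (force simp: F.Idl_empty)
  ultimately have "nonzerodivisor F x" by (simp add: nonzerodivisor_def)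
  thus ?thesis using nonzerodivisor_imp_inj[of x k] xs(1) by simp
qed

text \<open>If \<open>A\<close> is not in \<open>P\<close>, then \<open>1 = p + c A\<close> with
  \<open>p\<close> in \<open>P\<close>. An element with \<open>p z = 0\<close> satisfies
  \<open>z = c A z\<close>, so it climbs the degree filtration indefinitely and must be
  zero.\<close>

lemma maximal_contains_nonzerodivisor:
  assumes inj: "\<forall>n. inj_at n" and P: "maximalideal P F"
  shows "\<exists>x\<in>P. nonzerodivisor F x"
proof (cases "A \<in> P")
  case True thus ?thesis using A_nonzerodivisor_iff inj by blast
next
  case False
  interpret F: cring F by (rule F_cring)
  interpret P: maximalideal P F by fact
  note PI = F.cgenideal_ideal[OF A_closed]
  have I: "ideal (P <+>\<^bsub>F\<^esub> PIdl\<^bsub>F\<^esub> A) F" using F.add_ideals[OF P.is_ideal PI] .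
  have "A \<in> P <+>\<^bsub>F\<^esub> PIdl\<^bsub>F\<^esub> A"
    using F.set_add_upper(2)[OF P.is_ideal PI] F.cgenideal_self[OF A_closed] by blast
  hence "P <+>\<^bsub>F\<^esub> PIdl\<^bsub>F\<^esub> A = carrier F"
    using P.I_maximal[OF I F.set_add_upper(1)[OF P.is_ideal PI] F.ideal_subset_carrier[OF I]] False by blast
  hence "\<one>\<^bsub>F\<^esub> \<in> P <+>\<^bsub>F\<^esub> PIdl\<^bsub>F\<^esub> A" by simp
  then obtain p g where "p \<in> P" "g \<in> PIdl\<^bsub>F\<^esub> A" "\<one>\<^bsub>F\<^esub> = p \<oplus>\<^bsub>F\<^esub> g"
    unfolding F.set_add_iff by blast
  then obtain c where c: "p \<in> P" "c \<in> carrier F" "\<one>\<^bsub>F\<^esub> = p \<oplus>\<^bsub>F\<^esub> c \<otimes>\<^bsub>F\<^esub> A"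
    unfolding cgenideal_def by blast
  have pc: "p \<in> carrier F" using c P.Icarr by blast
  have "z = \<zero>\<^bsub>F\<^esub>" if z: "z \<in> carrier F" "p \<otimes>\<^bsub>F\<^esub> z = \<zero>\<^bsub>F\<^esub>" for z
  proof -
    have "z = (p \<oplus>\<^bsub>F\<^esub> c \<otimes>\<^bsub>F\<^esub> A) \<otimes>\<^bsub>F\<^esub> z" unfolding c(3)[symmetric] using z by simp
    also have "\<dots> = p \<otimes>\<^bsub>F\<^esub> z \<oplus>\<^bsub>F\<^esub> c \<otimes>\<^bsub>F\<^esub> (A \<otimes>\<^bsub>F\<^esub> z)"
      using z pc c(2) A_closed by (simp add: F.l_distr F.m_assoc)
    finally have eq: "z = c \<otimes>\<^bsub>F\<^esub> (A \<otimes>\<^bsub>F\<^esub> z)" using z c(2) A_closed by simp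
    have "z \<in> hset (trunc N)" for N
    proof (induction N)
      case 0
      obtain q where "q \<in> rees" "z = fib q" using fib_surj z(1) by blast
      moreover from this(1) have "\<forall>n. q n \<in> trunc 0 n" using rees_pw by (simp add: trunc_def)
      ultimately show ?case using fib_hset[OF trunc_hideal] by blast
    next
      case (Suc N)
      show ?case
        using ideal.I_l_closed[OF hset_ideal[OF trunc_hideal] trunc_mult[OF A_trunc Suc] c(2)] eq by simp
    qed
    thus ?thesis using trunc_all_zero z(1) by blast
  qed
  hence "nonzerodivisor F p" using pc by (simp add: nonzerodivisor_def)
  thus ?thesis using c(1) by blast
qed

section \<open>Leading ideals, as in Hilbert's basis theorem, and the noetherian property\<close>

definition lead where
  "lead G n = {x \<in> pw n. \<exists>p\<in>rees. fib p \<in> G \<and> p n = x \<and> (\<forall>j>n. p j = \<zero>)}"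

lemma smult_rees: "p \<in> rees \<Longrightarrow> c \<in> carrier R \<Longrightarrow> (\<lambda>n. c \<otimes> p n) \<in> rees"
  using ideal.I_l_closed[OF pw_ideal] unfolding rees_def by (auto, metis r_null)

lemma homog0_mult: "p \<in> rees \<Longrightarrow> c \<in> carrier R \<Longrightarrow> homog 0 c \<otimes>\<^bsub>F\<^esub> fib p = fib (\<lambda>n. c \<otimes> p n)"
  using homog_mult_fib[of c 0 p] by simp

lemma lead_ideal: assumes G: "ideal G F" shows "ideal (lead G n) R"
proof (rule idealI[OF ring_axioms])
  interpret F: cring F by (rule F_cring)
  have l: "c \<otimes> x \<in> lead G n" if x: "x \<in> lead G n" and c: "c \<in> carrier R" for x c
  proof -
    obtain p where p: "p \<in> rees" "fib p \<in> G" "p n = x" "\<forall>j>n. p j = \<zero>" using x unfolding lead_def by blast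
    have "fib (\<lambda>n. c \<otimes> p n) \<in> G"
      using ideal.I_l_closed[OF G p(2) homog_closed[of c 0]] homog0_mult[OF p(1) c] c by simp
    thus ?thesis unfolding lead_def using smult_rees[OF p(1) c] p c ideal.I_l_closed[OF pw_ideal rees_pw[OF p(1)] c]
      by (intro CollectI conjI bexI[of _ "\<lambda>n. c \<otimes> p n"]) auto
  qed
  have lc: "lead G n \<subseteq> carrier R" unfolding lead_def using pw_carrier by blast
  show "subgroup (lead G n) (add_monoid R)"
  proof (rule add.subgroupI[OF lc])
    have "\<zero> \<in> lead G n" unfolding lead_def
      using zero_rees F.ideal_zero_closed[OF G] fib_zero pw_zero by (intro CollectI conjI bexI[of _ "\<lambda>n. \<zero>"]) auto
    thus "lead G n \<noteq> {}" by blast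
    fix x assume x: "x \<in> lead G n"
    have "\<ominus> \<one> \<otimes> x \<in> lead G n" using l[OF x] by blast
    moreover have "x \<in> carrier R" using x lc by blast
    ultimately show "\<ominus> x \<in> lead G n" by (simp add: l_minus)
    fix y assume y: "y \<in> lead G n"
    obtain p where p: "p \<in> rees" "fib p \<in> G" "p n = x" "\<forall>j>n. p j = \<zero>" using x unfolding lead_def by blast
    obtain q where q: "q \<in> rees" "fib q \<in> G" "q n = y" "\<forall>j>n. q j = \<zero>" using y unfolding lead_def by blast
    have "fib (\<lambda>n. p n \<oplus> q n) \<in> G" using F.ideal_add_closed[OF G p(2) q(2)] fib_add[OF p(1) q(1)] by simp
    thus "x \<oplus> y \<in> lead G n" unfolding lead_def
      using add_rees[OF p(1) q(1)] p q ideal_add_closed[OF pw_ideal rees_pw[OF p(1)] rees_pw[OF q(1)]]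
      by (intro CollectI conjI bexI[of _ "\<lambda>n. p n \<oplus> q n"]) auto
  qed
  fix x c assume "x \<in> lead G n" "c \<in> carrier R"
  thus "c \<otimes> x \<in> lead G n" "x \<otimes> c \<in> lead G n" using l[of x c] lc m_comm[of x c] by auto
qed

lemma lead_Suc: assumes G: "ideal G F" and x: "x \<in> lead G n" shows "a \<otimes> x \<in> lead G (Suc n)"
proof -
  obtain p where p: "p \<in> rees" "fib p \<in> G" "p n = x" "\<forall>j>n. p j = \<zero>" using x unfolding lead_def by blast
  let ?q = "\<lambda>n. if n < Suc 0 then \<zero> else a \<otimes> p (n - Suc 0)"
  have "fib ?q \<in> G" using ideal.I_l_closed[OF G p(2) A_closed] A_mult_fib[OF p(1)] by simp
  moreover have "?q j = \<zero>" if "j > Suc n" for j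
  proof -
    have "j - Suc 0 > n" using that by auto
    thus ?thesis using p(4) a_carrier by simp
  qed
  ultimately show ?thesis unfolding lead_def
    using shift_rees[OF p(1)] p(3) pw_mult[OF a_pw rees_pw[OF p(1)], of n]
    by (intro CollectI conjI bexI[of _ ?q]) auto
qed

lemma lead_mono: "G \<subseteq> H \<Longrightarrow> lead G n \<subseteq> lead H n"
  unfolding lead_def by blast

text \<open>Subtracting from an element of \<open>H\<close> one of \<open>G\<close> with the same
  top coefficient lowers the degree, so induction on a degree bound applies.\<close>

lemma lead_eq_imp_eq:
  assumes G: "ideal G F" "ideal H F" "G \<subseteq> H" "\<And>n. lead G n = lead H n" shows "G = H"
proof
  interpret F: cring F by (rule F_cring)
  have "\<forall>p\<in>rees. (\<forall>j\<ge>N. p j = \<zero>) \<longrightarrow> fib p \<in> H \<longrightarrow> fib p \<in> G" for N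
  proof (induction N)
    case 0
    have "p = (\<lambda>n. \<zero>)" if "\<forall>k\<ge>0. p k = \<zero>" for p :: "nat \<Rightarrow> 'a" using that by auto
    thus ?case using F.ideal_zero_closed[OF G(1)] fib_zero by (metis (full_types))
  next
    case (Suc N)
    show ?case
    proof (intro ballI impI)
      fix p assume p: "p \<in> rees" "\<forall>j\<ge>Suc N. p j = \<zero>" "fib p \<in> H"
      have "\<forall>j>N. p j = \<zero>" using p(2) by simp
      hence "p N \<in> lead H N" unfolding lead_def using p(1,3) rees_pw[OF p(1)] by blast
      hence "p N \<in> lead G N" using G(4) by simp
      then obtain q where q: "q \<in> rees" "fib q \<in> G" "q N = p N" "\<forall>j>N. q j = \<zero>"
        unfolding lead_def by blast
      let ?d = "\<lambda>n. p n \<oplus> \<ominus> q n"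
      have d: "?d \<in> rees" using add_rees[OF p(1) minus_rees[OF q(1)]] .
      have eq: "fib p = fib ?d \<oplus>\<^bsub>F\<^esub> fib q"
      proof -
        have "(\<lambda>n. ?d n \<oplus> q n) = p" using rees_carrier[OF p(1)] rees_carrier[OF q(1)]
          by (auto simp: a_assoc l_neg fun_eq_iff)
        thus ?thesis using fib_add[OF d q(1)] by simp
      qed
      have "fib ?d = fib p \<ominus>\<^bsub>F\<^esub> fib q"
        unfolding eq using fib_closed[OF d] fib_closed[OF q(1)]
        by (simp add: a_minus_def F.a_assoc F.r_neg)
      hence dH: "fib ?d \<in> H" using F.ideal_minus_closed[OF G(2) p(3)] q(2) G(3) by auto
      have dz: "?d j = \<zero>" if "N \<le> j" for j
        using p(2) q(3,4) rees_carrier[OF p(1), of N] that by (cases "j = N") (auto simp: r_neg)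
      have "fib ?d \<in> G" by (rule Suc.IH[rule_format, OF d dz dH])
      thus "fib p \<in> G" using eq F.ideal_add_closed[OF G(1) _ q(2)] by simp
    qed
  qed
  hence all: "fib p \<in> G" if "p \<in> rees" "\<forall>j\<ge>N. p j = \<zero>" "fib p \<in> H" for p N using that by blast
  show "H \<subseteq> G"
  proof
    fix f assume f: "f \<in> H"
    then obtain p where p: "p \<in> rees" "f = fib p" using fib_surj F.ideal_subset_carrier[OF G(2)] by blast
    then obtain N where "\<forall>j>N. p j = \<zero>" unfolding rees_def by blast
    hence "\<forall>j\<ge>Suc N. p j = \<zero>" by auto
    thus "f \<in> G" using all p f by blast
  qed
qed (rule G(3))

text \<open>Beyond degree \<open>r\<close> the leading ideals of an ideal \<open>G\<close> are pulled back to the single ideal \<open>L\<^sup>r\<close>,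
  where they form an ascending sequence.\<close>

definition lead_tail where "lead_tail G n = pw r \<inter> colon R (lead G (r + n)) (a [^] n)"

lemma lead_tail_ideal: "ideal G F \<Longrightarrow> ideal (lead_tail G n) R"
  unfolding lead_tail_def using colon_ideal lead_ideal a_carrier pw_ideal i_intersect by simp

lemma lead_tail_mono:
  assumes "ideal H F" "G \<subseteq> H" shows "lead_tail G n \<subseteq> lead_tail H (n + k)"
proof -
  have step: "lead_tail H n \<subseteq> lead_tail H (Suc n)" for n
  proof
    fix x assume x: "x \<in> lead_tail H n"
    hence xc: "x \<in> carrier R" by (simp add: lead_tail_def colon_def)
    have "a \<otimes> (a [^] n \<otimes> x) \<in> lead H (Suc (r + n))"
      by (rule lead_Suc[OF assms(1)]) (use x in \<open>simp add: lead_tail_def colon_def\<close>)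
    thus "x \<in> lead_tail H (Suc n)" using x xc a_carrier by (simp add: lead_tail_def colon_def m_ac)
  qed
  have "lead_tail H n \<subseteq> lead_tail H (n + k)" by (induction k) (use step in \<open>auto\<close>)
  moreover have "lead_tail G n \<subseteq> lead_tail H n"
    using lead_mono[OF assms(2)] by (auto simp: lead_tail_def colon_def)
  ultimately show ?thesis by blast
qed

text \<open>A chain of ideals is shown to have a largest member: high degrees are governed by one
  maximal \<open>lead_tail\<close>, the finitely many low degrees are stabilized one after another,
  and equal leading ideals mean equal ideals.\<close>

lemma F_noetherian: "noetherian_ring F"
proof -
  interpret F: cring F by (rule F_cring)
  show ?thesis
  proof (rule F.trivial_ideal_chain_imp_noetherian)
    fix C assume C: "C \<noteq> {}" "subset.chain {I. ideal I F} C"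
    have CI: "ideal G F" if "G \<in> C" for G using C(2) that by (auto simp: pred_on.chain_def)
    have lin: "G \<subseteq> H \<or> H \<subseteq> G" if "G \<in> C" "H \<in> C" for G H
      using C(2) that by (auto simp: pred_on.chain_def)
    obtain G0 where G0: "G0 \<in> C" using C(1) by blast
    let ?S = "\<lambda>V. \<exists>G\<in>C. \<exists>n. V = lead_tail G n"
    have S0: "?S (lead_tail G0 0)" using G0 by blast
    have Si: "ideal V R" if "?S V" for V using that lead_tail_ideal CI by blast
    obtain M where M: "?S M" "\<And>V. ?S V \<Longrightarrow> M \<subseteq> V \<Longrightarrow> V = M"
      using exists_maximal_element[of ?S, OF S0 Si] by auto
    then obtain G1 n1 where G1: "G1 \<in> C" "M = lead_tail G1 n1" by blast
    \<comment> \<open>Above \<open>G1\<close> all tails from \<open>n1\<close> on coincide with the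
      maximal one.\<close>
    have tail: "lead_tail G (n1 + k) = M" if "G \<in> C" "G1 \<subseteq> G" for G k
    proof (rule M(2))
      show "\<exists>H\<in>C. \<exists>n. lead_tail G (n1 + k) = lead_tail H n" using that(1) by blast
      show "M \<subseteq> lead_tail G (n1 + k)" unfolding G1(2) by (rule lead_tail_mono[OF CI[OF that(1)] that(2)])
    qed
    \<comment> \<open>The leading ideals below degree \<open>N\<close> become constant one by one;
      linearity of the chain supplies a member above the choices made so far.\<close>
    have "\<exists>G\<in>C. G1 \<subseteq> G \<and> (\<forall>j<N. \<forall>H\<in>C. G \<subseteq> H \<longrightarrow> lead H j = lead G j)" for N
    proof (induction N)
      case 0 thus ?case using G1(1) by blast
    next
      case (Suc N)
      then obtain G where G: "G \<in> C" "G1 \<subseteq> G" "\<forall>j<N. \<forall>H\<in>C. G \<subseteq> H \<longrightarrow> lead H j = lead G j"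
        by auto
      let ?T = "\<lambda>V. \<exists>H\<in>C. V = lead H N"
      have T0: "?T (lead G N)" using G(1) by blast
      have Ti: "ideal V R" if "?T V" for V using that lead_ideal CI by blast
      obtain V where V: "?T V" "\<And>W. ?T W \<Longrightarrow> V \<subseteq> W \<Longrightarrow> W = V"
        using exists_maximal_element[of ?T, OF T0 Ti] by auto
      then obtain H where H: "H \<in> C" "V = lead H N" by blast
      obtain K where K: "K \<in> C" "G \<subseteq> K" "H \<subseteq> K" using lin[OF G(1) H(1)] G(1) H(1) by blast
      have eqV: "lead W N = V" if "W \<in> C" "K \<subseteq> W" for W
      proof (rule V(2))
        show "\<exists>H\<in>C. lead W N = lead H N" using that(1) by blast
        show "V \<subseteq> lead W N" unfolding H(2) using K(3) that(2) by (intro lead_mono) blast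
      qed
      have "lead W j = lead K j" if "j < Suc N" "W \<in> C" "K \<subseteq> W" for j W
      proof (cases "j = N")
        case True thus ?thesis using eqV[OF that(2,3)] eqV[OF K(1) subset_refl] by simp
      next
        case False
        hence "j < N" using that by simp
        thus ?thesis using G(3)[rule_format, of j W] G(3)[rule_format, of j K] that K by auto
      qed
      hence "\<forall>j<Suc N. \<forall>W\<in>C. K \<subseteq> W \<longrightarrow> lead W j = lead K j" by simp
      moreover have "G1 \<subseteq> K" using K(2) G(2) by simp
      ultimately show ?case using K(1) by blast
    qed
    from this[of "r + n1"] obtain G where G: "G \<in> C" "G1 \<subseteq> G"
      "\<forall>j<r + n1. \<forall>H\<in>C. G \<subseteq> H \<longrightarrow> lead H j = lead G j" by auto
    have "H \<subseteq> G" if H: "H \<in> C" for H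
    proof (cases "G \<subseteq> H")
      case True
      have "lead G n = lead H n" for n
      proof (cases "n < r + n1")
        case False
        define k where "k = n - r"
        have n: "n = r + k" "k = n1 + (k - n1)" using False by (auto simp: k_def)
        have t: "lead_tail H k = lead_tail G k"
          using tail[OF G(1,2), of "k - n1"] tail[OF H, of "k - n1"] True G(2) n(2) by auto
        \<comment> \<open>An element of \<open>L^(r+k)\<close> is \<open>a^k w\<close> with
          \<open>w\<close> in \<open>L^r\<close>, so the tails decide whether it is leading.\<close>
        have "lead H n \<subseteq> lead G n"
        proof
          fix x assume x: "x \<in> lead H n"
          hence "x \<in> pw (r + k)" by (simp add: lead_def n(1)[symmetric])
          then obtain w where w: "w \<in> pw r" "x = a [^] k \<otimes> w" using pw_add_power[of r x k] by blast
          hence "w \<in> lead_tail H k" using x n(1) pw_carrier[of w r] by (simp add: lead_tail_def colon_def)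
          hence "w \<in> lead_tail G k" using t by simp
          thus "x \<in> lead G n" using w n(1) by (simp add: lead_tail_def colon_def)
        qed
        thus ?thesis using lead_mono[OF True, of n] by blast
      qed (use G(3) H True in auto)
      hence "G = H" by (rule lead_eq_imp_eq[OF CI[OF G(1)] CI[OF H] True])
      thus ?thesis by simp
    qed (use lin[OF G(1) H] in auto)
    hence "\<Union>C = G" using G(1) by blast
    thus "\<Union>C \<in> C" using G(1) by simp
  qed
qed

theorem cohen_macaulay_iff:
  assumes "krull_dim F = 1" shows "cohen_macaulay F \<longleftrightarrow> (\<forall>n. inj_at n)"
proof
  assume "\<forall>n. inj_at n"
  thus "cohen_macaulay F"
    using cring.cohen_macaulay_dim_1I[OF F_cring F_noetherian assms] maximal_contains_nonzerodivisor by blast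
qed (use cohen_macaulay_imp_inj in blast)

end

section \<open>Lengths of the graded pieces\<close>

lemma enat_add_left_eq_self_iff: "enat k + x = enat k \<longleftrightarrow> x = 0"
  by (cases x) (auto simp: zero_enat_def)

context fiber_ring
begin

abbreviation mu :: "nat \<Rightarrow> nat" where "mu n \<equiv> mu_pow R L (int n)"

lemma ideal_length_m: "ideal_length R m (carrier R) = 1"
proof -
  have "ideal_length R m (carrier R) \<le> 1"
    using maximalideal.I_maximal[OF maximal] ideal_subset_carrier[OF m_ideal]
    by (intro ideal_length_le_1 m_ideal) auto
  moreover have "ideal_length R m (carrier R) \<noteq> 0"
    using ideal_length_eq_0_iff[OF m_ideal oneideal ideal_subset_carrier[OF m_ideal]] one_notin_m by auto
  ultimately show ?thesis by (cases "ideal_length R m (carrier R)") (auto simp: one_enat_def zero_enat_def)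
qed

text \<open>The convention in degree zero agrees with the length of the residue field.\<close>

lemma ideal_length_mu: "ideal_length R (mpw n) (pw n) = enat (mu n)"
proof (cases "n = 0")
  case True
  thus ?thesis using ideal_length_m mpw_0 by (simp add: mu_pow_def one_enat_def)
next
  case False
  thus ?thesis using ideal_length_min_gens[OF pw_ideal] by (simp add: mu_pow_def)
qed

end

section \<open>Kernel and cokernel of multiplication by the generator\<close>

context principal_reduction
begin

abbreviation cok where "cok \<equiv> gen_part (PIdl a)"

text \<open>The length of the kernel of the multiplication by \<open>a\<close> from \<open>L\<^sup>n/mL\<^sup>n\<close> to \<open>L\<^sup>n\<^sup>+\<^sup>1/mL\<^sup>n\<^sup>+\<^sup>1\<close>;
  \<open>L\<^sup>n/cok n\<close> is the cokernel into degree \<open>n\<close>.\<close>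

definition defect where "defect n = ideal_length R (a <# mpw n) ((a <# pw n) \<inter> mpw (Suc n))"

lemma cok_hideal: "hideal cok"
  using hideal_gen_part cgenideal_ideal[OF a_carrier] cgenideal_minimal[OF L_ideal a] by blast

lemma cok_Suc: "cok (Suc n) = mpw (Suc n) <+> (a <# pw n)"
  unfolding gen_part_def using PIdl_prod[OF pw_ideal a_carrier] by simp

lemma cok_0: "cok 0 = m"
proof -
  have "m <+> {\<zero>} = m"
    using set_add_absorb[OF zeroideal m_ideal] set_add_comm[of m "{\<zero>}"] ideal_subset_carrier[OF m_ideal]
      ideal_zero_closed[OF m_ideal] by simp
  thus ?thesis unfolding gen_part_def using mpw_0 by simp
qed

lemma a_coset_strict:
  assumes "V \<subset> Y" "Y \<subseteq> carrier R" shows "a <# V \<subset> a <# Y"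
proof -
  obtain y where y: "y \<in> Y" "y \<notin> V" using assms(1) by blast
  hence "a \<otimes> y \<notin> a <# V" using a_coset_cancel[of y V] assms by auto
  moreover have "a \<otimes> y \<in> a <# Y" unfolding l_coset_iff using y by blast
  ultimately show ?thesis using l_coset_mono[of V Y a] assms(1) by auto
qed

lemma a_cosets: "ideal (a <# pw n) R" "ideal (a <# mpw n) R" "a <# mpw n \<subseteq> (a <# pw n) \<inter> mpw (Suc n)"
proof -
  show "ideal (a <# pw n) R" "ideal (a <# mpw n) R"
    using l_coset_ideal pw_ideal mpw_ideal a_carrier by auto
  show "a <# mpw n \<subseteq> (a <# pw n) \<inter> mpw (Suc n)"
    using mpw_mult[OF a_pw, of _ n] l_coset_mono[OF mpw_subset] unfolding l_coset_def by auto
qed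

text \<open>Multiplication by the non-zero-divisor \<open>a\<close> is an isomorphism from
  \<open>L^n\<close> to \<open>aL^n\<close>; each direction gives one inequality.\<close>

lemma ideal_length_a_coset: "ideal_length R (a <# mpw n) (a <# pw n) = enat (mu n)"
proof (rule antisym)
  show "ideal_length R (a <# mpw n) (a <# pw n) \<le> enat (mu n)"
    using ideal_length_l_coset_le[OF mpw_ideal pw_ideal mpw_subset a_carrier] ideal_length_mu by metis
  have "ideal_length R (mpw n) (pw n) \<le> ideal_length R (a <# mpw n) (a <# pw n)"
  proof (rule ideal_length_order_embedding[where f = "\<lambda>Z. a <# Z"])
    fix V Y assume *: "V \<subset> Y" "Y \<subseteq> pw n"
    show "a <# V \<subset> a <# Y"
      by (rule a_coset_strict[OF *(1)]) (use * ideal_subset_carrier[OF pw_ideal] in blast)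
  qed (use mpw_ideal pw_ideal mpw_subset a_cosets l_coset_ideal[OF _ a_carrier] l_coset_mono in auto)
  thus "enat (mu n) \<le> ideal_length R (a <# mpw n) (a <# pw n)" using ideal_length_mu by metis
qed

text \<open>Rank and nullity in one degree, in additive form: lengths are extended naturals, so
  nothing may be subtracted before finiteness is known.\<close>

lemma cok_length:
  "ideal_length R (cok (Suc n)) (pw (Suc n)) + enat (mu n) = enat (mu (Suc n)) + defect n"
proof -
  have I: "ideal ((a <# pw n) \<inter> mpw (Suc n)) R" using i_intersect[OF a_cosets(1) mpw_ideal] .
  note c = hidealD(1,2,3)[OF cok_hideal, of "Suc n"]
  \<comment> \<open>The kernel sits below the image; the image is then moved into degree
    \<open>Suc n\<close> by the second isomorphism theorem.\<close>
  have "enat (mu n) = defect n + ideal_length R ((a <# pw n) \<inter> mpw (Suc n)) (a <# pw n)"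
    unfolding ideal_length_a_coset[symmetric] defect_def
    by (rule ideal_length_add[OF a_cosets(2) I a_cosets(1,3)]) simp
  also have "ideal_length R ((a <# pw n) \<inter> mpw (Suc n)) (a <# pw n) = ideal_length R (mpw (Suc n)) (cok (Suc n))"
    unfolding cok_Suc using ideal_length_inter_sum[OF mpw_ideal a_cosets(1), of "Suc n" n] by (simp add: Int_commute)
  finally have 1: "enat (mu n) = defect n + ideal_length R (mpw (Suc n)) (cok (Suc n))" .
  have 2: "enat (mu (Suc n)) = ideal_length R (mpw (Suc n)) (cok (Suc n)) + ideal_length R (cok (Suc n)) (pw (Suc n))"
    unfolding ideal_length_mu[symmetric] by (rule ideal_length_add[OF mpw_ideal c(1) pw_ideal c(2,3)])
  show ?thesis unfolding 1 2 by (simp add: ac_simps)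
qed

lemma defect_eq_0_iff: "defect n = 0 \<longleftrightarrow> inj_at n"
  unfolding defect_def coset_condition_iff[symmetric]
  using ideal_length_eq_0_iff[OF a_cosets(2) i_intersect[OF a_cosets(1) mpw_ideal] a_cosets(3)]
  by auto

lemma all_inj_below: "(\<forall>n. inj_at n) \<longleftrightarrow> (\<forall>n<r. inj_at n)"
  using all_inj_iff inj_at_ge not_less by metis

lemma length_condition_iff:
  "(\<forall>n. 1 \<le> n \<and> n \<le> r \<longrightarrow>
      ereal_of_enat (module_length R (quot_module R (pw n) (mpw n <+> (a <# pw (n - 1)))))
      = ereal (real (mu_pow R L (int n)) - real (mu_pow R L (int n - 1)))) \<longleftrightarrow> (\<forall>n. inj_at n)"
proof -
  have *: "ereal_of_enat (module_length R (quot_module R (pw (Suc n)) (mpw (Suc n) <+> (a <# pw n))))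
      = ereal (real (mu (Suc n)) - real (mu_pow R L (int (Suc n) - 1))) \<longleftrightarrow> inj_at n" for n
  proof -
    have mu: "mu_pow R L (int (Suc n) - 1) = mu n" by simp
    note c = hidealD(1,3)[OF cok_hideal, of "Suc n"]
    have ml: "module_length R (quot_module R (pw (Suc n)) (mpw (Suc n) <+> (a <# pw n)))
      = ideal_length R (cok (Suc n)) (pw (Suc n))"
      unfolding cok_Suc[symmetric] by (rule module_length_quot[OF c(1) pw_ideal c(2)])
    \<comment> \<open>This makes the length finite, so the equation between reals reduces to one
      between natural numbers.\<close>
    have "ideal_length R (cok (Suc n)) (pw (Suc n)) \<le> enat (mu (Suc n))"
      unfolding ideal_length_mu[symmetric]
      using ideal_length_add[OF mpw_ideal c(1) pw_ideal hidealD(2)[OF cok_hideal] c(2)] by simp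
    then obtain l where l: "ideal_length R (cok (Suc n)) (pw (Suc n)) = enat l"
      by (cases "ideal_length R (cok (Suc n)) (pw (Suc n))") auto
    then obtain d where d: "defect n = enat d" "l + mu n = mu (Suc n) + d"
      using cok_length[of n] by (cases "defect n") auto
    have "ereal (real l) = ereal (real (mu (Suc n)) - real (mu n)) \<longleftrightarrow> d = 0" using d(2) by auto
    thus ?thesis using defect_eq_0_iff[of n] unfolding ml l d(1) mu by (simp add: zero_enat_def)
  qed
  have "(\<forall>n. 1 \<le> n \<and> n \<le> r \<longrightarrow>
      ereal_of_enat (module_length R (quot_module R (pw n) (mpw n <+> (a <# pw (n - 1)))))
      = ereal (real (mu_pow R L (int n)) - real (mu_pow R L (int n - 1)))) \<longleftrightarrow> (\<forall>n<r. inj_at n)"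
  proof (intro iffI allI impI)
    fix n assume L: "\<forall>n. 1 \<le> n \<and> n \<le> r \<longrightarrow>
      ereal_of_enat (module_length R (quot_module R (pw n) (mpw n <+> (a <# pw (n - 1)))))
      = ereal (real (mu_pow R L (int n)) - real (mu_pow R L (int n - 1)))" and n: "n < r"
    show "inj_at n" using L[rule_format, of "Suc n"] n unfolding *[of n, symmetric] diff_Suc_1 by simp
  next
    fix n assume L: "\<forall>n<r. inj_at n" and n: "1 \<le> n \<and> n \<le> r"
    then obtain k where k: "n = Suc k" "k < r" by (cases n) auto
    show "ereal_of_enat (module_length R (quot_module R (pw n) (mpw n <+> (a <# pw (n - 1)))))
      = ereal (real (mu_pow R L (int n)) - real (mu_pow R L (int n - 1)))"
      unfolding k(1) diff_Suc_1 * using L k(2) by blast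
  qed
  thus ?thesis using all_inj_below by simp
qed

lemma fiber_class_eq: "fiber_class R m L a = A"
  unfolding fiber_class_def homog_def fib_def mono_def piece_zero
  using coset_zero[OF mpw_ideal] by (auto simp: fun_eq_iff)

lemma PIdl_A: "PIdl\<^bsub>F\<^esub> A = hset cok"
proof
  interpret F: cring F by (rule F_cring)
  have "a \<otimes> \<one> \<in> cok (Suc 0)"
    using gen_part_mem[OF cgenideal_ideal[OF a_carrier] cgenideal_self[OF a_carrier], of \<one> 0] by simp
  hence "A \<in> hset cok" using homog_hset[OF cok_hideal a_pw] a_carrier by simp
  thus "PIdl\<^bsub>F\<^esub> A \<subseteq> hset cok" using F.cgenideal_minimal[OF hset_ideal[OF cok_hideal]] by blast
  show "hset cok \<subseteq> PIdl\<^bsub>F\<^esub> A"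
  proof
    fix f assume "f \<in> hset cok"
    then obtain p where p: "p \<in> rees" "\<And>n. p n \<in> cok n" "f = fib p" unfolding hset_def by blast
    \<comment> \<open>Coefficients are divided by \<open>a\<close> modulo \<open>mpw\<close>; a zero
      coefficient gets a zero quotient, which keeps the support finite.\<close>
    have "\<exists>y\<in>pw n. p (Suc n) \<ominus> a \<otimes> y \<in> mpw (Suc n) \<and> (p (Suc n) = \<zero> \<longrightarrow> y = \<zero>)" for n
    proof (cases "p (Suc n) = \<zero>")
      case True
      thus ?thesis using pw_zero ideal_zero_closed[OF mpw_ideal, of "Suc n"] a_carrier
        by (intro bexI[of _ \<zero>]) (auto simp: a_minus_def)
    next
      case False
      obtain k y where ky: "k \<in> mpw (Suc n)" "y \<in> pw n" "p (Suc n) = k \<oplus> a \<otimes> y"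
        using p(2)[of "Suc n"] unfolding cok_Suc set_add_iff by (auto simp: Bex_def l_coset_iff)
      have "k \<in> carrier R" "a \<otimes> y \<in> carrier R" using mpw_carrier[OF ky(1)] pw_carrier[OF ky(2)] a_carrier by auto
      hence "p (Suc n) \<ominus> a \<otimes> y = k" unfolding ky(3) by algebra
      hence "p (Suc n) \<ominus> a \<otimes> y \<in> mpw (Suc n)" using ky(1) by simp
      thus ?thesis using ky(2) False by blast
    qed
    then obtain y where y: "\<And>n. y n \<in> pw n" "\<And>n. p (Suc n) \<ominus> a \<otimes> y n \<in> mpw (Suc n)"
      "\<And>n. p (Suc n) = \<zero> \<Longrightarrow> y n = \<zero>" by metis
    obtain N where N: "\<And>j. j > N \<Longrightarrow> p j = \<zero>" using p(1) unfolding rees_def by blast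
    have yr: "y \<in> rees" by (rule reesI[of y N]) (use y N in auto)
    have "f = A \<otimes>\<^bsub>F\<^esub> fib y" unfolding p(3) A_mult_fib[OF yr] fib_eq_iff[OF p(1) shift_rees[OF yr]]
    proof
      fix n
      show "p n \<ominus> (if n < Suc 0 then \<zero> else a \<otimes> y (n - Suc 0)) \<in> mpw n"
      proof (cases n)
        case 0
        thus ?thesis using p(2)[of 0] cok_0 mpw_0 rees_carrier[OF p(1), of 0] by (simp add: a_minus_def)
      qed (use y(2) in simp)
    qed
    hence "f = fib y \<otimes>\<^bsub>F\<^esub> A" using F.m_comm A_closed fib_closed[OF yr] by simp
    thus "f \<in> PIdl\<^bsub>F\<^esub> A" unfolding cgenideal_def using fib_closed[OF yr] by blast
  qed
qed

text \<open>For \<open>W = L\<^sup>n\<close> and \<open>W = cok n\<close> these are consecutive terms of the filtration of \<open>F(L)/a\<^sup>0F(L)\<close> by degree.\<close>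

definition step where "step n W j = (if j < n then cok j else if j = n then W else pw j)"

lemma step_hideal:
  assumes W: "ideal W R" "cok n \<subseteq> W" "W \<subseteq> pw n" shows "hideal (step n W)"
proof -
  note c = hidealD[OF cok_hideal]
  have "x \<otimes> y \<in> step n W (i + j)" if x: "x \<in> pw i" and y: "y \<in> step n W j" for x y i j
  proof -
    have ypw: "y \<in> pw j" using y c(3) W(3) by (auto simp: step_def split: if_splits)
    consider "i = 0" | "j < n" | "0 < i" "n \<le> j" by linarith
    thus ?thesis
    proof cases
      case 1
      thus ?thesis using x y ideal.I_l_closed[OF W(1), of y x] ideal.I_l_closed[OF c(1), of y _ x]
          ideal.I_l_closed[OF pw_ideal, of y j x] by (auto simp: step_def split: if_splits)
    next
      case 2
      hence "x \<otimes> y \<in> cok (i + j)" using c(4)[OF x, of y j] y by (simp add: step_def)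
      moreover have "x \<otimes> y \<in> pw (i + j)" using pw_mult[OF x ypw] .
      ultimately show ?thesis using W(2) by (auto simp: step_def)
    next
      case 3
      thus ?thesis using pw_mult[OF x ypw] by (simp add: step_def)
    qed
  qed
  moreover have "ideal (step n W j) R \<and> mpw j \<subseteq> step n W j \<and> step n W j \<subseteq> pw j" for j
    using W c(1,2,3)[of j] pw_ideal mpw_subset by (auto simp: step_def)
  ultimately show ?thesis unfolding hideal_def by blast
qed

text \<open>The two ideals differ only in degree \<open>n\<close>. An ideal between them may be
  inhomogeneous, but each of its elements agrees with its component of degree \<open>n\<close> up to
  the smaller ideal, so the part in degree \<open>n\<close> determines it.\<close>

lemma step_length:
  "ideal_length F (hset (step n (cok n))) (hset (step n (pw n))) = ideal_length R (cok n) (pw n)"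
proof (rule antisym)
  interpret F: cring F by (rule F_cring)
  note c = hidealD(1,2,3)[OF cok_hideal, of n]
  have h: "hideal (step n (cok n))" "hideal (step n (pw n))"
    using step_hideal c pw_ideal by auto
  have sub: "hset (step n V) \<subseteq> hset (step n Y)" if "V \<subseteq> Y" for V Y
    using that unfolding hset_def step_def by auto
  show "ideal_length F (hset (step n (cok n))) (hset (step n (pw n))) \<le> ideal_length R (cok n) (pw n)"
  proof (rule ideal_length_order_embedding[where f = "\<lambda>G. {x \<in> pw n. homog n x \<in> G}"])
    show "ideal (hset (step n (cok n))) F" using hset_ideal h by blast
    show "hset (step n (cok n)) \<subseteq> hset (step n (pw n))" using sub c by blast
    fix V assume V: "ideal V F" "hset (step n (cok n)) \<subseteq> V"
    have "cok n \<subseteq> {x \<in> pw n. homog n x \<in> V}"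
    proof
      fix x assume x: "x \<in> cok n"
      hence "x \<in> pw n" using c by blast
      thus "x \<in> {x \<in> pw n. homog n x \<in> V}" using homog_hset[OF h(1)] V(2) x by (auto simp: step_def)
    qed
    thus "ideal {x \<in> pw n. homog n x \<in> V} R \<and> cok n \<subseteq> {x \<in> pw n. homog n x \<in> V} \<and> {x \<in> pw n. homog n x \<in> V} \<subseteq> pw n"
      using hidealD(1)[OF hideal_of_ideal[OF V(1)]] by blast
    fix Y assume Y: "ideal Y F" "V \<subset> Y" "Y \<subseteq> hset (step n (pw n))"
    obtain f where f: "f \<in> Y" "f \<notin> V" using Y(2) by blast
    then obtain p where p: "p \<in> rees" "\<And>j. p j \<in> step n (pw n) j" "f = fib p" using Y(3) unfolding hset_def by blast
    have "(p(n := \<zero>)) j \<in> step n (cok n) j" for j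
      using p(2)[of j] ideal_zero_closed[OF c(1)] by (auto simp: step_def)
    hence "fib (p(n := \<zero>)) \<in> hset (step n (cok n))" unfolding hset_def using upd_zero_rees[OF p(1)] by blast
    hence u: "fib (p(n := \<zero>)) \<in> V" using V(2) by blast
    have hp: "homog n (p n) \<in> carrier F" by (rule homog_closed[OF rees_pw[OF p(1)]])
    have uc: "fib (p(n := \<zero>)) \<in> carrier F" by (rule fib_closed[OF upd_zero_rees[OF p(1)]])
    have split: "f = fib (p(n := \<zero>)) \<oplus>\<^bsub>F\<^esub> homog n (p n)" using fib_split[OF p(1)] p(3) by simp
    have "homog n (p n) = f \<ominus>\<^bsub>F\<^esub> fib (p(n := \<zero>))"
      unfolding split using uc hp by (simp add: F.a_ac a_minus_def F.r_neg F.r_neg1 F.r_neg2)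
    hence "homog n (p n) \<in> Y" using F.ideal_minus_closed[OF Y(1) f(1)] u Y(2) by auto
    moreover have "homog n (p n) \<notin> V" using f(2) split F.ideal_add_closed[OF V(1) u] by auto
    ultimately show "{x \<in> pw n. homog n x \<in> V} \<subset> {x \<in> pw n. homog n x \<in> Y}"
      using Y(2) rees_pw[OF p(1), of n] by auto
  qed (use c in auto)
  show "ideal_length R (cok n) (pw n) \<le> ideal_length F (hset (step n (cok n))) (hset (step n (pw n)))"
  proof (rule ideal_length_order_embedding[where f = "\<lambda>W. hset (step n W)"])
    fix V assume V: "ideal V R" "cok n \<subseteq> V" "V \<subseteq> pw n"
    show "ideal (hset (step n V)) F \<and> hset (step n (cok n)) \<subseteq> hset (step n V) \<and> hset (step n V) \<subseteq> hset (step n (pw n))"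
      using hset_ideal[OF step_hideal[OF V]] sub V by blast
  next
    fix V Y assume VY: "ideal V R" "ideal Y R" "cok n \<subseteq> V" "V \<subset> Y" "Y \<subseteq> pw n"
    then obtain y where y: "y \<in> Y" "y \<notin> V" by blast
    show "hset (step n V) \<subset> hset (step n Y)"
    proof (rule hset_mono)
      show "hideal (step n V)" "hideal (step n Y)" using step_hideal VY by auto
      show "step n V j \<subseteq> step n Y j" for j using VY(4) by (auto simp: step_def)
      show "y \<in> step n Y n" "y \<notin> step n V n" using y by (auto simp: step_def)
    qed
  qed (use c hset_ideal[OF h(1)] sub in auto)
qed

text \<open>The cokernel lengths telescope: by \<open>cok_length\<close> each one is the increment
  of \<open>mu\<close> plus the defect of the preceding degree.\<close>

lemma step_chain_length:
  "ideal_length F (hset (step n (cok n))) (carrier F) = enat (mu n) + (\<Sum>i<n. defect i)"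
proof (induction n)
  case 0
  have "hset (step 0 (pw 0)) = carrier F"
  proof -
    have "step 0 (pw 0) = pw" by (auto simp: step_def fun_eq_iff)
    thus ?thesis unfolding F_carrier hset_def using rees_pw by auto
  qed
  moreover have "ideal_length R (cok 0) (pw 0) = enat (mu 0)"
    using ideal_length_mu[of 0] cok_0 mpw_0 by simp
  ultimately show ?case using step_length[of 0] by simp
next
  case (Suc n)
  interpret F: cring F by (rule F_cring)
  \<comment> \<open>The top of one layer is the bottom of the layer before it.\<close>
  have eq: "step (Suc n) (pw (Suc n)) = step n (cok n)"
    by (auto simp: step_def fun_eq_iff less_Suc_eq simp del: ideal_pow.simps)
  note c = hidealD(1,2,3)[OF cok_hideal]
  have I: "ideal (hset (step (Suc n) (cok (Suc n)))) F" "ideal (hset (step n (cok n))) F"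
    by (rule hset_ideal[OF step_hideal[OF c(1) subset_refl c(3)]])+
  have sub: "hset (step (Suc n) (cok (Suc n))) \<subseteq> hset (step n (cok n))"
  proof -
    have le: "step (Suc n) (cok (Suc n)) j \<subseteq> step n (cok n) j" for j
      using c(3)[of "Suc n"] by (auto simp: step_def less_Suc_eq)
    show ?thesis unfolding hset_def using le by blast
  qed
  have "ideal_length F (hset (step (Suc n) (cok (Suc n)))) (carrier F)
    = ideal_length F (hset (step (Suc n) (cok (Suc n)))) (hset (step n (cok n)))
      + ideal_length F (hset (step n (cok n))) (carrier F)"
    using F.ideal_length_add[OF I F.oneideal sub] F.ideal_subset_carrier[OF I(2)] by simp
  also have "\<dots> = (ideal_length R (cok (Suc n)) (pw (Suc n)) + enat (mu n)) + (\<Sum>i<n. defect i)"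
    unfolding Suc using step_length[of "Suc n"] unfolding eq by (simp add: ac_simps)
  also have "\<dots> = enat (mu (Suc n)) + (\<Sum>i<Suc n. defect i)"
    unfolding cok_length by (simp add: ac_simps)
  finally show ?case .
qed

text \<open>Above degree \<open>r\<close> the cokernels vanish, so the filtration is exhausted at
  step \<open>r\<close>. The length exceeds \<open>mu r\<close> by the sum of the defects below
  \<open>r\<close>, and it equals \<open>mu r\<close> only if all of them are zero.\<close>

lemma fiber_length_condition_iff:
  "module_length F (quot_module F (carrier F) (PIdl\<^bsub>F\<^esub> (fiber_class R m L a))) = enat (mu_pow R L (int r))
    \<longleftrightarrow> (\<forall>n. inj_at n)"
proof -
  interpret F: cring F by (rule F_cring)
  have "cok j = pw j" if j: "r < j" for j
  proof -
    obtain n where n: "j = Suc n" "r \<le> n" using less_imp_Suc_add[OF j] by auto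
    have "pw j \<subseteq> cok j" unfolding n(1) cok_Suc pw_Suc[OF n(2)]
      using set_add_upper(2)[OF mpw_ideal a_cosets(1)] pw_Suc[OF n(2)] by metis
    thus ?thesis using hidealD(3)[OF cok_hideal] by blast
  qed
  hence "step r (cok r) = cok" by (auto simp: step_def fun_eq_iff)
  hence P: "PIdl\<^bsub>F\<^esub> (fiber_class R m L a) = hset (step r (cok r))" using PIdl_A fiber_class_eq by simp
  have I: "ideal (hset (step r (cok r))) F"
    by (rule hset_ideal[OF step_hideal[OF hidealD(1)[OF cok_hideal] subset_refl hidealD(3)[OF cok_hideal]]])
  have "module_length F (quot_module F (carrier F) (PIdl\<^bsub>F\<^esub> (fiber_class R m L a)))
      = enat (mu r) + (\<Sum>i<r. defect i)"
    unfolding P step_chain_length[symmetric]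
    by (rule F.module_length_quot[OF I F.oneideal F.ideal_subset_carrier[OF I]])
  thus ?thesis using defect_eq_0_iff all_inj_below by (auto simp: enat_add_left_eq_self_iff)
qed

end

section \<open>The decomposition over the fiber cone of a principal reduction\<close>

lemma (in cring) coset_set_add:
  assumes "ideal K R" "ideal K' R" "K \<subseteq> K'" "x \<in> carrier R"
  shows "(K +> x) <+> K' = K' +> x"
proof -
  have "(K +> x) <+> K' = K' <+> (K +> x)"
    using set_add_comm ideal_subset_carrier assms by (simp add: a_r_coset_subset_G)
  also have "\<dots> = (K' <+> K) +> x"
    using a_setmult_rcos_assoc ideal_subset_carrier assms by simp
  also have "K' <+> K = K'"
    using set_add_absorb[OF assms(1,2,3)] set_add_comm ideal_subset_carrier assms by simp
  finally show ?thesis .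
qed

text \<open>\<open>N/K\<close> is a vector space of dimension \<open>e\<close> over the residue
  field. A basis is lifted by induction on \<open>e\<close>, one vector for each step of a
  chain.\<close>

lemma (in noetherian_local_ring) exists_basis_mod:
  assumes "ideal K R" "ideal N R" "K \<subseteq> N" "m \<cdot> N \<subseteq> K" "ideal_length R K N = enat e"
  shows "\<exists>y. (\<forall>j<e. y j \<in> N) \<and>
    (\<forall>x\<in>N. \<exists>c. (\<forall>j. c j \<in> carrier R) \<and> x \<ominus> (\<Oplus>j\<in>{..<e}. c j \<otimes> y j) \<in> K) \<and>
    (\<forall>c. (\<forall>j. c j \<in> carrier R) \<and> (\<Oplus>j\<in>{..<e}. c j \<otimes> y j) \<in> K \<longrightarrow> (\<forall>j<e. c j \<in> m))"
  using assms
proof (induction e arbitrary: N)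
  case 0
  hence "K = N" using ideal_length_eq_0_iff[of K N] by (simp add: zero_enat_def)
  thus ?case using ideal.Icarr[OF 0(2)] by (auto simp: a_minus_def intro!: exI[of _ "\<lambda>_. \<zero>"])
next
  case (Suc e)
  have "ideal_chain R K N (Suc e)" using le_ideal_length_iff[OF Suc.prems(1,3), of "Suc e"] Suc.prems(5) by simp
  then obtain c where c: "\<forall>i\<le>Suc e. ideal (c i) R \<and> K \<subseteq> c i \<and> c i \<subseteq> N" "\<forall>i<Suc e. c i \<subset> c (Suc i)"
    unfolding ideal_chain_def by blast
  \<comment> \<open>\<open>V\<close> is the hyperplane below the last step, so \<open>N/V\<close>
    has length one.\<close>
  define V where "V = c e"
  have V: "ideal V R" "K \<subseteq> V" "V \<subset> N" using c(1)[rule_format, of e] c(1)[rule_format, of "Suc e"] c(2)[rule_format, of e]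
    unfolding V_def by auto
  have Vl: "enat e \<le> ideal_length R K V"
  proof -
    have "ideal_chain R K V e" unfolding ideal_chain_def
    proof (intro exI[of _ c] conjI allI impI)
      have mono: "k \<le> e \<Longrightarrow> i \<le> k \<Longrightarrow> c i \<subseteq> c k" for i k
      proof (induction k)
        case (Suc k)
        have "c k \<subset> c (Suc k)" using c(2) Suc.prems(1) by simp
        moreover have "c i \<subseteq> c k \<or> i = Suc k" using Suc by (cases "i = Suc k") auto
        ultimately show ?case by blast
      qed simp
      have up: "c i \<subseteq> c e" if "i \<le> e" for i using mono[OF order_refl that] .
      fix i assume "i \<le> e"
      thus "ideal (c i) R" "K \<subseteq> c i" "c i \<subseteq> V" using c(1)[rule_format, of i] up[of i] unfolding V_def by auto
    qed (use c(2) in auto)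
    thus ?thesis using le_ideal_length_iff[OF Suc.prems(1) V(2)] by simp
  qed
  have sum: "enat (Suc e) = ideal_length R K V + ideal_length R V N"
    using ideal_length_add[OF Suc.prems(1) V(1) Suc.prems(2) V(2)] V(3) Suc.prems(5) by auto
  have "ideal_length R V N \<noteq> 0" using ideal_length_eq_0_iff[OF V(1) Suc.prems(2)] V(3) by auto
  hence len: "ideal_length R K V = enat e" "ideal_length R V N = 1"
    using sum Vl by (cases "ideal_length R K V"; cases "ideal_length R V N"; auto simp: one_enat_def zero_enat_def)+
  have "m \<cdot> V \<subseteq> K" using Suc.prems(4) ideal_prod_mono[of m m V N] V(3) by blast
  from Suc.IH[OF Suc.prems(1) V(1,2) this len(1)] obtain y where y: "\<forall>j<e. y j \<in> V"
    "\<forall>x\<in>V. \<exists>c. (\<forall>j. c j \<in> carrier R) \<and> x \<ominus> (\<Oplus>j\<in>{..<e}. c j \<otimes> y j) \<in> K"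
    "\<forall>c. (\<forall>j. c j \<in> carrier R) \<and> (\<Oplus>j\<in>{..<e}. c j \<otimes> y j) \<in> K \<longrightarrow> (\<forall>j<e. c j \<in> m)"
    by blast
  obtain z where z: "z \<in> N" "z \<notin> V" using V(3) by blast
  have zc: "z \<in> carrier R" using z ideal.Icarr[OF Suc.prems(2)] by blast
  have yc: "y j \<in> carrier R" if "j < e" for j using y(1) that ideal.Icarr[OF V(1)] by blast
  let ?y = "y(e := z)"
  have fs: "(\<Oplus>j\<in>{..<Suc e}. c j \<otimes> ?y j) = c e \<otimes> z \<oplus> (\<Oplus>j\<in>{..<e}. c j \<otimes> y j)"
    if c: "\<forall>j. c j \<in> carrier R" for c
  proof -
    have "(\<Oplus>j\<in>{..<Suc e}. c j \<otimes> ?y j) = c e \<otimes> z \<oplus> (\<Oplus>j\<in>{..<e}. c j \<otimes> ?y j)"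
      unfolding lessThan_Suc using c zc yc by (subst finsum_insert) auto
    also have "(\<Oplus>j\<in>{..<e}. c j \<otimes> ?y j) = (\<Oplus>j\<in>{..<e}. c j \<otimes> y j)"
      using c yc by (intro finsum_cong') auto
    finally show ?thesis .
  qed
  have fV: "(\<Oplus>j\<in>{..<e}. c j \<otimes> y j) \<in> V" if "\<forall>j. c j \<in> carrier R" for c
    using that y(1) ideal.I_l_closed[OF V(1)] by (intro ideal_finsum_closed V(1)) auto
  note PI = cgenideal_ideal[OF zc]
  have VP: "ideal (V <+> PIdl z) R" using add_ideals[OF V(1) PI] .
  have VPN: "V <+> PIdl z \<subseteq> N"
    using V(3) cgenideal_minimal[OF Suc.prems(2) z(1)] by (auto simp: set_add_subset_iff[OF V(1) PI Suc.prems(2)])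
  \<comment> \<open>Any vector outside the hyperplane spans the remaining dimension.\<close>
  have "V \<noteq> V <+> PIdl z" using set_add_upper(2)[OF V(1) PI] cgenideal_self[OF zc] z(2) by blast
  hence "ideal_length R V (V <+> PIdl z) \<noteq> 0"
    using ideal_length_eq_0_iff[OF V(1) VP set_add_upper(1)[OF V(1) PI]] by simp
  moreover have "1 = ideal_length R V (V <+> PIdl z) + ideal_length R (V <+> PIdl z) N"
    using ideal_length_add[OF V(1) VP Suc.prems(2) set_add_upper(1)[OF V(1) PI] VPN] len(2) by simp
  ultimately have "ideal_length R (V <+> PIdl z) N = 0"
    by (cases "ideal_length R V (V <+> PIdl z)"; cases "ideal_length R (V <+> PIdl z) N")
      (auto simp: one_enat_def zero_enat_def)
  hence N: "N = V <+> PIdl z" using ideal_length_eq_0_iff[OF VP Suc.prems(2) VPN] by simp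
  show ?case
  proof (rule exI[of _ ?y], intro conjI ballI allI impI)
    fix j assume "j < Suc e" thus "?y j \<in> N" using y(1) z V(3) by (auto simp: less_Suc_eq)
  next
    fix x assume "x \<in> N"
    then obtain v g where vg: "v \<in> V" "g \<in> PIdl z" "x = v \<oplus> g" unfolding N set_add_iff by blast
    then obtain b where b: "b \<in> carrier R" "g = b \<otimes> z" unfolding cgenideal_def by blast
    obtain c where c: "\<forall>j. c j \<in> carrier R" "v \<ominus> (\<Oplus>j\<in>{..<e}. c j \<otimes> y j) \<in> K" using y(2) vg(1) by blast
    let ?c = "c(e := b)"
    have cc: "\<forall>j. ?c j \<in> carrier R" using c(1) b(1) by simp
    have "(\<Oplus>j\<in>{..<e}. ?c j \<otimes> y j) = (\<Oplus>j\<in>{..<e}. c j \<otimes> y j)"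
      using c(1) yc by (intro finsum_cong') auto
    hence eq: "(\<Oplus>j\<in>{..<Suc e}. ?c j \<otimes> ?y j) = b \<otimes> z \<oplus> (\<Oplus>j\<in>{..<e}. c j \<otimes> y j)"
      unfolding fs[OF cc] by simp
    have "(v \<oplus> b \<otimes> z) \<ominus> (b \<otimes> z \<oplus> s) = v \<ominus> s" if "s \<in> carrier R" for s
      using that vg(1) ideal.Icarr[OF V(1)] b(1) zc by algebra
    hence "x \<ominus> (\<Oplus>j\<in>{..<Suc e}. ?c j \<otimes> ?y j) = v \<ominus> (\<Oplus>j\<in>{..<e}. c j \<otimes> y j)"
      unfolding eq vg(3) b(2) using ideal.Icarr[OF V(1) fV[OF c(1)]] by simp
    thus "\<exists>c. (\<forall>j. c j \<in> carrier R) \<and> x \<ominus> (\<Oplus>j\<in>{..<Suc e}. c j \<otimes> ?y j) \<in> K"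
      using cc c(2) by (intro exI[of _ ?c]) simp
  next
    fix c j assume c: "(\<forall>j. c j \<in> carrier R) \<and> (\<Oplus>j\<in>{..<Suc e}. c j \<otimes> ?y j) \<in> K" and j: "j < Suc e"
    let ?s = "\<Oplus>j\<in>{..<e}. c j \<otimes> y j"
    have sV: "?s \<in> V" using fV c by blast
    have ce: "c e \<in> carrier R" using c by blast
    have K: "c e \<otimes> z \<oplus> ?s \<in> K" using c fs by metis
    have cz: "(c e \<otimes> z \<oplus> ?s) \<ominus> ?s = c e \<otimes> z"
    proof -
      have "(p \<oplus> q) \<ominus> q = p" if "p \<in> carrier R" "q \<in> carrier R" for p q using that by algebra
      thus ?thesis using ce zc ideal.Icarr[OF V(1) sV] by simp
    qed
    hence czV: "c e \<otimes> z \<in> V" using ideal_minus_closed[OF V(1) _ sV] K V(2) by (metis subsetD)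
    \<comment> \<open>A unit coefficient would put \<open>z\<close> into \<open>V\<close>.\<close>
    have cm: "c e \<in> m"
    proof (rule ccontr)
      assume "c e \<notin> m"
      then obtain d where d: "d \<in> carrier R" "d \<otimes> c e = \<one>" using unit_of_notin_m ce by blast
      have "d \<otimes> (c e \<otimes> z) = z" using d ce zc m_assoc[of d "c e" z] by simp
      thus False using ideal.I_l_closed[OF V(1) czV d(1)] z(2) by simp
    qed
    hence "c e \<otimes> z \<in> K" using Suc.prems(4) z(1) by (auto intro: ideal_prod.prod)
    moreover have "(c e \<otimes> z \<oplus> ?s) \<ominus> (c e \<otimes> z) = ?s"
    proof -
      have "(p \<oplus> q) \<ominus> p = q" if "p \<in> carrier R" "q \<in> carrier R" for p q using that by algebra
      thus ?thesis using ce zc ideal.Icarr[OF V(1) sV] by simp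
    qed
    ultimately have "?s \<in> K" using ideal_minus_closed[OF Suc.prems(1) K] by metis
    thus "c j \<in> m" using y(3) c cm j by (auto simp: less_Suc_eq)
  qed
qed

section \<open>The fiber cone of the principal reduction as a polynomial ring\<close>

context principal_reduction
begin

text \<open>The general results thus apply to \<open>(a)\<close> as a reduction of itself. With
  \<open>r = 0\<close>, multiplication by \<open>a\<close> is injective in every degree of its fiber
  cone.\<close>

lemma sub_principal_reduction: "principal_reduction R m (PIdl a) a 0"
proof (intro principal_reduction.intro fiber_ring.intro fiber_ring_axioms.intro principal_reduction_axioms.intro)
  show "ideal (PIdl a) R" using cgenideal_ideal[OF a_carrier] .
  show "a \<in> PIdl a" using cgenideal_self[OF a_carrier] .
  show "ideal_pow R (PIdl a) (Suc 0) = a <# ideal_pow R (PIdl a) 0"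
    using PIdl_prod[OF oneideal a_carrier] by simp
qed (rule noetherian_local_ring_axioms nzd)+

interpretation J: principal_reduction R m "PIdl a" a 0
  by (rule sub_principal_reduction)

lemma J_sub: "J.pw n \<subseteq> pw n" "J.mpw n \<subseteq> mpw n"
proof -
  show pw: "J.pw n \<subseteq> pw n"
  proof (induction n)
    case (Suc n)
    show ?case unfolding ideal_pow.simps by (rule ideal_prod_mono[OF cgenideal_minimal[OF L_ideal a] Suc])
  qed simp
  show "J.mpw n \<subseteq> mpw n" by (rule ideal_prod_mono[OF subset_refl pw])
qed

lemma J_rees: "J.rees \<subseteq> rees"
  unfolding J.rees_def rees_def using J_sub(1) by blast

lemma J_pw: "J.pw n = PIdl (a [^] n)" by (rule ideal_pow_PIdl[OF a_carrier])

lemma J_mpw: "J.mpw n = a [^] n <# m"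
  unfolding J_pw using ideal_prod_commute[OF m_ideal cgenideal_ideal] PIdl_prod[OF m_ideal] a_carrier by simp

text \<open>Cancelling \<open>a^n\<close> shows that coefficients are determined modulo
  \<open>m\<close>: the fiber cone of \<open>(a)\<close> is a polynomial ring over the residue
  field.\<close>

lemma J_mpw_iff:
  assumes "c \<in> carrier R" shows "c \<otimes> a [^] n \<in> J.mpw n \<longleftrightarrow> c \<in> m"
proof
  assume "c \<in> m" thus "c \<otimes> a [^] n \<in> J.mpw n"
    unfolding J_mpw l_coset_iff using a_carrier assms by (intro bexI[of _ c]) (simp_all add: m_comm)
next
  assume "c \<otimes> a [^] n \<in> J.mpw n"
  then obtain d where d: "d \<in> m" "c \<otimes> a [^] n = a [^] n \<otimes> d" unfolding J_mpw l_coset_iff by blast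
  have dc: "d \<in> carrier R" using d ideal.Icarr[OF m_ideal] by blast
  have an: "a [^] n \<in> carrier R" using a_carrier by simp
  have "a [^] n \<otimes> (c \<ominus> d) = c \<otimes> a [^] n \<ominus> a [^] n \<otimes> d" using assms dc an by algebra
  also have "\<dots> = \<zero>" unfolding d(2) using dc an by (simp add: a_minus_def r_neg)
  finally have "c \<ominus> d = \<zero>" using a_pow_cancel[of "c \<ominus> d" n] assms dc by simp
  moreover have "c = (c \<ominus> d) \<oplus> d" using assms dc by algebra
  ultimately show "c \<in> m" using d(1) dc by simp
qed

text \<open>Represents the polynomial with coefficients \<open>c n\<close> in the class of
  \<open>a\<close>.\<close>

abbreviation scal :: "(nat \<Rightarrow> 'a) \<Rightarrow> nat \<Rightarrow> 'a" where "scal c \<equiv> (\<lambda>n. c n \<otimes> a [^] n)"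

definition fin_seqs where "fin_seqs = {c. (\<forall>n. c n \<in> carrier R) \<and> (\<exists>N. \<forall>n>N. c n = \<zero>)}"

lemma fin_seqs_carrier: "c \<in> fin_seqs \<Longrightarrow> c n \<in> carrier R" by (simp add: fin_seqs_def)

lemma scal_rees: assumes "c \<in> fin_seqs" shows "scal c \<in> J.rees"
proof -
  obtain N where N: "\<forall>n>N. c n = \<zero>" using assms unfolding fin_seqs_def by blast
  have "scal c n \<in> PIdl (a [^] n)" for n
    unfolding cgenideal_def using fin_seqs_carrier[OF assms] by blast
  hence "scal c n \<in> J.pw n" for n unfolding J_pw .
  moreover have "scal c n = \<zero>" if "n > N" for n using N that a_carrier by simp
  ultimately show ?thesis by (rule J.reesI)
qed

lemma J_rep: assumes "f \<in> carrier J.F" shows "\<exists>c\<in>fin_seqs. f = J.fib (scal c)"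
proof -
  obtain p where p: "p \<in> J.rees" "f = J.fib p" using J.fib_surj assms by blast
  \<comment> \<open>Zero gets the coefficient zero, so that the coefficients have finite
    support.\<close>
  have "\<exists>c\<in>carrier R. p n = c \<otimes> a [^] n \<and> (p n = \<zero> \<longrightarrow> c = \<zero>)" for n
  proof (cases "p n = \<zero>")
    case True thus ?thesis using a_carrier by (intro bexI[of _ \<zero>]) auto
  next
    case False
    have "p n \<in> PIdl (a [^] n)" using J.rees_pw[OF p(1)] J_pw by blast
    thus ?thesis using False unfolding cgenideal_def by blast
  qed
  then obtain c where c: "\<And>n. c n \<in> carrier R" "\<And>n. p n = c n \<otimes> a [^] n" "\<And>n. p n = \<zero> \<Longrightarrow> c n = \<zero>" by metis
  obtain N where "\<forall>n>N. p n = \<zero>" using p(1) unfolding J.rees_def by blast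
  hence "c \<in> fin_seqs" unfolding fin_seqs_def using c(1,3) by blast
  moreover have "p = scal c" using c(2) by blast
  ultimately show ?thesis using p(2) by blast
qed

lemma J_fib_eq_iff:
  assumes "c \<in> fin_seqs" "d \<in> fin_seqs"
  shows "J.fib (scal c) = J.fib (scal d) \<longleftrightarrow> (\<forall>n. c n \<ominus> d n \<in> m)"
proof -
  have "scal c n \<ominus> scal d n \<in> J.mpw n \<longleftrightarrow> c n \<ominus> d n \<in> m" for n
  proof -
    have cd: "c n \<in> carrier R" "d n \<in> carrier R" "a [^] n \<in> carrier R"
      using fin_seqs_carrier assms a_carrier by auto
    have "scal c n \<ominus> scal d n = (c n \<ominus> d n) \<otimes> a [^] n" using cd by algebra
    thus ?thesis using J_mpw_iff[of "c n \<ominus> d n" n] cd by simp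
  qed
  thus ?thesis using J.fib_eq_iff[OF scal_rees[OF assms(1)] scal_rees[OF assms(2)]] by simp
qed

lemma J_fib_zero_iff:
  assumes "c \<in> fin_seqs" shows "J.fib (scal c) n = \<zero>\<^bsub>fiber_piece R m (PIdl a) n\<^esub> \<longleftrightarrow> c n \<in> m"
proof -
  have "c n \<otimes> a [^] n \<in> carrier R" using fin_seqs_carrier[OF assms] a_carrier by simp
  thus ?thesis unfolding J.piece_zero J.fib_def
    using coset_eq_zero_iff[OF J.mpw_ideal] J_mpw_iff[OF fin_seqs_carrier[OF assms]] by simp
qed

text \<open>The canonical map between the two fiber cones, in the form in which
  \<open>fiber_module\<close> uses it for scalars.\<close>

definition incl where "incl c = (\<lambda>n. c n <+> mpw n)"

lemma incl_fib: assumes "p \<in> J.rees" shows "incl (J.fib p) = fib p"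
  unfolding incl_def fib_def J.fib_def
  using coset_set_add[OF J.mpw_ideal mpw_ideal J_sub(2) J.rees_carrier[OF assms]] by blast

lemma incl_add:
  assumes "c \<in> carrier J.F" "d \<in> carrier J.F" shows "incl (c \<oplus>\<^bsub>J.F\<^esub> d) = incl c \<oplus>\<^bsub>F\<^esub> incl d"
proof -
  obtain p q where pq: "p \<in> J.rees" "q \<in> J.rees" "c = J.fib p" "d = J.fib q" using assms J.fib_surj by blast
  hence "p \<in> rees" "q \<in> rees" using J_rees by auto
  thus ?thesis using pq J.fib_add J.add_rees incl_fib fib_add by simp
qed

lemma incl_mult:
  assumes "c \<in> carrier J.F" "d \<in> carrier J.F" shows "incl (c \<otimes>\<^bsub>J.F\<^esub> d) = incl c \<otimes>\<^bsub>F\<^esub> incl d"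
proof -
  obtain p q where pq: "p \<in> J.rees" "q \<in> J.rees" "c = J.fib p" "d = J.fib q" using assms J.fib_surj by blast
  hence r: "p \<in> rees" "q \<in> rees" using J_rees by auto
  thus ?thesis using pq J.fib_mult[OF pq(1,2)] incl_fib[OF J.conv_rees[OF pq(1,2)]] incl_fib[OF pq(1)] incl_fib[OF pq(2)] fib_mult[OF r] by simp
qed

lemma incl_closed: assumes "c \<in> carrier J.F" shows "incl c \<in> carrier F"
proof -
  obtain p where p: "p \<in> J.rees" "c = J.fib p" using assms J.fib_surj by blast
  hence "p \<in> rees" using J_rees by auto
  thus ?thesis using p incl_fib fib_closed by simp
qed

lemma J_smult: assumes "c \<in> carrier J.F" shows "c \<odot>\<^bsub>fiber_module R m (PIdl a)\<^esub> f = c \<otimes>\<^bsub>J.F\<^esub> f"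
proof -
  obtain p where p: "p \<in> J.rees" "c = J.fib p" using assms J.fib_surj by blast
  have "(\<lambda>n. c n <+> J.mpw n) = c" unfolding p(2) J.fib_def
    using coset_set_add[OF J.mpw_ideal J.mpw_ideal subset_refl J.rees_carrier[OF p(1)]] by blast
  thus ?thesis by (simp add: fiber_module_def)
qed

lemma smult_incl: "c \<odot>\<^bsub>fiber_module R m L\<^esub> f = incl c \<otimes>\<^bsub>F\<^esub> f"
  by (simp add: fiber_module_def incl_def)

lemma fiber_module_simps:
  "carrier (fiber_module R m L) = carrier F" "x \<oplus>\<^bsub>fiber_module R m L\<^esub> y = x \<oplus>\<^bsub>F\<^esub> y"
  "carrier (fiber_module R m (PIdl a)) = carrier J.F"
  "x' \<oplus>\<^bsub>fiber_module R m (PIdl a)\<^esub> y' = x' \<oplus>\<^bsub>J.F\<^esub> y'"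
  by (simp_all add: fiber_module_def)

lemma J_cancel:
  assumes "f \<in> carrier J.F" "g \<in> carrier J.F" "J.A \<otimes>\<^bsub>J.F\<^esub> f = J.A \<otimes>\<^bsub>J.F\<^esub> g"
  shows "f = g"
proof -
  interpret JF: cring J.F by (rule J.F_cring)
  have Ag: "J.A \<otimes>\<^bsub>J.F\<^esub> g \<in> carrier J.F" using J.A_closed assms(2) by simp
  have "J.A \<otimes>\<^bsub>J.F\<^esub> (f \<ominus>\<^bsub>J.F\<^esub> g) = \<zero>\<^bsub>J.F\<^esub>"
  proof -
    have "J.A \<otimes>\<^bsub>J.F\<^esub> (f \<ominus>\<^bsub>J.F\<^esub> g) = J.A \<otimes>\<^bsub>J.F\<^esub> f \<ominus>\<^bsub>J.F\<^esub> J.A \<otimes>\<^bsub>J.F\<^esub> g"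
      using assms(1,2) J.A_closed by (simp add: a_minus_def JF.r_distr JF.r_minus)
    also have "\<dots> = \<zero>\<^bsub>J.F\<^esub>" unfolding assms(3) a_minus_def by (rule JF.r_neg[OF Ag])
    finally show ?thesis .
  qed
  moreover have nz: "nonzerodivisor J.F J.A" unfolding J.A_nonzerodivisor_iff using J.inj_at_ge by blast
  moreover have "f \<ominus>\<^bsub>J.F\<^esub> g \<in> carrier J.F" using assms(1,2) by (rule JF.minus_closed)
  ultimately have zero: "f \<ominus>\<^bsub>J.F\<^esub> g = \<zero>\<^bsub>J.F\<^esub>" using nonzerodivisorD[OF nz] by blast
  have "f = (f \<ominus>\<^bsub>J.F\<^esub> g) \<oplus>\<^bsub>J.F\<^esub> g" using assms(1,2) by (simp add: a_minus_def JF.a_assoc JF.l_neg)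
  also have "\<dots> = g" unfolding zero using assms(2) by simp
  finally show ?thesis .
qed

text \<open>The class of \<open>a\<close> acts injectively on the fiber cone of \<open>(a)\<close>,
  hence on sums of shifted copies, and an injective linear map carries this back to the fiber cone
  of \<open>L\<close>.\<close>

lemma decomposition_imp_inj:
  assumes "graded_isomorphic J.F (fiber_module R m L)
    (graded_sum K (\<lambda>(i, _). graded_shift (fiber_module R m (PIdl a)) (d i)))" (is "graded_isomorphic _ ?M ?N")
  shows "inj_at n"
  unfolding inj_at_def
proof (intro ballI impI)
  fix x assume x: "x \<in> pw n" "a \<otimes> x \<in> mpw (Suc n)"
  interpret F: cring F by (rule F_cring)
  obtain h where h: "bij_betw h (carrier ?M) (carrier ?N)"
    "\<And>c x. c \<in> carrier J.F \<Longrightarrow> x \<in> carrier ?M \<Longrightarrow> h (c \<odot>\<^bsub>?M\<^esub> x) = c \<odot>\<^bsub>?N\<^esub> h x"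
    using assms unfolding graded_isomorphic_def by blast
  let ?f = "homog n x"
  have M: "carrier ?M = carrier F" by (simp add: fiber_module_simps)
  have f: "?f \<in> carrier ?M" "\<zero>\<^bsub>F\<^esub> \<in> carrier ?M" using homog_closed[OF x(1)] M by auto
  have "incl J.A = A" unfolding J.homog_def homog_def
    using incl_fib[OF J.mono_rees[OF J.a_pw]] unfolding J.mono_def mono_def .
  \<comment> \<open>Comparison with the image of zero avoids showing that \<open>h\<close> preserves
    zero.\<close>
  hence "J.A \<odot>\<^bsub>?M\<^esub> ?f = J.A \<odot>\<^bsub>?M\<^esub> \<zero>\<^bsub>F\<^esub>"
    using homog_mult[OF a_pw x(1)] homog_eq_zero_iff[OF mpw_pw[OF x(2)]] x(2) A_closed by (simp add: smult_incl)
  hence eq: "J.A \<odot>\<^bsub>?N\<^esub> h ?f = J.A \<odot>\<^bsub>?N\<^esub> h \<zero>\<^bsub>F\<^esub>"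
    using h(2)[OF J.A_closed f(1)] h(2)[OF J.A_closed f(2)] by simp
  have hN: "h ?f \<in> carrier ?N" "h \<zero>\<^bsub>F\<^esub> \<in> carrier ?N" using h(1) f unfolding bij_betw_def by auto
  have "h ?f k = h \<zero>\<^bsub>F\<^esub> k" for k
  proof (cases "k \<in> K")
    case True
    obtain i j where k: "k = (i, j)" by (cases k)
    have c: "h ?f k \<in> carrier J.F" "h \<zero>\<^bsub>F\<^esub> k \<in> carrier J.F"
      using hN True unfolding k by (auto simp: graded_sum_def graded_shift_def fiber_module_simps PiE_def Pi_def split: prod.splits)
    have "(J.A \<odot>\<^bsub>?N\<^esub> h ?f) k = (J.A \<odot>\<^bsub>?N\<^esub> h \<zero>\<^bsub>F\<^esub>) k" using eq by simp
    hence "J.A \<otimes>\<^bsub>J.F\<^esub> h ?f k = J.A \<otimes>\<^bsub>J.F\<^esub> h \<zero>\<^bsub>F\<^esub> k"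
      using True J_smult[OF J.A_closed] by (simp add: graded_sum_def graded_shift_def split: prod.splits)
    thus ?thesis using J_cancel c by blast
  next
    case False
    have "carrier ?N = (\<Pi>\<^sub>E k\<in>K. carrier (case k of (i, _) \<Rightarrow> graded_shift (fiber_module R m (PIdl a)) (d i)))"
      by (simp add: graded_sum_def)
    thus ?thesis using PiE_arb[OF _ False] hN by metis
  qed
  hence "h ?f = h \<zero>\<^bsub>F\<^esub>" by blast
  hence "?f = \<zero>\<^bsub>F\<^esub>" using h(1) f unfolding bij_betw_def inj_on_def by blast
  thus "x \<in> mpw n" using homog_eq_zero_iff[OF x(1)] by simp
qed

end

context principal_reduction
begin

text \<open>Truncated subtraction; it is the true difference when multiplication by \<open>a\<close>
  is injective one degree below, by \<open>cok_length_rank\<close>.\<close>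

definition rank where "rank n = mu_pow R L (int n) - mu_pow R L (int n - 1)"

lemma cok_length_rank:
  assumes "inj_at (n - 1)"
  shows "ideal_length R (cok n) (pw n) = enat (rank n)" "mu_pow R L (int n - 1) \<le> mu_pow R L (int n)"
proof -
  have "ideal_length R (cok n) (pw n) = enat (rank n) \<and> mu_pow R L (int n - 1) \<le> mu_pow R L (int n)"
  proof (cases n)
    case 0
    thus ?thesis using ideal_length_m cok_0 by (simp add: rank_def mu_pow_def one_enat_def)
  next
    case (Suc k)
    have mu: "mu_pow R L (int (Suc k) - 1) = mu k" by simp
    have "defect k = 0" using assms Suc defect_eq_0_iff by simp
    hence eq: "ideal_length R (cok (Suc k)) (pw (Suc k)) + enat (mu k) = enat (mu (Suc k))"
      using cok_length[of k] by simp
    then obtain l where l: "ideal_length R (cok (Suc k)) (pw (Suc k)) = enat l"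
      by (cases "ideal_length R (cok (Suc k)) (pw (Suc k))") auto
    hence "l + mu k = mu (Suc k)" using eq by simp
    thus ?thesis unfolding Suc rank_def mu l by auto
  qed
  thus "ideal_length R (cok n) (pw n) = enat (rank n)" "mu_pow R L (int n - 1) \<le> mu_pow R L (int n)"
    by blast+
qed

end

text \<open>For each \<open>n\<close>, the \<open>y n j\<close> lift a basis of the cokernel \<open>L\<^sup>n/cok n\<close> over the residue field.\<close>

locale graded_basis = principal_reduction +
  fixes y
  assumes inj: "\<And>n. inj_at n"
    and basis_pw: "\<And>n j. j < rank n \<Longrightarrow> y n j \<in> pw n"
    and basis_span: "\<And>n x. x \<in> pw n \<Longrightarrow>
      \<exists>c. (\<forall>j. c j \<in> carrier R) \<and> x \<ominus> (\<Oplus>j\<in>{..<rank n}. c j \<otimes> y n j) \<in> cok n"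
    and basis_indep: "\<And>n c j. (\<And>j. c j \<in> carrier R) \<Longrightarrow>
      (\<Oplus>j\<in>{..<rank n}. c j \<otimes> y n j) \<in> cok n \<Longrightarrow> j < rank n \<Longrightarrow> c j \<in> m"
begin

interpretation J: principal_reduction R m "PIdl a" a 0
  by (rule sub_principal_reduction)

definition Ix where "Ix = (SIGMA i:{0..r}. {..<rank i})"

abbreviation Y where "Y k \<equiv> y (fst k) (snd k)"

text \<open>The component of degree \<open>n\<close> of a general combination: a basis element of
  degree \<open>i <= n\<close> enters with the factor \<open>a^(n-i)\<close>, one of higher degree
  not at all.\<close>

definition comb where
  "comb n c = (\<Oplus>k\<in>Ix. if n < fst k then \<zero> else c k \<otimes> (a [^] (n - fst k) \<otimes> Y k))"

lemma finite_Ix: "finite Ix" unfolding Ix_def by simp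

lemma Y_pw: "k \<in> Ix \<Longrightarrow> Y k \<in> pw (fst k)" unfolding Ix_def using basis_pw by auto

lemma Y_carrier: "k \<in> Ix \<Longrightarrow> Y k \<in> carrier R" using Y_pw pw_carrier by blast

text \<open>The cokernels vanish above \<open>r\<close>, so \<open>Ix\<close> lists the whole
  basis.\<close>

lemma rank_eq_0: "r < n \<Longrightarrow> rank n = 0"
proof -
  assume n: "r < n"
  obtain k where k: "n = Suc k" "r \<le> k" using less_imp_Suc_add[OF n] by auto
  have "pw n \<subseteq> cok n" unfolding k(1) cok_Suc
    using set_add_upper(2)[OF mpw_ideal a_cosets(1)] pw_Suc[OF k(2)] by metis
  hence "cok n = pw n" using hidealD(3)[OF cok_hideal] by blast
  hence "ideal_length R (cok n) (pw n) = 0" using ideal_length_same[OF pw_ideal] by simp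
  thus ?thesis using cok_length_rank(1)[OF inj] by (simp add: zero_enat_def)
qed

lemma comb_top:
  assumes c: "\<And>k. c k \<in> carrier R"
  shows "(\<Oplus>k\<in>Ix. if fst k = n then c k \<otimes> Y k else \<zero>) = (\<Oplus>j\<in>{..<rank n}. c (n, j) \<otimes> y n j)"
proof -
  have sub: "Pair n ` {..<rank n} \<subseteq> Ix"
    using rank_eq_0[of n] by (cases "r < n") (auto simp: Ix_def)
  have "(\<Oplus>k\<in>Ix. if fst k = n then c k \<otimes> Y k else \<zero>) = (\<Oplus>k\<in>Pair n ` {..<rank n}. c k \<otimes> Y k)"
    by (rule add.finprod_mono_neutral_cong_right[OF finite_Ix sub])
      (use c Y_carrier in \<open>auto simp: Ix_def\<close>)
  also have "\<dots> = (\<Oplus>j\<in>{..<rank n}. c (n, j) \<otimes> y n j)"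
  proof -
    have "(\<lambda>k. c k \<otimes> Y k) \<in> Pair n ` {..<rank n} \<rightarrow> carrier R"
      using sub by (intro Pi_I m_closed c Y_carrier) blast
    thus ?thesis using add.finprod_reindex[of "\<lambda>k. c k \<otimes> Y k" "Pair n" "{..<rank n}"]
      by (simp add: inj_on_def)
  qed
  finally show ?thesis .
qed

lemma comb_0: 
  assumes c: "\<And>k. c k \<in> carrier R"
  shows "comb 0 c = (\<Oplus>j\<in>{..<rank 0}. c (0, j) \<otimes> y 0 j)"
proof -
  have "comb 0 c = (\<Oplus>k\<in>Ix. if fst k = 0 then c k \<otimes> Y k else \<zero>)"
    unfolding comb_def
  proof (intro finsum_cong' refl)
    show "(\<lambda>k. if fst k = 0 then c k \<otimes> Y k else \<zero>) \<in> Ix \<rightarrow> carrier R"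
    proof
      fix k assume k: "k \<in> Ix"
      show "(if fst k = 0 then c k \<otimes> Y k else \<zero>) \<in> carrier R"
        using m_closed[OF c[of k] Y_carrier[OF k]] by (cases "fst k = 0") simp_all
    qed
    fix k assume k: "k \<in> Ix"
    show "(if 0 < fst k then \<zero> else c k \<otimes> (a [^] (0 - fst k) \<otimes> Y k)) = (if fst k = 0 then c k \<otimes> Y k else \<zero>)"
      using Y_carrier[OF k] by (cases "fst k = 0") simp_all
  qed
  also note comb_top[OF c]
  finally show ?thesis .
qed

text \<open>Passing to the next degree multiplies the old part by \<open>a\<close> and adds the
  basis elements that are new there. The inductions for spanning and for independence both run on
  this recursion.\<close>

lemma comb_Suc:
  assumes c: "\<And>k. c k \<in> carrier R"
  shows "comb (Suc n) c = a \<otimes> comb n c \<oplus> (\<Oplus>j\<in>{..<rank (Suc n)}. c (Suc n, j) \<otimes> y (Suc n) j)"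
proof -
  have "comb (Suc n) c = (\<Oplus>k\<in>Ix. a \<otimes> (if n < fst k then \<zero> else c k \<otimes> (a [^] (n - fst k) \<otimes> Y k))
      \<oplus> (if fst k = Suc n then c k \<otimes> Y k else \<zero>))"
    unfolding comb_def
  proof (intro finsum_cong' refl)
    fix k assume k: "k \<in> Ix"
    consider "Suc n < fst k" | "fst k = Suc n" | "fst k \<le> n" by linarith
    thus "(if Suc n < fst k then \<zero> else c k \<otimes> (a [^] (Suc n - fst k) \<otimes> Y k)) =
      a \<otimes> (if n < fst k then \<zero> else c k \<otimes> (a [^] (n - fst k) \<otimes> Y k))
      \<oplus> (if fst k = Suc n then c k \<otimes> Y k else \<zero>)"
    proof cases
      case 3
      have "Suc n - fst k = Suc (n - fst k)" using 3 by simp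
      thus ?thesis using 3 c[of k] Y_carrier[OF k] a_carrier by (simp add: m_ac)
    qed (use c[of k] Y_carrier[OF k] a_carrier in auto)
  qed (use c Y_carrier a_carrier in auto)
  also have "\<dots> = (\<Oplus>k\<in>Ix. a \<otimes> (if n < fst k then \<zero> else c k \<otimes> (a [^] (n - fst k) \<otimes> Y k)))
      \<oplus> (\<Oplus>k\<in>Ix. if fst k = Suc n then c k \<otimes> Y k else \<zero>)"
    using c Y_carrier a_carrier by (intro finsum_addf) auto
  also have "(\<Oplus>k\<in>Ix. a \<otimes> (if n < fst k then \<zero> else c k \<otimes> (a [^] (n - fst k) \<otimes> Y k))) = a \<otimes> comb n c"
    unfolding comb_def using c Y_carrier a_carrier by (intro finsum_rdistr[symmetric] finite_Ix) auto
  finally show ?thesis unfolding comb_top[OF c] .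
qed

lemma comb_cong:
  assumes "\<And>k. c k \<in> carrier R" "\<And>k. k \<in> Ix \<Longrightarrow> fst k \<le> n \<Longrightarrow> c k = d k"
  shows "comb n c = comb n d"
  unfolding comb_def
proof (intro finsum_cong' refl)
  show "(\<lambda>k. if n < fst k then \<zero> else d k \<otimes> (a [^] (n - fst k) \<otimes> Y k)) \<in> Ix \<rightarrow> carrier R"
  proof
    fix k assume k: "k \<in> Ix"
    show "(if n < fst k then \<zero> else d k \<otimes> (a [^] (n - fst k) \<otimes> Y k)) \<in> carrier R"
      using assms(2)[OF k] assms(1)[of k] Y_carrier[OF k] a_carrier by (auto simp: not_less)
  qed
qed (use assms(2) in auto)

lemma comb_pw: assumes "\<And>k. c k \<in> carrier R" shows "comb n c \<in> pw n"
  unfolding comb_def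
proof (intro ideal_finsum_closed pw_ideal finite_Ix)
  fix k assume k: "k \<in> Ix"
  have "a [^] (n - fst k) \<otimes> Y k \<in> pw (n - fst k + fst k)"
    by (rule pw_mult[OF pow_in_ideal_pow[OF L_ideal a] Y_pw[OF k]])
  thus "(if n < fst k then \<zero> else c k \<otimes> (a [^] (n - fst k) \<otimes> Y k)) \<in> pw n"
    using pw_zero[of n] ideal.I_l_closed[OF pw_ideal[of n] _ assms[of k], of "a [^] (n - fst k) \<otimes> Y k"]
    by (cases "n < fst k") (simp_all add: not_less)
qed

lemma comb_mpw:
  assumes "\<And>k. k \<in> Ix \<Longrightarrow> fst k \<le> n \<Longrightarrow> c k \<in> m" shows "comb n c \<in> mpw n"
  unfolding comb_def
proof (intro ideal_finsum_closed mpw_ideal finite_Ix)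
  fix k assume k: "k \<in> Ix"
  have "a [^] (n - fst k) \<otimes> Y k \<in> pw (n - fst k + fst k)"
    by (rule pw_mult[OF pow_in_ideal_pow[OF L_ideal a] Y_pw[OF k]])
  thus "(if n < fst k then \<zero> else c k \<otimes> (a [^] (n - fst k) \<otimes> Y k)) \<in> mpw n"
    using ideal_zero_closed[OF mpw_ideal] m_mult_pw assms[OF k] by auto
qed

lemma comb_minus:
  assumes "\<And>k. c k \<in> carrier R" "\<And>k. d k \<in> carrier R"
  shows "comb n c \<ominus> comb n d = comb n (\<lambda>k. c k \<ominus> d k)"
proof -
  let ?t = "\<lambda>c k. if n < fst k then \<zero> else c k \<otimes> (a [^] (n - fst k) \<otimes> Y k)"
  have cc: "?t c \<in> Ix \<rightarrow> carrier R" if "\<And>k. c k \<in> carrier R" for c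
    using that Y_carrier a_carrier by auto
  have "comb n c = (\<Oplus>k\<in>Ix. ?t (\<lambda>k. c k \<ominus> d k) k \<oplus> ?t d k)"
    unfolding comb_def
  proof (intro finsum_cong' refl)
    fix k assume k: "k \<in> Ix"
    have alg: "p \<otimes> t = (p \<ominus> q) \<otimes> t \<oplus> q \<otimes> t" if "p \<in> carrier R" "q \<in> carrier R" "t \<in> carrier R" for p q t
      using that by algebra
    have "a [^] (n - fst k) \<otimes> Y k \<in> carrier R" using Y_carrier[OF k] a_carrier by simp
    from alg[OF assms(1)[of k] assms(2)[of k] this]
    show "?t c k = ?t (\<lambda>k. c k \<ominus> d k) k \<oplus> ?t d k" by (cases "n < fst k") simp_all
  qed (use cc[of "\<lambda>k. c k \<ominus> d k"] cc[of d] assms Y_carrier a_carrier in auto)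
  also have "\<dots> = comb n (\<lambda>k. c k \<ominus> d k) \<oplus> comb n d"
    unfolding comb_def using cc[of "\<lambda>k. c k \<ominus> d k"] cc[of d] assms by (intro finsum_addf) auto
  finally have eq: "comb n c = comb n (\<lambda>k. c k \<ominus> d k) \<oplus> comb n d" .
  have "(p \<oplus> q) \<ominus> q = p" if "p \<in> carrier R" "q \<in> carrier R" for p q using that by algebra
  thus ?thesis unfolding eq using pw_carrier[OF comb_pw] assms by simp
qed

lemma basis_sum_pw:
  "(\<And>j. b j \<in> carrier R) \<Longrightarrow> (\<Oplus>j\<in>{..<rank n}. b j \<otimes> y n j) \<in> pw n"
  using basis_pw ideal.I_l_closed[OF pw_ideal] by (intro ideal_finsum_closed pw_ideal) auto

text \<open>Modulo \<open>cok\<close> the new basis elements represent \<open>x\<close>; what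
  remains is \<open>a z\<close> up to \<open>mpw\<close>, with \<open>z\<close> of lower
  degree.\<close>

lemma comb_span: "x \<in> pw n \<Longrightarrow> \<exists>c. (\<forall>k. c k \<in> carrier R) \<and> x \<ominus> comb n c \<in> mpw n"
proof (induction n arbitrary: x)
  case 0
  obtain b where b: "\<forall>j. b j \<in> carrier R" "x \<ominus> (\<Oplus>j\<in>{..<rank 0}. b j \<otimes> y 0 j) \<in> cok 0"
    using basis_span[OF 0] by blast
  have "comb 0 (\<lambda>k. b (snd k)) = (\<Oplus>j\<in>{..<rank 0}. b j \<otimes> y 0 j)" using comb_0[of "\<lambda>k. b (snd k)"] b(1) by simp
  thus ?case using b cok_0 mpw_0 by (intro exI[of _ "\<lambda>k. b (snd k)"]) simp
next
  case (Suc n)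
  obtain b where b: "\<forall>j. b j \<in> carrier R" "x \<ominus> (\<Oplus>j\<in>{..<rank (Suc n)}. b j \<otimes> y (Suc n) j) \<in> cok (Suc n)"
    using basis_span[OF Suc.prems] by blast
  let ?s = "\<Oplus>j\<in>{..<rank (Suc n)}. b j \<otimes> y (Suc n) j"
  have s: "?s \<in> pw (Suc n)"
    by (rule basis_sum_pw) (use b(1) in blast)
  obtain k h where kh: "k \<in> mpw (Suc n)" "h \<in> a <# pw n" "x \<ominus> ?s = k \<oplus> h"
    using b(2) unfolding cok_Suc set_add_iff by blast
  then obtain z where z: "z \<in> pw n" "h = a \<otimes> z" unfolding l_coset_iff by blast
  obtain c where c: "\<forall>k. c k \<in> carrier R" "z \<ominus> comb n c \<in> mpw n" using Suc.IH[OF z(1)] by blast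
  \<comment> \<open>\<open>comb n\<close> ignores coefficients in degree \<open>Suc n\<close>, so
    these can be set freely.\<close>
  let ?c = "\<lambda>k. if fst k = Suc n then b (snd k) else c k"
  have cc: "?c k \<in> carrier R" for k using b(1)[rule_format, of "snd k"] c(1)[rule_format, of k] by simp
  have "comb n ?c = comb n c" by (rule comb_cong[OF cc]) auto
  hence eq: "comb (Suc n) ?c = a \<otimes> comb n c \<oplus> ?s" using comb_Suc[OF cc, of n] by simp
  have cr: "comb n c \<in> carrier R" "k \<in> carrier R" "z \<in> carrier R" "?s \<in> carrier R" "x \<in> carrier R"
    using comb_pw[of c n] c(1) pw_carrier mpw_carrier[OF kh(1)] pw_carrier[OF z(1)] pw_carrier[OF s] pw_carrier[OF Suc.prems] by auto
  have alg: "x \<ominus> (a \<otimes> t \<oplus> s) = k \<oplus> a \<otimes> (z \<ominus> t)"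
    if "x \<ominus> s = k \<oplus> a \<otimes> z" "s \<in> carrier R" "t \<in> carrier R" for s t
  proof -
    have "x \<ominus> (a \<otimes> t \<oplus> s) = (x \<ominus> s) \<ominus> a \<otimes> t" using that(2,3) cr(5) a_carrier by algebra
    also have "\<dots> = k \<oplus> a \<otimes> (z \<ominus> t)" unfolding that(1) using that(2,3) cr(2,3) a_carrier by algebra
    finally show ?thesis .
  qed
  have "x \<ominus> comb (Suc n) ?c = k \<oplus> a \<otimes> (z \<ominus> comb n c)"
    unfolding eq by (rule alg) (use kh(3) z(2) cr in auto)
  moreover have "a \<otimes> (z \<ominus> comb n c) \<in> mpw (Suc n)" using mpw_mult[OF a_pw c(2)] by simp
  ultimately have "x \<ominus> comb (Suc n) ?c \<in> mpw (Suc n)" using ideal_add_closed[OF mpw_ideal kh(1)] by simp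
  thus ?case using cc by (intro exI[of _ ?c]) auto
qed

text \<open>Modulo \<open>cok\<close> only the new basis elements remain, so their coefficients lie
  in \<open>m\<close>. The rest is \<open>a\<close> times a combination of lower degree, and
  injectivity removes \<open>a\<close>.\<close>

lemma comb_indep:
  assumes "\<And>k. c k \<in> carrier R"
  shows "comb n c \<in> mpw n \<Longrightarrow> k \<in> Ix \<Longrightarrow> fst k \<le> n \<Longrightarrow> c k \<in> m"
proof (induction n arbitrary: k)
  case 0
  have "(\<Oplus>j\<in>{..<rank 0}. c (0, j) \<otimes> y 0 j) \<in> cok 0" using 0 comb_0[OF assms] cok_0 mpw_0 by simp
  hence "c (0, snd k) \<in> m" using basis_indep[of "\<lambda>j. c (0, j)" 0 "snd k"] assms 0 by (auto simp: Ix_def)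
  moreover have "k = (0, snd k)" using 0 by (cases k) auto
  ultimately show ?case by simp
next
  case (Suc n)
  let ?s = "\<Oplus>j\<in>{..<rank (Suc n)}. c (Suc n, j) \<otimes> y (Suc n) j"
  have cb: "comb n c \<in> pw n" by (rule comb_pw[OF assms])
  have s: "?s \<in> pw (Suc n)"
    by (rule basis_sum_pw[OF assms])
  have cr: "a \<otimes> comb n c \<in> carrier R" "?s \<in> carrier R" using pw_carrier[OF cb] pw_carrier[OF s] a_carrier by auto
  have eq: "comb (Suc n) c = a \<otimes> comb n c \<oplus> ?s" by (rule comb_Suc[OF assms])
  have ac: "a \<otimes> comb n c \<in> cok (Suc n)"
  proof -
    have "a \<otimes> comb n c \<in> a <# pw n" unfolding l_coset_iff using cb by blast
    thus ?thesis unfolding cok_Suc by (rule subsetD[OF set_add_upper(2)[OF mpw_ideal a_cosets(1)]])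
  qed
  have pq: "(p \<oplus> q) \<ominus> p = q" "(p \<oplus> q) \<ominus> q = p" if "p \<in> carrier R" "q \<in> carrier R" for p q
    using that by algebra+
  have "comb (Suc n) c \<in> cok (Suc n)" using Suc.prems(1) hidealD(2)[OF cok_hideal] by blast
  hence "comb (Suc n) c \<ominus> a \<otimes> comb n c \<in> cok (Suc n)"
    by (rule ideal_minus_closed[OF hidealD(1)[OF cok_hideal] _ ac])
  hence "?s \<in> cok (Suc n)" unfolding eq pq(1)[OF cr] .
  hence top: "c (Suc n, j) \<in> m" if "j < rank (Suc n)" for j
    using basis_indep[of "\<lambda>j. c (Suc n, j)" "Suc n" j] assms that by blast
  show ?case
  proof (cases "fst k = Suc n")
    case True
    hence "k = (Suc n, snd k)" "snd k < rank (Suc n)" using Suc.prems(2) by (cases k; auto simp: Ix_def)+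
    thus ?thesis using top by metis
  next
    case False
    have "?s \<in> mpw (Suc n)"
      by (intro ideal_finsum_closed mpw_ideal m_mult_pw) (use top basis_pw in \<open>simp_all del: ideal_pow.simps\<close>)
    hence "comb (Suc n) c \<ominus> ?s \<in> mpw (Suc n)" by (rule ideal_minus_closed[OF mpw_ideal Suc.prems(1)])
    hence "a \<otimes> comb n c \<in> mpw (Suc n)" unfolding eq pq(2)[OF cr] .
    hence "comb n c \<in> mpw n" using inj cb unfolding inj_at_def by blast
    thus ?thesis using Suc.IH Suc.prems False by auto
  qed
qed

lemma fib_finsum:
  assumes "finite S" "\<And>k. k \<in> S \<Longrightarrow> t k \<in> rees"
  shows "(\<lambda>n. \<Oplus>k\<in>S. t k n) \<in> rees \<and> (\<Oplus>\<^bsub>F\<^esub>k\<in>S. fib (t k)) = fib (\<lambda>n. \<Oplus>k\<in>S. t k n)"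
proof -
  interpret F: cring F by (rule F_cring)
  show ?thesis using assms
  proof (induction rule: finite_induct)
    case empty thus ?case using zero_rees fib_zero by simp
  next
    case (insert k S)
    have tk: "t k \<in> rees" and tS: "\<And>j. j \<in> S \<Longrightarrow> t j \<in> rees" using insert by auto
    have eq: "(\<lambda>n. \<Oplus>j\<in>insert k S. t j n) = (\<lambda>n. t k n \<oplus> (\<Oplus>j\<in>S. t j n))"
      using insert(1,2) rees_carrier[OF tk] rees_carrier[OF tS] by (subst finsum_insert) auto
    have "(\<Oplus>\<^bsub>F\<^esub>j\<in>insert k S. fib (t j)) = fib (t k) \<oplus>\<^bsub>F\<^esub> (\<Oplus>\<^bsub>F\<^esub>j\<in>S. fib (t j))"
      using insert(1,2) fib_closed[OF tk] fib_closed[OF tS] by (subst F.finsum_insert) auto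
    also have "\<dots> = fib (\<lambda>n. t k n \<oplus> (\<Oplus>j\<in>S. t j n))"
      using insert tS fib_add[OF tk] by simp
    finally show ?case unfolding eq using add_rees[OF tk] insert tS by simp
  qed
qed

text \<open>The inverse of the isomorphism in condition (7).\<close>

definition assemble where
  "assemble \<phi> = (\<Oplus>\<^bsub>F\<^esub>k\<in>Ix. incl (\<phi> k) \<otimes>\<^bsub>F\<^esub> homog (fst k) (Y k))"

text \<open>Translates the sum in \<open>F\<close> into coefficients, so that spanning and
  independence of \<open>comb\<close> become surjectivity and injectivity.\<close>

lemma assemble_formula:
  assumes "\<And>k. k \<in> Ix \<Longrightarrow> cs k \<in> fin_seqs \<and> \<phi> k = J.fib (scal (cs k))"
  shows "(\<lambda>n. comb n (\<lambda>k. cs k (n - fst k))) \<in> rees"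
    "assemble \<phi> = fib (\<lambda>n. comb n (\<lambda>k. cs k (n - fst k)))"
proof -
  interpret F: cring F by (rule F_cring)
  let ?t = "\<lambda>k n. if n < fst k then \<zero> else cs k (n - fst k) \<otimes> (a [^] (n - fst k) \<otimes> Y k)"
  have t: "?t k \<in> rees \<and> incl (\<phi> k) \<otimes>\<^bsub>F\<^esub> homog (fst k) (Y k) = fib (?t k)" if k: "k \<in> Ix" for k
  proof -
    have c: "cs k \<in> fin_seqs" "\<phi> k = J.fib (scal (cs k))" using assms[OF k] by auto
    have sr: "scal (cs k) \<in> rees" using scal_rees[OF c(1)] J_rees by blast
    have eq: "(\<lambda>n. if n < fst k then \<zero> else Y k \<otimes> scal (cs k) (n - fst k)) = ?t k"
      using Y_carrier[OF k] fin_seqs_carrier[OF c(1)] a_carrier by (auto simp: fun_eq_iff m_ac)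
    have "incl (\<phi> k) \<otimes>\<^bsub>F\<^esub> homog (fst k) (Y k) = homog (fst k) (Y k) \<otimes>\<^bsub>F\<^esub> fib (scal (cs k))"
      unfolding c(2) incl_fib[OF scal_rees[OF c(1)]] using F.m_comm fib_closed[OF sr] homog_closed[OF Y_pw[OF k]] by simp
    also have "\<dots> = fib (?t k)" unfolding homog_mult_fib[OF Y_pw[OF k] sr] eq ..
    finally show ?thesis
      using conv_rees[OF mono_rees[OF Y_pw[OF k]] sr] conv_mono[OF Y_pw[OF k] sr] eq by simp
  qed
  have "assemble \<phi> = (\<Oplus>\<^bsub>F\<^esub>k\<in>Ix. fib (?t k))"
    unfolding assemble_def using t fib_closed by (intro F.finsum_cong') auto
  thus "(\<lambda>n. comb n (\<lambda>k. cs k (n - fst k))) \<in> rees" "assemble \<phi> = fib (\<lambda>n. comb n (\<lambda>k. cs k (n - fst k)))"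
    using fib_finsum[OF finite_Ix, of ?t] t unfolding comb_def by auto
qed

lemma seqs_of:
  assumes "\<phi> \<in> (\<Pi>\<^sub>E k\<in>Ix. carrier J.F)"
  shows "\<exists>cs. \<forall>k. cs k \<in> fin_seqs \<and> (k \<in> Ix \<longrightarrow> \<phi> k = J.fib (scal (cs k)))"
proof -
  have "\<exists>c. c \<in> fin_seqs \<and> (k \<in> Ix \<longrightarrow> \<phi> k = J.fib (scal c))" for k
  proof (cases "k \<in> Ix")
    case True thus ?thesis using J_rep[OF PiE_mem[OF assms True]] by blast
  next
    case False
    have "(\<lambda>_. \<zero>) \<in> fin_seqs" by (simp add: fin_seqs_def)
    thus ?thesis using False by blast
  qed
  thus ?thesis by metis
qed

lemma assemble_closed:
  assumes "\<phi> \<in> (\<Pi>\<^sub>E k\<in>Ix. carrier J.F)" shows "assemble \<phi> \<in> carrier F"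
proof -
  obtain cs where "\<And>k. cs k \<in> fin_seqs" "\<And>k. k \<in> Ix \<Longrightarrow> \<phi> k = J.fib (scal (cs k))"
    using seqs_of[OF assms] by blast
  hence *: "\<And>k. k \<in> Ix \<Longrightarrow> cs k \<in> fin_seqs \<and> \<phi> k = J.fib (scal (cs k))" by blast
  have "fib (\<lambda>n. comb n (\<lambda>k. cs k (n - fst k))) \<in> carrier F"
    by (rule fib_closed, rule assemble_formula(1), rule *)
  thus ?thesis using assemble_formula(2)[of cs \<phi>] * by simp
qed

lemma assemble_inj: "inj_on assemble (\<Pi>\<^sub>E k\<in>Ix. carrier J.F)"
proof (rule inj_onI)
  fix \<phi> \<psi> assume p: "\<phi> \<in> (\<Pi>\<^sub>E k\<in>Ix. carrier J.F)" and q: "\<psi> \<in> (\<Pi>\<^sub>E k\<in>Ix. carrier J.F)"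
    and eq: "assemble \<phi> = assemble \<psi>"
  obtain c where c: "\<And>k. c k \<in> fin_seqs" "\<And>k. k \<in> Ix \<Longrightarrow> \<phi> k = J.fib (scal (c k))" using seqs_of[OF p] by blast
  obtain d where d: "\<And>k. d k \<in> fin_seqs" "\<And>k. k \<in> Ix \<Longrightarrow> \<psi> k = J.fib (scal (d k))" using seqs_of[OF q] by blast
  have fc: "(\<lambda>n. comb n (\<lambda>k. c k (n - fst k))) \<in> rees" "assemble \<phi> = fib (\<lambda>n. comb n (\<lambda>k. c k (n - fst k)))"
    using assemble_formula[of c \<phi>] c by blast+
  have fd: "(\<lambda>n. comb n (\<lambda>k. d k (n - fst k))) \<in> rees" "assemble \<psi> = fib (\<lambda>n. comb n (\<lambda>k. d k (n - fst k)))"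
    using assemble_formula[of d \<psi>] d by blast+
  have cc: "c k n \<in> carrier R" "d k n \<in> carrier R" for k n using fin_seqs_carrier[OF c(1)] fin_seqs_carrier[OF d(1)] by blast+
  have diff: "comb n (\<lambda>k. c k (n - fst k)) \<ominus> comb n (\<lambda>k. d k (n - fst k)) \<in> mpw n" for n
    using eq fib_eq_iff[OF fc(1) fd(1)] fc(2) fd(2) by simp
  have "\<phi> k = \<psi> k" for k
  proof (cases "k \<in> Ix")
    case True
    have "c k l \<ominus> d k l \<in> m" for l
    proof -
      \<comment> \<open>The coefficient of index \<open>l\<close> at \<open>k\<close> shows up in
        this degree.\<close>
      let ?n = "l + fst k"
      have "comb ?n (\<lambda>k. c k (?n - fst k) \<ominus> d k (?n - fst k)) \<in> mpw ?n"
        using diff[of ?n] comb_minus[of "\<lambda>k. c k (?n - fst k)" "\<lambda>k. d k (?n - fst k)" ?n] cc by simp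
      from comb_indep[OF _ this True] show ?thesis using cc by simp
    qed
    thus ?thesis using c d True J_fib_eq_iff[OF c(1)[of k] d(1)[of k]] by simp
  next
    case False
    show ?thesis unfolding PiE_arb[OF p False] PiE_arb[OF q False] ..
  qed
  thus "\<phi> = \<psi>" by blast
qed

text \<open>The set \<open>D\<close> of degrees serves two purposes: taken as everything it gives
  surjectivity, taken as at most one degree it gives compatibility with the grading.\<close>

lemma assemble_surj_supported:
  assumes p: "p \<in> rees" "\<And>n. n \<notin> D \<Longrightarrow> p n = \<zero>"
  shows "\<exists>\<phi>\<in>(\<Pi>\<^sub>E k\<in>Ix. carrier J.F). assemble \<phi> = fib p \<and>
    (\<forall>k\<in>Ix. \<forall>l. l + fst k \<notin> D \<longrightarrow> \<phi> k l = \<zero>\<^bsub>fiber_piece R m (PIdl a) l\<^esub>)"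
proof -
  have "\<exists>c. (\<forall>k. c k \<in> carrier R) \<and> p n \<ominus> comb n c \<in> mpw n \<and> (p n = \<zero> \<longrightarrow> c = (\<lambda>_. \<zero>))" for n
  proof (cases "p n = \<zero>")
    case True
    have "comb n (\<lambda>_. \<zero>) \<in> mpw n" using ideal_zero_closed[OF m_ideal] by (intro comb_mpw)
    hence "\<zero> \<ominus> comb n (\<lambda>_. \<zero>) \<in> mpw n" using ideal_minus_closed[OF mpw_ideal ideal_zero_closed[OF mpw_ideal]] by blast
    thus ?thesis using True by auto
  next
    case False
    thus ?thesis using comb_span[OF rees_pw[OF p(1)]] by blast
  qed
  then obtain c where c: "\<And>n k. c n k \<in> carrier R" "\<And>n. p n \<ominus> comb n (c n) \<in> mpw n"
    "\<And>n. p n = \<zero> \<Longrightarrow> c n = (\<lambda>_. \<zero>)" by metis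
  obtain N where N: "\<And>n. n > N \<Longrightarrow> p n = \<zero>" using p(1) unfolding rees_def by blast
  \<comment> \<open>The coefficient of \<open>a^l\<close> at the basis element \<open>k\<close> is
    read off in degree \<open>l + fst k\<close>.\<close>
  define cs where "cs k l = c (l + fst k) k" for k l
  have csf: "cs k \<in> fin_seqs" for k
    unfolding fin_seqs_def cs_def using c(1,3) N by (auto intro!: exI[of _ N])
  define \<phi> where "\<phi> = (\<lambda>k\<in>Ix. J.fib (scal (cs k)))"
  have P: "\<phi> \<in> (\<Pi>\<^sub>E k\<in>Ix. carrier J.F)" unfolding \<phi>_def using J.fib_closed[OF scal_rees[OF csf]] by auto
  have f: "(\<lambda>n. comb n (\<lambda>k. cs k (n - fst k))) \<in> rees" "assemble \<phi> = fib (\<lambda>n. comb n (\<lambda>k. cs k (n - fst k)))"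
    using assemble_formula[of cs \<phi>] csf by (auto simp: \<phi>_def)
  have "comb n (\<lambda>k. cs k (n - fst k)) = comb n (c n)" for n
    by (rule comb_cong) (auto simp: cs_def c(1))
  hence "assemble \<phi> = fib p" using f fib_eq_iff[OF p(1) f(1)] c(2) by simp
  moreover have "\<phi> k l = \<zero>\<^bsub>fiber_piece R m (PIdl a) l\<^esub>" if "k \<in> Ix" "l + fst k \<notin> D" for k l
  proof -
    have "cs k l = \<zero>" using c(3)[OF p(2)[OF that(2)]] by (simp add: cs_def)
    thus ?thesis using J_fib_zero_iff[OF csf] that(1) ideal_zero_closed[OF m_ideal] by (simp add: \<phi>_def)
  qed
  ultimately show ?thesis using P by blast
qed

abbreviation dsum where
  "dsum \<equiv> graded_sum Ix (\<lambda>(i, _). graded_shift (fiber_module R m (PIdl a)) (- int i))"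

lemma dsum_simps:
  "carrier dsum = (\<Pi>\<^sub>E k\<in>Ix. carrier J.F)"
  "\<phi> \<oplus>\<^bsub>dsum\<^esub> \<psi> = (\<lambda>k\<in>Ix. \<phi> k \<oplus>\<^bsub>J.F\<^esub> \<psi> k)"
  "c \<odot>\<^bsub>dsum\<^esub> \<phi> = (\<lambda>k\<in>Ix. c \<odot>\<^bsub>fiber_module R m (PIdl a)\<^esub> \<phi> k)"
  "degree_part dsum d = (\<Pi>\<^sub>E k\<in>Ix. {f \<in> carrier J.F. \<forall>l. int l \<noteq> d - int (fst k) \<longrightarrow> f l = \<zero>\<^bsub>fiber_piece R m (PIdl a) l\<^esub>})"
  by (auto simp: graded_sum_def graded_shift_def fiber_module_def restrict_def fun_eq_iff intro!: PiE_cong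
      split: prod.splits)

lemma assemble_add:
  assumes "\<phi> \<in> carrier dsum" "\<psi> \<in> carrier dsum"
  shows "assemble (\<phi> \<oplus>\<^bsub>dsum\<^esub> \<psi>) = assemble \<phi> \<oplus>\<^bsub>F\<^esub> assemble \<psi>"
proof -
  interpret F: cring F by (rule F_cring)
  have c: "\<phi> k \<in> carrier J.F" "\<psi> k \<in> carrier J.F" if "k \<in> Ix" for k
    using assms that unfolding dsum_simps by auto
  have "assemble (\<phi> \<oplus>\<^bsub>dsum\<^esub> \<psi>) = (\<Oplus>\<^bsub>F\<^esub>k\<in>Ix. incl (\<phi> k) \<otimes>\<^bsub>F\<^esub> homog (fst k) (Y k) \<oplus>\<^bsub>F\<^esub> incl (\<psi> k) \<otimes>\<^bsub>F\<^esub> homog (fst k) (Y k))"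
    unfolding assemble_def dsum_simps using c incl_add incl_closed homog_closed[OF Y_pw]
    by (intro F.finsum_cong') (auto simp: F.l_distr)
  thus ?thesis unfolding assemble_def using c incl_closed homog_closed[OF Y_pw] by (simp add: F.finsum_addf)
qed

lemma assemble_smult:
  assumes "c \<in> carrier J.F" "\<phi> \<in> carrier dsum"
  shows "assemble (c \<odot>\<^bsub>dsum\<^esub> \<phi>) = incl c \<otimes>\<^bsub>F\<^esub> assemble \<phi>"
proof -
  interpret F: cring F by (rule F_cring)
  have p: "\<phi> k \<in> carrier J.F" if "k \<in> Ix" for k
    using assms that unfolding dsum_simps by auto
  have "assemble (c \<odot>\<^bsub>dsum\<^esub> \<phi>) = (\<Oplus>\<^bsub>F\<^esub>k\<in>Ix. incl c \<otimes>\<^bsub>F\<^esub> (incl (\<phi> k) \<otimes>\<^bsub>F\<^esub> homog (fst k) (Y k)))"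
    unfolding assemble_def dsum_simps using p assms(1) incl_mult incl_closed homog_closed[OF Y_pw] J_smult
    by (intro F.finsum_cong') (auto simp: F.m_assoc)
  thus ?thesis unfolding assemble_def using p assms(1) incl_closed homog_closed[OF Y_pw] finite_Ix
    by (subst F.finsum_rdistr) auto
qed

lemma dsum_closed:
  assumes "\<phi> \<in> carrier dsum"
  shows "\<psi> \<in> carrier dsum \<Longrightarrow> \<phi> \<oplus>\<^bsub>dsum\<^esub> \<psi> \<in> carrier dsum"
    "c \<in> carrier J.F \<Longrightarrow> c \<odot>\<^bsub>dsum\<^esub> \<phi> \<in> carrier dsum"
proof -
  interpret JF: cring J.F by (rule J.F_cring)
  show "\<psi> \<in> carrier dsum \<Longrightarrow> \<phi> \<oplus>\<^bsub>dsum\<^esub> \<psi> \<in> carrier dsum"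
    "c \<in> carrier J.F \<Longrightarrow> c \<odot>\<^bsub>dsum\<^esub> \<phi> \<in> carrier dsum"
    using assms J_smult unfolding dsum_simps by (auto simp: PiE_def Pi_def)
qed

lemma assemble_bij: "bij_betw assemble (carrier dsum) (carrier F)"
  unfolding bij_betw_def
proof
  show "inj_on assemble (carrier dsum)" unfolding dsum_simps by (rule assemble_inj)
  show "assemble ` carrier dsum = carrier F"
  proof
    show "assemble ` carrier dsum \<subseteq> carrier F" unfolding dsum_simps using assemble_closed by blast
    show "carrier F \<subseteq> assemble ` carrier dsum"
    proof
      fix f assume "f \<in> carrier F"
      then obtain p where p: "p \<in> rees" "f = fib p" using fib_surj by blast
      show "f \<in> assemble ` carrier dsum"
        using assemble_surj_supported[OF p(1), of UNIV] unfolding p(2) dsum_simps by (metis UNIV_I imageI)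
    qed
  qed
qed

lemma assemble_degree: "assemble ` degree_part dsum d = degree_part (fiber_module R m L) d"
proof
  have M: "degree_part (fiber_module R m L) d = {f \<in> carrier F. \<forall>n. int n \<noteq> d \<longrightarrow> f n = mpw n}"
    by (simp add: fiber_module_def piece_zero)
  show "assemble ` degree_part dsum d \<subseteq> degree_part (fiber_module R m L) d"
  proof
    fix f assume "f \<in> assemble ` degree_part dsum d"
    then obtain \<phi> where p: "\<phi> \<in> degree_part dsum d" "f = assemble \<phi>" by blast
    have P: "\<phi> \<in> (\<Pi>\<^sub>E k\<in>Ix. carrier J.F)"
      using p(1) PiE_mono[of Ix "\<lambda>k. {f \<in> carrier J.F. \<forall>l. int l \<noteq> d - int (fst k) \<longrightarrow> f l = \<zero>\<^bsub>fiber_piece R m (PIdl a) l\<^esub>}" "\<lambda>_. carrier J.F"]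
      unfolding dsum_simps by blast
    obtain c where c: "\<And>k. c k \<in> fin_seqs" "\<And>k. k \<in> Ix \<Longrightarrow> \<phi> k = J.fib (scal (c k))" using seqs_of[OF P] by blast
    have f: "(\<lambda>n. comb n (\<lambda>k. c k (n - fst k))) \<in> rees" "f = fib (\<lambda>n. comb n (\<lambda>k. c k (n - fst k)))"
      using assemble_formula[of c \<phi>] c p(2) by blast+
    have "f n = mpw n" if n: "int n \<noteq> d" for n
    proof -
      have "c k (n - fst k) \<in> m" if k: "k \<in> Ix" "fst k \<le> n" for k
      proof -
        have "int (n - fst k) \<noteq> d - int (fst k)" using k n by (simp add: of_nat_diff)
        hence "\<phi> k (n - fst k) = \<zero>\<^bsub>fiber_piece R m (PIdl a) (n - fst k)\<^esub>"
          using PiE_mem[OF p(1)[unfolded dsum_simps] k(1)] by blast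
        thus ?thesis using J_fib_zero_iff[OF c(1)] c(2)[OF k(1)] by simp
      qed
      hence "comb n (\<lambda>k. c k (n - fst k)) \<in> mpw n" by (rule comb_mpw)
      thus ?thesis unfolding f(2) fib_def
        using coset_eq_zero_iff[OF mpw_ideal rees_carrier[OF f(1), of n]] by simp
    qed
    thus "f \<in> degree_part (fiber_module R m L) d" unfolding M using assemble_closed[OF P] p(2) by blast
  qed
  show "degree_part (fiber_module R m L) d \<subseteq> assemble ` degree_part dsum d"
  proof
    fix f assume "f \<in> degree_part (fiber_module R m L) d"
    hence f: "f \<in> carrier F" "\<And>n. int n \<noteq> d \<Longrightarrow> f n = mpw n" unfolding M by auto
    then obtain q where q: "q \<in> rees" "f = fib q" using fib_surj by blast
    \<comment> \<open>Dropping the other coefficients changes no coset and leaves at most one degree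
      in the support.\<close>
    define p where "p n = (if int n = d then q n else \<zero>)" for n
    have p: "p \<in> rees" using q(1) pw_zero unfolding rees_def p_def by auto
    have "fib q = fib p"
    proof
      fix n show "fib q n = fib p n"
        using f(2)[of n] q(2) coset_zero[OF mpw_ideal, of n] by (auto simp: fib_def p_def)
    qed
    moreover obtain \<phi> where ph: "\<phi> \<in> (\<Pi>\<^sub>E k\<in>Ix. carrier J.F)" "assemble \<phi> = fib p"
      "\<And>k l. k \<in> Ix \<Longrightarrow> l + fst k \<notin> {n. int n = d} \<Longrightarrow> \<phi> k l = \<zero>\<^bsub>fiber_piece R m (PIdl a) l\<^esub>"
      using assemble_surj_supported[OF p, of "{n. int n = d}"] by (auto simp: p_def)
    moreover have "\<phi> \<in> degree_part dsum d" unfolding dsum_simps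
    proof (rule PiE_I)
      fix k assume k: "k \<in> Ix"
      have "\<phi> k l = \<zero>\<^bsub>fiber_piece R m (PIdl a) l\<^esub>" if "int l \<noteq> d - int (fst k)" for l
        by (rule ph(3)[OF k]) (use that in auto)
      thus "\<phi> k \<in> {f \<in> carrier J.F. \<forall>l. int l \<noteq> d - int (fst k) \<longrightarrow> f l = \<zero>\<^bsub>fiber_piece R m (PIdl a) l\<^esub>}"
        using PiE_mem[OF ph(1) k] by blast
    qed (use PiE_arb[OF ph(1)] in blast)
    ultimately show "f \<in> assemble ` degree_part dsum d" using q(2) by (metis imageI)
  qed
qed

text \<open>Linearity and degrees were checked for \<open>assemble\<close>, which is an explicit
  sum; here they are carried over to its inverse.\<close>

lemma decomposition: "graded_isomorphic J.F (fiber_module R m L) dsum"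
proof -
  define h where "h = inv_into (carrier dsum) assemble"
  note inj = bij_betw_imp_inj_on[OF assemble_bij]
  have hc: "h x \<in> carrier dsum" "assemble (h x) = x" if "x \<in> carrier F" for x
  proof -
    have "x \<in> assemble ` carrier dsum" using that bij_betw_imp_surj_on[OF assemble_bij] by simp
    thus "h x \<in> carrier dsum" "assemble (h x) = x"
      unfolding h_def by (rule inv_into_into, rule f_inv_into_f)
  qed
  have hI: "h (assemble \<phi>) = \<phi>" if "\<phi> \<in> carrier dsum" for \<phi>
    unfolding h_def using inv_into_f_f[OF inj that] .
  show ?thesis unfolding graded_isomorphic_def
  proof (intro exI[of _ h] conjI ballI allI)
    show "bij_betw h (carrier (fiber_module R m L)) (carrier dsum)"
      unfolding h_def fiber_module_simps by (rule bij_betw_inv_into[OF assemble_bij])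
  next
    fix x z assume "x \<in> carrier (fiber_module R m L)" "z \<in> carrier (fiber_module R m L)"
    hence xz: "x \<in> carrier F" "z \<in> carrier F" by (simp_all add: fiber_module_simps)
    have "h (x \<oplus>\<^bsub>F\<^esub> z) = h (assemble (h x \<oplus>\<^bsub>dsum\<^esub> h z))"
      using assemble_add hc xz by simp
    also have "\<dots> = h x \<oplus>\<^bsub>dsum\<^esub> h z" by (rule hI[OF dsum_closed(1)]) (use hc xz in auto)
    finally show "h (x \<oplus>\<^bsub>fiber_module R m L\<^esub> z) = h x \<oplus>\<^bsub>dsum\<^esub> h z" by (simp add: fiber_module_simps)
  next
    fix c x assume c: "c \<in> carrier J.F" and "x \<in> carrier (fiber_module R m L)"
    hence x: "x \<in> carrier F" by (simp add: fiber_module_simps)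
    have "h (incl c \<otimes>\<^bsub>F\<^esub> x) = h (assemble (c \<odot>\<^bsub>dsum\<^esub> h x))"
      using assemble_smult[OF c] hc x by simp
    also have "\<dots> = c \<odot>\<^bsub>dsum\<^esub> h x" by (rule hI[OF dsum_closed(2)]) (use hc x c in auto)
    finally show "h (c \<odot>\<^bsub>fiber_module R m L\<^esub> x) = c \<odot>\<^bsub>dsum\<^esub> h x" by (simp add: smult_incl)
  next
    fix d
    have "degree_part dsum d \<subseteq> carrier dsum" unfolding dsum_simps by (rule PiE_mono) blast
    thus "h ` degree_part (fiber_module R m L) d = degree_part dsum d"
      unfolding assemble_degree[symmetric] h_def by (rule inv_into_image_cancel[OF inj])
  qed
qed

end

section \<open>The decomposition condition\<close>

context principal_reduction
begin

text \<open>The monotonicity clause makes the exponents, which are truncated differences, the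
  intended ones.\<close>

lemma decomposition_condition_iff:
  "(\<forall>i\<le>r. mu_pow R L (int i - 1) \<le> mu_pow R L (int i)) \<and>
    graded_isomorphic (fiber_cone R m (PIdl a)) (fiber_module R m L)
      (graded_sum (SIGMA i:{0..r}. {..<mu_pow R L (int i) - mu_pow R L (int i - 1)})
        (\<lambda>(i, _). graded_shift (fiber_module R m (PIdl a)) (- int i)))
    \<longleftrightarrow> (\<forall>n. inj_at n)"
proof
  assume inj: "\<forall>n. inj_at n"
  define B where "B n y \<longleftrightarrow> (\<forall>j<rank n. y j \<in> pw n) \<and>
    (\<forall>x\<in>pw n. \<exists>c. (\<forall>j. c j \<in> carrier R) \<and> x \<ominus> (\<Oplus>j\<in>{..<rank n}. c j \<otimes> y j) \<in> cok n) \<and>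
    (\<forall>c. (\<forall>j. c j \<in> carrier R) \<and> (\<Oplus>j\<in>{..<rank n}. c j \<otimes> y j) \<in> cok n \<longrightarrow> (\<forall>j<rank n. c j \<in> m))" for n y
  have "\<exists>y. B n y" for n
    unfolding B_def
    by (rule exists_basis_mod[OF hidealD(1)[OF cok_hideal] pw_ideal hidealD(3)[OF cok_hideal]
          hidealD(2)[OF cok_hideal] cok_length_rank(1)]) (use inj in blast)
  then obtain y where By: "\<And>n. B n (y n)" by metis
  note By' = By[unfolded B_def, THEN conjunct1] By[unfolded B_def, THEN conjunct2, THEN conjunct1]
    By[unfolded B_def, THEN conjunct2, THEN conjunct2]
  have y: "\<And>n j. j < rank n \<Longrightarrow> y n j \<in> pw n"
    "\<And>n x. x \<in> pw n \<Longrightarrow> \<exists>c. (\<forall>j. c j \<in> carrier R) \<and> x \<ominus> (\<Oplus>j\<in>{..<rank n}. c j \<otimes> y n j) \<in> cok n"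
    "\<And>n c. (\<forall>j. c j \<in> carrier R) \<and> (\<Oplus>j\<in>{..<rank n}. c j \<otimes> y n j) \<in> cok n \<Longrightarrow> (\<forall>j<rank n. c j \<in> m)"
    by (rule By'(1)[rule_format], assumption) (rule By'(2)[rule_format], assumption,
      rule By'(3)[THEN spec, THEN mp], assumption)
  interpret graded_basis R m L a r y
  proof (intro graded_basis.intro graded_basis_axioms.intro principal_reduction_axioms)
    show "inj_at n" for n using inj by blast
    show "j < rank n \<Longrightarrow> y n j \<in> pw n" for n j by (rule y(1))
    show "x \<in> pw n \<Longrightarrow> \<exists>c. (\<forall>j. c j \<in> carrier R) \<and> x \<ominus> (\<Oplus>j\<in>{..<rank n}. c j \<otimes> y n j) \<in> cok n" for n x
      by (rule y(2))
    show "(\<And>j. c j \<in> carrier R) \<Longrightarrow> (\<Oplus>j\<in>{..<rank n}. c j \<otimes> y n j) \<in> cok n \<Longrightarrow> j < rank n \<Longrightarrow> c j \<in> m"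
      for n c j
    proof -
      assume c: "\<And>j. c j \<in> carrier R" "(\<Oplus>j\<in>{..<rank n}. c j \<otimes> y n j) \<in> cok n" and j: "j < rank n"
      have "\<forall>j<rank n. c j \<in> m" by (rule y(3)) (intro conjI allI c)
      thus "c j \<in> m" using j by simp
    qed
  qed
  show "(\<forall>i\<le>r. mu_pow R L (int i - 1) \<le> mu_pow R L (int i)) \<and>
    graded_isomorphic (fiber_cone R m (PIdl a)) (fiber_module R m L)
      (graded_sum (SIGMA i:{0..r}. {..<mu_pow R L (int i) - mu_pow R L (int i - 1)})
        (\<lambda>(i, _). graded_shift (fiber_module R m (PIdl a)) (- int i)))"
    using decomposition cok_length_rank(2) inj unfolding Ix_def rank_def by blast
next
  assume *: "(\<forall>i\<le>r. mu_pow R L (int i - 1) \<le> mu_pow R L (int i)) \<and>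
    graded_isomorphic (fiber_cone R m (PIdl a)) (fiber_module R m L)
      (graded_sum (SIGMA i:{0..r}. {..<mu_pow R L (int i) - mu_pow R L (int i - 1)})
        (\<lambda>(i, _). graded_shift (fiber_module R m (PIdl a)) (- int i)))"
  show "\<forall>n. inj_at n"
    by (rule allI, rule decomposition_imp_inj[where d = "\<lambda>i. - int i"], rule conjunct2[OF *])
qed

end

section \<open>Independence of the minimal reduction\<close>

context fiber_ring
begin

text \<open>A power of a non-zero-divisor of \<open>L\<close> is a multiple of \<open>a\<close>, so
  whatever \<open>a\<close> kills is killed by that power.\<close>

lemma reduction_generator_nonzerodivisor:
  assumes "regular_ideal R L" and a: "a \<in> carrier R" and red: "reduction R L (PIdl a)"
  shows "nonzerodivisor R a"
proof -
  obtain x where x: "x \<in> L" "nonzerodivisor R x" using assms(1) by (auto simp: regular_ideal_def)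
  have xc: "x \<in> carrier R" using x(1) ideal.Icarr[OF L_ideal] by blast
  obtain n where "pw (n + 1) = (PIdl a) \<cdot> pw n" using red by (auto simp: reduction_def)
  hence "pw (Suc n) = a <# pw n" using PIdl_prod[OF pw_ideal a] by simp
  then obtain z where z: "z \<in> pw n" "x [^] (Suc n) = a \<otimes> z"
    using pow_in_ideal_pow[OF L_ideal x(1), of "Suc n"] unfolding l_coset_def by blast
  have pow: "y = \<zero>" if "y \<in> carrier R" "x [^] k \<otimes> y = \<zero>" for y and k :: nat
    using that(2)
  proof (induction k)
    case (Suc k)
    have "x \<otimes> (x [^] k \<otimes> y) = \<zero>" using Suc.prems xc that(1) by (simp add: m_ac)
    hence "x [^] k \<otimes> y = \<zero>" by (rule nonzerodivisorD[OF x(2), rotated]) (use xc that(1) in simp)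
    thus ?case by (rule Suc.IH)
  qed (use that(1) in simp)
  have "y = \<zero>" if y: "y \<in> carrier R" "a \<otimes> y = \<zero>" for y
  proof (rule pow[OF y(1)])
    have "(a \<otimes> z) \<otimes> y = z \<otimes> (a \<otimes> y)" using a y(1) pw_carrier[OF z(1)] by (simp add: m_ac)
    thus "x [^] (Suc n) \<otimes> y = \<zero>" unfolding z(2) y(2) using pw_carrier[OF z(1)] by simp
  qed
  thus ?thesis using a by (simp add: nonzerodivisor_def)
qed

text \<open>Independence of the reduction number. For \<open>x\<close> in \<open>L^(r+1)\<close> the
  element \<open>a^s x\<close> lies in \<open>L^(r+s+1) = b L^(r+s) = b a^s L^r\<close>, and
  \<open>a^s\<close> can be cancelled.\<close>

lemma principal_reduction_transfer:
  assumes "regular_ideal R L" and ab: "a \<in> carrier R" "b \<in> carrier R"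
    and red: "reduction R L (PIdl a)" "reduction R L (PIdl b)"
    and r: "pw (Suc r) = (PIdl a) \<cdot> pw r"
  shows "principal_reduction R m L b r"
proof -
  have sub: "c \<in> L" if "c \<in> carrier R" "reduction R L (PIdl c)" for c
    using that cgenideal_self[OF that(1)] by (auto simp: reduction_def)
  have bL: "b \<in> L" using sub ab(2) red(2) .
  interpret A: principal_reduction R m L a r
    by (intro principal_reduction.intro fiber_ring_axioms principal_reduction_axioms.intro)
      (use sub[OF ab(1) red(1)] reduction_generator_nonzerodivisor[OF assms(1) ab(1) red(1)] r
         PIdl_prod[OF pw_ideal ab(1)] in simp_all)
  obtain s where s: "pw (s + 1) = (PIdl b) \<cdot> pw s" using red(2) by (auto simp: reduction_def)
  have "pw (Suc (r + s)) = b <# pw (r + s)"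
    using reduction_stable[OF cgenideal_ideal[OF ab(2)] s, of "r + s"] PIdl_prod[OF pw_ideal ab(2)] by simp
  moreover have "pw (Suc r) \<subseteq> b <# pw r"
  proof
    fix x assume x: "x \<in> pw (Suc r)"
    have xc: "x \<in> carrier R" using pw_carrier[OF x] .
    have "a [^] s \<otimes> x \<in> pw (s + Suc r)"
      by (rule pw_mult[OF pow_in_ideal_pow[OF L_ideal A.a] x])
    hence "a [^] s \<otimes> x \<in> b <# pw (r + s)" using calculation by (simp add: add.commute)
    then obtain z where z: "z \<in> pw (r + s)" "a [^] s \<otimes> x = b \<otimes> z" unfolding l_coset_iff by blast
    obtain w where w: "w \<in> pw r" "z = a [^] s \<otimes> w" using A.pw_add_power[OF order_refl z(1)] by blast
    have wc: "w \<in> carrier R" using pw_carrier[OF w(1)] .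
    have as: "a [^] s \<in> carrier R" using ab(1) by simp
    have "a [^] s \<otimes> (x \<ominus> b \<otimes> w) = a [^] s \<otimes> x \<ominus> b \<otimes> (a [^] s \<otimes> w)" using xc wc as ab(2) by algebra
    also have "\<dots> = \<zero>" unfolding z(2) w(2) using as wc ab(2) by (simp add: a_minus_def r_neg)
    finally have "x \<ominus> b \<otimes> w = \<zero>" using A.a_pow_cancel[of "x \<ominus> b \<otimes> w" s] xc wc ab(2) by simp
    moreover have "x = (x \<ominus> b \<otimes> w) \<oplus> b \<otimes> w" using xc wc ab(2) by algebra
    ultimately have "x = b \<otimes> w" using wc ab(2) by simp
    thus "x \<in> b <# pw r" unfolding l_coset_iff using w(1) by blast
  qed
  moreover have "b <# pw r \<subseteq> pw (Suc r)"
    using PIdl_prod[OF pw_ideal ab(2), of r] ideal_prod_mono[OF cgenideal_minimal[OF L_ideal bL] subset_refl, of "pw r"] by simp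
  ultimately have "pw (Suc r) = b <# pw r" by blast
  thus ?thesis using bL reduction_generator_nonzerodivisor[OF assms(1) ab(2) red(2)]
    by (intro principal_reduction.intro fiber_ring_axioms principal_reduction_axioms.intro)
qed

end

theorem theorem3p6:
  fixes A :: "('a, 'b) ring_scheme" (structure)
    and m I :: "'a set" and r :: nat
  assumes "noetherian_local_ring A m"
    and "infinite (carrier (A Quot m))"
    and "regular_ideal A I"
    and "analytic_spread A m I = 1"
    and "is_reduction_number A I r"
  shows "\<forall>C \<in> {
      (\<lambda>a. \<forall>n. 1 \<le> n \<and> n \<le> r - 1 \<longrightarrow>
        ideal_pow A I n \<inter> colon A (m \<cdot> ideal_pow A I (n + 1)) a = m \<cdot> ideal_pow A I n),
      (\<lambda>a. module_length (fiber_cone A m I)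
          (quot_module (fiber_cone A m I) (carrier (fiber_cone A m I))
             (PIdl\<^bsub>fiber_cone A m I\<^esub> (fiber_class A m I a)))
        = enat (mu_pow A I (int r))),
      (\<lambda>a. \<forall>k. 1 \<le> k \<and> k \<le> r - 1 \<longrightarrow>
        ideal_pow A I k \<inter> colon A (m \<cdot> ideal_pow A I r) (a [^] (r - k)) = m \<cdot> ideal_pow A I k),
      (\<lambda>a. \<forall>n. 1 \<le> n \<and> n \<le> r - 1 \<longrightarrow>
        (a <# ideal_pow A I n) \<inter> (m \<cdot> ideal_pow A I (n + 1)) = a <# (m \<cdot> ideal_pow A I n)),
      (\<lambda>a. \<forall>n. 1 \<le> n \<and> n \<le> r \<longrightarrow>
        ereal_of_enat (module_length A
          (quot_module A (ideal_pow A I n)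
             ((m \<cdot> ideal_pow A I n) <+> (a <# ideal_pow A I (n - 1)))))
        = ereal (real (mu_pow A I (int n)) - real (mu_pow A I (int n - 1)))),
      (\<lambda>a. (\<forall>i\<le>r. mu_pow A I (int i - 1) \<le> mu_pow A I (int i)) \<and>
        graded_isomorphic (fiber_cone A m (PIdl a))
          (fiber_module A m I)
          (graded_sum (SIGMA i:{0..r}. {..<mu_pow A I (int i) - mu_pow A I (int i - 1)})
             (\<lambda>(i, _). graded_shift (fiber_module A m (PIdl a)) (- int i))))
    }.
      (cohen_macaulay (fiber_cone A m I) \<longleftrightarrow>
         (\<forall>a\<in>carrier A. minimal_reduction A I (PIdl a) \<longrightarrow> C a)) \<and>
      (cohen_macaulay (fiber_cone A m I) \<longleftrightarrow>
         (\<exists>a\<in>carrier A. minimal_reduction A I (PIdl a) \<and> C a))"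
proof -
  have "ideal I A" using assms(3) by (simp add: regular_ideal_def)
  then interpret fiber_ring A m I
    by (intro fiber_ring.intro fiber_ring_axioms.intro assms(1))
  have dim: "krull_dim F = 1" using assms(4) by (simp add: analytic_spread_def)
  obtain J where J: "minimal_reduction A I J" "r = (LEAST n. pw (n + 1) = J \<cdot> pw n)"
    using assms(5) by (auto simp: is_reduction_number_def)
  \<comment> \<open>The reduction number is attained by a minimal reduction; being principal, it is
    the witness for the existential reading.\<close>
  obtain b where b: "b \<in> carrier A" "J = PIdl b"
    using minimal_reduction_principal[OF assms(2,3) dim J(1)] by blast
  have "\<exists>n. pw (n + 1) = J \<cdot> pw n" using J(1) by (auto simp: minimal_reduction_def reduction_def)
  hence r: "pw (Suc r) = (PIdl b) \<cdot> pw r" using LeastI_ex[of "\<lambda>n. pw (n + 1) = J \<cdot> pw n"] J(2) b(2) by simp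
  have red: "reduction A I (PIdl a)" if "minimal_reduction A I (PIdl a)" for a
    using that by (simp add: minimal_reduction_def)
  have pr: "principal_reduction A m I a r" if "a \<in> carrier A" "minimal_reduction A I (PIdl a)" for a
    by (rule principal_reduction_transfer[OF assms(3) b(1) that(1) red red[OF that(2)] r]) (use J(1) b(2) in simp)
  \<comment> \<open>For each admissible \<open>a\<close> the condition \<open>C a\<close> is
    equivalent to a property that does not mention \<open>a\<close>; as \<open>b\<close> is
    admissible, both readings coincide with it.\<close>
  have equiv: "(cohen_macaulay F \<longleftrightarrow> (\<forall>a\<in>carrier A. minimal_reduction A I (PIdl a) \<longrightarrow> C a)) \<and>
      (cohen_macaulay F \<longleftrightarrow> (\<exists>a\<in>carrier A. minimal_reduction A I (PIdl a) \<and> C a))"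
    if C: "\<And>a. principal_reduction A m I a r \<Longrightarrow> C a \<longleftrightarrow> (\<forall>n. principal_reduction.inj_at A m I a n)" for C
  proof -
    have "C a \<longleftrightarrow> cohen_macaulay F" if "a \<in> carrier A" "minimal_reduction A I (PIdl a)" for a
      using C[OF pr[OF that]] principal_reduction.cohen_macaulay_iff[OF pr[OF that] dim] by simp
    moreover have "minimal_reduction A I (PIdl b)" using J(1) b(2) by simp
    ultimately show ?thesis using b(1) by blast
  qed
  show ?thesis
    apply (intro ballI)
    apply (elim insertE emptyE; simp only:)
         apply (rule equiv, simp only: principal_reduction.all_inj_iff principal_reduction.colon_condition_iff)
        apply (rule equiv, rule principal_reduction.fiber_length_condition_iff, assumption)
       apply (rule equiv, rule principal_reduction.colon_power_condition_iff, assumption)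
      apply (rule equiv, simp only: principal_reduction.all_inj_iff principal_reduction.coset_condition_iff)
     apply (rule equiv, rule principal_reduction.length_condition_iff, assumption)
    apply (rule equiv, rule principal_reduction.decomposition_condition_iff, assumption)
    done
qed

end
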